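(* Let $q$ be a prime power, and let $\mathcal C_X$ and $\mathcal C_Z$ be $[n,k_X,d_X]_q$ and $[n,k_Z,d_Z]_q$ linear codes with parity-check matrices $\mathbf H_X$ and $\mathbf H_Z$, respectively. Let $r$ be an integer. Assume that, for every $i\in[n]$, there exist $\mathbf h_i^X\in\mathcal C_X^\perp$ and $\mathbf h_i^Z\in\mathcal C_Z^\perp$ such that $$i\in\mathrm{supp}(\mathbf h_i^X)\cap\mathrm{supp}(\mathbf h_i^Z)\quad\text{and}\quad|\mathrm{supp}(\mathbf h_i^X)\cup\mathrm{supp}(\mathbf h_i^Z)|\le r+1.$$ Then the EA-CSS code $\mathcal Q(\mathcal C_X,\mathcal C_Z)$ is an $[[n,\kappa,\delta;c]]_q$ EAQLRC of locality $r$, where $$c=n-k_X-\dim(\mathcal C_X^\perp\cap\mathcal C_Z)=n-k_Z-\dim(\mathcal C_X\cap\mathcal C_Z^\perp),\qquad \kappa=k_X+k_Z-n+c,$$ and $\delta=\min\{d_X,d_Z\}$ if $\mathcal C_X\subseteq\mathcal C_Z^\perp$, while otherwise $$\delta=\min\{\mathrm{wt}(\mathcal C_X\setminus(\mathcal C_X\cap\mathcal C_Z^\perp)),\ \mathrm{wt}(\mathcal C_Z\setminus(\mathcal C_X^\perp\cap\mathcal C_Z))\}.$$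
   Context: Notation. $[m]=\{1,\dots,m\}$. An $[n,k,d]_q$ linear code is a $k$-dimensional subspace of $\mathbb F_q^n$ with minimum distance $d$; $\mathcal C^\perp$ is the Euclidean dual; a parity-check matrix of an $[n,k]_q$ code $\mathcal C$ is an $(n-k)\times n$ matrix $\mathbf H$ with $\mathcal C=\ker\mathbf H$ and $\mathcal C^\perp$ equal to the row space of $\mathbf H$. $\mathrm{supp}(\mathbf u)=\{i:u_i\neq0\}$; for a set $S\subseteq\mathbb F_q^n$ containing a nonzero vector, $\mathrm{wt}(S)$ is the minimum Hamming weight of its nonzero vectors. Registers and Paulis. A qudit has Hilbert space $\mathbb C^q$ with basis $\{|x\rangle:x\in\mathbb F_q\}$, $q=p^m$. $Q=Q_{[n]}=(Q_1,\dots,Q_n)$ is the transmitted register, $B=B_{[c]}$ is Bob's noiseless register of $c$ qudits, $\mathcal H_A$ is the Hilbert space of a register $A$. With ${\rm tr}:\mathbb F_q\to\mathbb F_p$ the trace and $\omega_p=e^{2\pi i/p}$: $X(a)|x\rangle=|x+a\rangle$, $Z(b)|x\rangle=\omega_p^{{\rm tr}(bx)}|x\rangle$; $X_A(\mathbf a)=\bigotimes_jX(a_j)$, $Z_A(\mathbf b)=\bigotimes_jZ(b_j)$. EAQECC. An $[[n,\kappa,\delta;c]]_q$ EAQECC $\mathcal Q\subseteq\mathcal H_{Q_{[n]}}\otimes\mathcal H_{B_{[c]}}$ ($0\le c\le n-\kappa$) is the image of an isometry $V:(\mathbb C^q)^{\otimes\kappa}\to(\mathbb C^q)^{\otimes n}\otimes(\mathbb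 C^q)^{\otimes c}$ of the form $V|\phi\rangle=q^{-c/2}\sum_{\mathbf x\in\mathbb F_q^c}U_{\rm enc}(|\phi\rangle\otimes|0\rangle^{\otimes(n-\kappa-c)}\otimes|\mathbf x\rangle)\otimes|\mathbf x\rangle_{B_{[c]}}$ with $U_{\rm enc}$ unitary on $n$ qudits; it has minimum distance $\delta$, meaning it can correct every set of erasures of at most $\delta-1$ transmitted qudits. EA-CSS code. Given $\mathcal C_X,\mathcal C_Z$ with parity-check matrices $\mathbf H_X,\mathbf H_Z$, put $c=\mathrm{rank}(\mathbf H_X\mathbf H_Z^\top)$ and choose a rank factorization $-\mathbf H_X\mathbf H_Z^\top=\mathbf F_X\mathbf F_Z^\top$ with $\mathbf F_X\in\mathbb F_q^{(n-k_X)\times c}$, $\mathbf F_Z\in\mathbb F_q^{(n-k_Z)\times c}$. The EA-CSS code $\mathcal Q(\mathcal C_X,\mathcal C_Z)$ is the subspace of $\mathcal H_Q\otimes\mathcal H_B$ fixed pointwise by all elements of $$S_{\rm EA}=\{X_Q(\mathbf u\mathbf H_X)Z_Q(\mathbf v\mathbf H_Z)\otimes X_B(\mathbf u\mathbf F_X)Z_B(\mathbf v\mathbf F_Z):\mathbf u\in\mathbb F_q^{n-k_X},\mathbf v\in\mathbb F_q^{n-k_Z}\}.$$ (It is a known result of Galindo, Hernando, Matsumoto and Ruano that this is an EAQECC with the parameters $n,\kappa,\delta,c$ given in the claim.) Locality. $\mathcal M(A)$ is the set of density operators on $\mathcal H_A$; a quantum channel is a completely positive trace-preserving linear map. The erasure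 of qudit $i$ is $\Gamma_i(\rho)=\frac{I_{Q_i}}{q}\otimes{\rm Tr}_{Q_i}(\rho)$. A set $R\subseteq[n]\setminus\{i\}$ is a recovery set for $Q_i$ if there is a quantum channel ${\rm Rec}_{i,R}$ from $\mathcal M(Q_{\{i\}\cup R}\cup B_{[c]})$ to itself such that $({\rm Rec}_{i,R}\otimes{\rm id}_{Q_{[n]\setminus(\{i\}\cup R)}})(\Gamma_i(|\psi\rangle\langle\psi|))=|\psi\rangle\langle\psi|$ for every unit vector $|\psi\rangle\in\mathcal Q$. An $[[n,\kappa,\delta;c]]_q$ EAQECC is an EAQLRC with (of) locality $r$ if for every $i\in[n]$ there is a recovery set $R_i\subseteq[n]\setminus\{i\}$ for $Q_i$ with $|R_i|\le r$. *)

theory Defs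
  imports
    "Jordan_Normal_Form.DL_Rank"
    "Jordan_Normal_Form.Matrix_Kernel"
    "HOL-Library.Cardinality"
    "HOL-Library.Nonpos_Ints"
    Complex_Main
begin

text \<open>
  The field with \<open>q\<close> elements is a type \<open>'a\<close> of sort \<open>{finite, field}\<close>, with \<open>q = CARD('a)\<close>.
  Coordinates are numbered \<open>0, \<dots>, n - 1\<close>.
\<close>

section \<open>Linear codes\<close>

definition supp :: "'a :: zero vec \<Rightarrow> nat set" where
  "supp v = {i. i < dim_vec v \<and> v $ i \<noteq> 0}"

text \<open>Meaningful only for finite \<open>S\<close> containing a nonzero vector.\<close>

definition wt :: "'a :: zero vec set \<Rightarrow> nat" where
  "wt S = Min {card (supp v) | v. v \<in> S \<and> supp v \<noteq> {}}"

definition code_dim :: "nat \<Rightarrow> 'a :: field vec set \<Rightarrow> nat" where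
  "code_dim n C = vectorspace.dim class_ring ((module_vec TYPE('a) n)\<lparr>carrier := C\<rparr>)"

text \<open>The minimum distance of a linear code is the minimum weight of a nonzero codeword, so it is
  defined only if the code has one.\<close>

definition linear_code :: "nat \<Rightarrow> nat \<Rightarrow> nat \<Rightarrow> 'a :: field vec set \<Rightarrow> bool" where
  "linear_code n k d C \<longleftrightarrow>
     VectorSpace.subspace class_ring C (module_vec TYPE('a) n) \<and> code_dim n C = k \<and>
     (\<exists>v\<in>C. supp v \<noteq> {}) \<and> d = wt C"

abbreviation dual :: "nat \<Rightarrow> 'a :: field vec set \<Rightarrow> 'a vec set" where
  "dual n C \<equiv> vec_module.orthogonal_complement n C"

definition parity_check_matrix :: "nat \<Rightarrow> nat \<Rightarrow> 'a :: field vec set \<Rightarrow> 'a mat \<Rightarrow> bool" where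
  "parity_check_matrix n k C H \<longleftrightarrow>
     H \<in> carrier_mat (n - k) n \<and> mat_kernel H = C \<and> vec_space.row_space n H = dual n C"

section \<open>Registers, states and operators\<close>

text \<open>
  Qudits are labelled by sites: \<open>Tx j\<close> is the transmitted qudit \<open>Q\<^sub>j\<close>, and \<open>Bob j\<close> is Bob's
  noiseless qudit \<open>B\<^sub>j\<close>. A register is a finite set \<open>A\<close> of sites. The computational basis of its
  Hilbert space is the set \<open>confs A\<close> of functions from \<open>A\<close> to the field (extensional, hence
  determined by their values on \<open>A\<close>). Vectors and operators are given by their entries in this
  basis, and vanish at all other arguments. Tensor factors are sub-registers: restriction of
  configurations identifies \<open>confs (A \<union> B)\<close> with \<open>confs A \<times> confs B\<close> for disjoint \<open>A\<close>, \<open>B\<close>.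
\<close>

datatype site = Tx (idx: nat) | Bob (idx: nat)

type_synonym 'a conf = "site \<Rightarrow> 'a"
type_synonym 'a state = "'a conf \<Rightarrow> complex"
type_synonym 'a oper = "'a conf \<Rightarrow> 'a conf \<Rightarrow> complex"

definition Qreg :: "nat set \<Rightarrow> site set" where "Qreg S = Tx ` S"
definition Breg :: "nat \<Rightarrow> site set" where "Breg c = Bob ` {..<c}"

definition confs :: "site set \<Rightarrow> 'a conf set" where
  "confs A = A \<rightarrow>\<^sub>E UNIV"

definition hilb :: "site set \<Rightarrow> 'a state set" where
  "hilb A = {\<psi>. \<forall>x. x \<notin> confs A \<longrightarrow> \<psi> x = 0}"

definition opers :: "site set \<Rightarrow> 'a oper set" where
  "opers A = {M. \<forall>x y. x \<notin> confs A \<or> y \<notin> confs A \<longrightarrow> M x y = 0}"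

definition st_norm :: "site set \<Rightarrow> 'a state \<Rightarrow> real" where
  "st_norm A \<psi> = sqrt (\<Sum>x\<in>confs A. (cmod (\<psi> x))\<^sup>2)"

definition ket :: "site set \<Rightarrow> 'a conf \<Rightarrow> 'a state" where
  "ket A f = (\<lambda>x. if x = restrict f A then 1 else 0)"

definition st_tensor :: "site set \<Rightarrow> site set \<Rightarrow> 'a state \<Rightarrow> 'a state \<Rightarrow> 'a state" where
  "st_tensor A B \<phi> \<psi> =
     (\<lambda>x. if x \<in> confs (A \<union> B) then \<phi> (restrict x A) * \<psi> (restrict x B) else 0)"

definition op_apply :: "site set \<Rightarrow> 'a oper \<Rightarrow> 'a state \<Rightarrow> 'a state" where
  "op_apply A M \<psi> = (\<lambda>x. \<Sum>y\<in>confs A. M x y * \<psi> y)"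

definition op_one :: "site set \<Rightarrow> 'a oper" where
  "op_one A = (\<lambda>x y. if x \<in> confs A \<and> x = y then 1 else 0)"

definition op_mult :: "site set \<Rightarrow> 'a oper \<Rightarrow> 'a oper \<Rightarrow> 'a oper" where
  "op_mult A M N = (\<lambda>x y. \<Sum>z\<in>confs A. M x z * N z y)"

definition op_adj :: "'a oper \<Rightarrow> 'a oper" where
  "op_adj M = (\<lambda>x y. cnj (M y x))"

definition op_tensor :: "site set \<Rightarrow> site set \<Rightarrow> 'a oper \<Rightarrow> 'a oper \<Rightarrow> 'a oper" where
  "op_tensor A B M N =
     (\<lambda>x y. if x \<in> confs (A \<union> B) \<and> y \<in> confs (A \<union> B)
            then M (restrict x A) (restrict y A) * N (restrict x B) (restrict y B) else 0)"

definition op_trace :: "site set \<Rightarrow> 'a oper \<Rightarrow> complex" where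
  "op_trace A M = (\<Sum>x\<in>confs A. M x x)"

definition unitary_on :: "site set \<Rightarrow> 'a oper \<Rightarrow> bool" where
  "unitary_on A U \<longleftrightarrow> U \<in> opers A \<and>
     op_mult A (op_adj U) U = op_one A \<and> op_mult A U (op_adj U) = op_one A"

definition proj :: "'a state \<Rightarrow> 'a oper" where
  "proj \<psi> = (\<lambda>x y. \<psi> x * cnj (\<psi> y))"

section \<open>Generalized Pauli operators\<close>

definition field_trace :: "'a :: {finite, field} \<Rightarrow> 'a" where
  "field_trace y = (\<Sum>i<(THE m. CARD('a) = CHAR('a) ^ m). y ^ (CHAR('a) ^ i))"

text \<open>\<open>\<omega>\<^sub>p\<close> to the power \<open>tr y\<close>; the trace lies in the prime field, so it is the image of a natural
  number, unique modulo \<open>p\<close>.\<close>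

definition add_char :: "'a :: {finite, field} \<Rightarrow> complex" where
  "add_char y =
     exp (2 * of_real pi * \<i> / of_nat CHAR('a)) ^ (LEAST t :: nat. of_nat t = field_trace y)"

text \<open>Matrix entries: \<open>X(a)\<close> sends \<open>|y\<rangle>\<close> to \<open>|y + a\<rangle>\<close>, and \<open>Z(b)\<close> multiplies \<open>|y\<rangle>\<close> by a phase.\<close>

definition X1 :: "'a :: {finite, field} \<Rightarrow> 'a \<Rightarrow> 'a \<Rightarrow> complex" where
  "X1 a x y = (if x = y + a then 1 else 0)"

definition Z1 :: "'a :: {finite, field} \<Rightarrow> 'a \<Rightarrow> 'a \<Rightarrow> complex" where
  "Z1 b x y = (if x = y then add_char (b * y) else 0)"

definition pauli_X :: "site set \<Rightarrow> 'a :: {finite, field} vec \<Rightarrow> 'a oper" where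
  "pauli_X A a = (\<lambda>x y. if x \<in> confs A \<and> y \<in> confs A
     then (\<Prod>s\<in>A. X1 (a $ idx s) (x s) (y s)) else 0)"

definition pauli_Z :: "site set \<Rightarrow> 'a :: {finite, field} vec \<Rightarrow> 'a oper" where
  "pauli_Z A b = (\<lambda>x y. if x \<in> confs A \<and> y \<in> confs A
     then (\<Prod>s\<in>A. Z1 (b $ idx s) (x s) (y s)) else 0)"

section \<open>Quantum channels\<close>

definition psd :: "'x set \<Rightarrow> ('x \<Rightarrow> 'x \<Rightarrow> complex) \<Rightarrow> bool" where
  "psd X M \<longleftrightarrow> (\<forall>v. (\<Sum>x\<in>X. \<Sum>y\<in>X. cnj (v x) * M x y * v y) \<in> \<real>\<^sub>\<ge>\<^sub>0)"

definition linear_on_opers :: "site set \<Rightarrow> ('a oper \<Rightarrow> 'a oper) \<Rightarrow> bool" where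
  "linear_on_opers A \<Phi> \<longleftrightarrow>
     (\<forall>M\<in>opers A. \<Phi> M \<in> opers A) \<and>
     (\<forall>M\<in>opers A. \<forall>N\<in>opers A. \<forall>\<alpha> \<beta>.
        \<Phi> (\<lambda>x y. \<alpha> * M x y + \<beta> * N x y) = (\<lambda>x y. \<alpha> * \<Phi> M x y + \<beta> * \<Phi> N x y))"

text \<open>\<open>\<Phi> \<otimes> id\<close> preserves positivity for every ancilla dimension \<open>m\<close>. It acts on an operator on
  \<open>\<H>\<^sub>A \<otimes> \<complex>\<^sup>m\<close> by applying \<open>\<Phi>\<close> to each of the \<open>m \<times> m\<close> blocks.\<close>

definition completely_positive :: "site set \<Rightarrow> ('a oper \<Rightarrow> 'a oper) \<Rightarrow> bool" where
  "completely_positive A \<Phi> \<longleftrightarrow>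
     (\<forall>(m :: nat) M. psd (confs A \<times> {..<m}) M \<longrightarrow>
        psd (confs A \<times> {..<m}) (\<lambda>(x, k) (y, l).
          \<Phi> (\<lambda>a b. if a \<in> confs A \<and> b \<in> confs A then M (a, k) (b, l) else 0) x y))"

definition trace_preserving :: "site set \<Rightarrow> ('a oper \<Rightarrow> 'a oper) \<Rightarrow> bool" where
  "trace_preserving A \<Phi> \<longleftrightarrow> (\<forall>M\<in>opers A. op_trace A (\<Phi> M) = op_trace A M)"

definition quantum_channel :: "site set \<Rightarrow> ('a oper \<Rightarrow> 'a oper) \<Rightarrow> bool" where
  "quantum_channel A \<Phi> \<longleftrightarrow>
     linear_on_opers A \<Phi> \<and> completely_positive A \<Phi> \<and> trace_preserving A \<Phi>"

text \<open>\<open>\<Phi> \<otimes> id\<^sub>E\<close> on \<open>A \<union> E\<close>, for disjoint \<open>A\<close>, \<open>E\<close> and \<open>\<Phi>\<close> acting on operators on \<open>A\<close>, again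
  blockwise: the block of \<open>\<rho>\<close> is selected by the values of \<open>x\<close> and \<open>y\<close> on \<open>E\<close>.\<close>

definition chan_ext ::
    "site set \<Rightarrow> site set \<Rightarrow> ('a oper \<Rightarrow> 'a oper) \<Rightarrow> 'a oper \<Rightarrow> 'a oper" where
  "chan_ext A E \<Phi> \<rho> = (\<lambda>x y. if x \<in> confs (A \<union> E) \<and> y \<in> confs (A \<union> E)
     then \<Phi> (\<lambda>a b. if a \<in> confs A \<and> b \<in> confs A
                    then \<rho> (override_on x a A) (override_on y b A) else 0)
            (restrict x A) (restrict y A)
     else 0)"

definition ptrace :: "site set \<Rightarrow> site set \<Rightarrow> 'a oper \<Rightarrow> 'a oper" where
  "ptrace A T \<rho> = (\<lambda>x y. if x \<in> confs (A - T) \<and> y \<in> confs (A - T)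
     then (\<Sum>t\<in>confs T. \<rho> (override_on x t T) (override_on y t T)) else 0)"

text \<open>The erasure of the qudits in \<open>T \<subseteq> A\<close>, which replaces them by the maximally mixed state.\<close>

definition erase :: "site set \<Rightarrow> site set \<Rightarrow> 'a :: finite oper \<Rightarrow> 'a oper" where
  "erase A T \<rho> =
     op_tensor T (A - T) (\<lambda>x y. op_one T x y / of_nat (CARD('a) ^ card T)) (ptrace A T \<rho>)"

section \<open>Entanglement-assisted codes\<close>

text \<open>\<open>|\<phi>\<rangle> \<otimes> |0\<rangle> \<otimes> |x\<rangle>\<close>, the three factors occupying the qudits \<open>[0, \<kappa>)\<close>, \<open>[\<kappa>, n - c)\<close> and
  \<open>[n - c, n)\<close> of the transmitted register.\<close>

definition enc_input ::
    "nat \<Rightarrow> nat \<Rightarrow> nat \<Rightarrow> 'a :: {finite, field} state \<Rightarrow> 'a vec \<Rightarrow> 'a state" where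
  "enc_input n \<kappa> c \<phi> x =
     st_tensor (Qreg {..<\<kappa>}) (Qreg {\<kappa>..<n}) \<phi>
       (st_tensor (Qreg {\<kappa>..<n - c}) (Qreg {n - c..<n})
          (ket (Qreg {\<kappa>..<n - c}) (\<lambda>s. 0))
          (ket (Qreg {n - c..<n}) (\<lambda>s. x $ (idx s - (n - c)))))"

definition encode ::
    "nat \<Rightarrow> nat \<Rightarrow> nat \<Rightarrow> 'a oper \<Rightarrow> 'a :: {finite, field} state \<Rightarrow> 'a state" where
  "encode n \<kappa> c U \<phi> = (\<lambda>z. of_real (real CARD('a) powr (- real c / 2)) *
     (\<Sum>x\<in>carrier_vec c.
        st_tensor (Qreg {..<n}) (Breg c)
          (op_apply (Qreg {..<n}) U (enc_input n \<kappa> c \<phi> x))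
          (ket (Breg c) (\<lambda>s. x $ idx s)) z))"

definition corrects_erasure ::
    "nat \<Rightarrow> nat \<Rightarrow> 'a :: {finite, field} state set \<Rightarrow> nat set \<Rightarrow> bool" where
  "corrects_erasure n c \<Q> T \<longleftrightarrow>
     (let A = Qreg {..<n} \<union> Breg c in
      \<exists>\<Phi>. quantum_channel A \<Phi> \<and>
        (\<forall>\<psi>\<in>\<Q>. st_norm A \<psi> = 1 \<longrightarrow> \<Phi> (erase A (Qreg T) (proj \<psi>)) = proj \<psi>))"

text \<open>Distance \<open>\<delta>\<close> means that all sets of at most
  \<open>\<delta> - 1\<close> erased transmitted qudits are correctable; maximality of \<open>\<delta>\<close> is not part of it (for \<open>\<kappa> = 0\<close>
  every erasure is correctable).\<close>

definition eaqecc ::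
    "nat \<Rightarrow> nat \<Rightarrow> nat \<Rightarrow> nat \<Rightarrow> 'a :: {finite, field} state set \<Rightarrow> bool" where
  "eaqecc n \<kappa> \<delta> c \<Q> \<longleftrightarrow>
     \<kappa> \<le> n \<and> c \<le> n - \<kappa> \<and>
     (\<exists>U. unitary_on (Qreg {..<n}) U \<and>
        (\<forall>\<phi>\<in>hilb (Qreg {..<\<kappa>}).
           st_norm (Qreg {..<n} \<union> Breg c) (encode n \<kappa> c U \<phi>) = st_norm (Qreg {..<\<kappa>}) \<phi>) \<and>
        \<Q> = encode n \<kappa> c U ` hilb (Qreg {..<\<kappa>})) \<and>
     (\<forall>T\<subseteq>{..<n}. card T < \<delta> \<longrightarrow> corrects_erasure n c \<Q> T)"

definition recovery_set ::
    "nat \<Rightarrow> nat \<Rightarrow> 'a :: {finite, field} state set \<Rightarrow> nat \<Rightarrow> nat set \<Rightarrow> bool" where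
  "recovery_set n c \<Q> i R \<longleftrightarrow> R \<subseteq> {..<n} - {i} \<and>
     (let A = Qreg {..<n} \<union> Breg c;
          L = Qreg (insert i R) \<union> Breg c;
          E = Qreg ({..<n} - insert i R)
      in \<exists>\<Phi>. quantum_channel L \<Phi> \<and>
           (\<forall>\<psi>\<in>\<Q>. st_norm A \<psi> = 1 \<longrightarrow>
              chan_ext L E \<Phi> (erase A (Qreg {i}) (proj \<psi>)) = proj \<psi>))"

definition eaqlrc ::
    "nat \<Rightarrow> nat \<Rightarrow> nat \<Rightarrow> nat \<Rightarrow> int \<Rightarrow> 'a :: {finite, field} state set \<Rightarrow> bool" where
  "eaqlrc n \<kappa> \<delta> c r \<Q> \<longleftrightarrow>
     eaqecc n \<kappa> \<delta> c \<Q> \<and> (\<forall>i<n. \<exists>R. recovery_set n c \<Q> i R \<and> int (card R) \<le> r)"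

text \<open>The row vector \<open>u H\<close> is written as \<open>H\<^sup>T u\<close>.\<close>

definition ea_css_stabilizer ::
    "nat \<Rightarrow> nat \<Rightarrow> 'a :: {finite, field} mat \<Rightarrow> 'a mat \<Rightarrow> 'a mat \<Rightarrow> 'a mat \<Rightarrow> 'a oper set" where
  "ea_css_stabilizer n c HX HZ FX FZ =
     {op_tensor (Qreg {..<n}) (Breg c)
        (op_mult (Qreg {..<n}) (pauli_X (Qreg {..<n}) (HX\<^sup>T *\<^sub>v u)) (pauli_Z (Qreg {..<n}) (HZ\<^sup>T *\<^sub>v v)))
        (op_mult (Breg c) (pauli_X (Breg c) (FX\<^sup>T *\<^sub>v u)) (pauli_Z (Breg c) (FZ\<^sup>T *\<^sub>v v)))
      | u v. u \<in> carrier_vec (dim_row HX) \<and> v \<in> carrier_vec (dim_row HZ)}"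

definition ea_css ::
    "nat \<Rightarrow> nat \<Rightarrow> 'a :: {finite, field} mat \<Rightarrow> 'a mat \<Rightarrow> 'a mat \<Rightarrow> 'a mat \<Rightarrow> 'a state set" where
  "ea_css n c HX HZ FX FZ =
     {\<psi> \<in> hilb (Qreg {..<n} \<union> Breg c).
        \<forall>S\<in>ea_css_stabilizer n c HX HZ FX FZ. op_apply (Qreg {..<n} \<union> Breg c) S \<psi> = \<psi>}"

end

theory Submission
  imports Defs "HOL-Number_Theory.Cong" "HOL-Computational_Algebra.Polynomial"
    "HOL-Library.Function_Algebras" "HOL-Library.Product_Plus"
begin

text \<open>
  A state of the code is a function that is supported on the annihilator of the pairs
  \<open>(v H\<^sub>Z, v F\<^sub>Z)\<close> and invariant under translation by the pairs \<open>(u H\<^sub>X, u F\<^sub>X)\<close>. Normalised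
  indicators of cosets form a basis; since \<open>F\<^sub>Z\<close> is injective and \<open>u \<mapsto> u F\<^sub>X\<close> is onto, their slices at
  fixed Bob symbols are orthogonal with equal norms, so they complete to the encoding unitary. All
  dimensions are obtained by counting points.

  Erasing a set \<open>T\<close> is a uniform mixture of the operators \<open>X(a) Z(b)\<close> supported on \<open>T\<close>. If every such
  error that commutes with a group \<open>S\<close> of stabilizers supported on a register \<open>L \<supseteq> T\<close> fixes the code,
  then measuring the syndromes of \<open>S\<close> and undoing one error per syndrome is a channel on \<open>L\<close> that
  recovers the state. For the distance, \<open>S\<close> is the whole stabilizer: a commuting error has
  \<open>a \<in> C\<^sub>Z\<close> and \<open>b \<in> C\<^sub>X\<close>, and its small weight puts it in the stabilizer. For the
  locality at \<open>i\<close>, \<open>S\<close> consists of the multiples of \<open>h\<^sub>i\<^sup>X\<close> and \<open>h\<^sub>i\<^sup>Z\<close>, with which no nontrivial error at \<open>i\<close>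
  commutes.
\<close>

section \<open>The additive character of a finite field\<close>

text \<open>Three points shape the argument. A stabilizer condition or a syndrome only yields phases
  \<open>add_char z = 1\<close>, which test a trace and not \<open>z\<close> itself. Since the trace
  is not identically zero, the phases of all scalar multiples together give \<open>z = 0\<close>;
  hence the stabilizer groups used here are closed under scalars. The minus sign in the
  factorization of \<open>HX * HZ\<^sup>T\<close> makes the extended rows (u HX, u FX) and (v HZ, v
  FZ) orthogonal, so the stabilizers X(a) Z(b) multiply without phases and averages over them are
  projections. Finally, a row u HX lies in the kernel of \<open>HZ\<close> exactly if its Bob part u
  FX is zero. This equivalence gives the formulas for \<open>c\<close>, and it shows that an X error
  given by such a row is already a stabilizer although it touches transmitted qudits only. Such
  errors are harmless, which is why the weights in the distance exclude them (and their Z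
  counterparts). Bob's register belongs to every recovery register, so the Bob part of a stabilizer
  never spoils its locality.\<close>

lemma prime_CHAR_finite_field: "prime CHAR('a :: {finite, field})"
  by (simp add: finite_imp_CHAR_pos prime_CHAR_semidom)

text \<open>Multiplication by \<open>x \<noteq> 0\<close> permutes the nonzero elements, whose
  product is then cancelled.\<close>

lemma power_CARD_eq_same: "x ^ CARD('a) = (x :: 'a :: {finite, field})"
proof (cases "x = 0")
  case False
  have "x * (\<Prod>y\<in>UNIV-{0}. x * y) = x * x ^ (card (UNIV :: 'a set) - 1) * \<Prod>(UNIV-{0})"
    by (simp add: prod.distrib mult_ac)
  also have "x * x ^ (card (UNIV :: 'a set) - 1) = x ^ CARD('a)"
    using finite_UNIV_card_ge_0[where ?'a = 'a] by (simp flip: power_Suc)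
  also have "(\<Prod>y\<in>UNIV-{0}. x * y) = (\<Prod>y\<in>UNIV-{0}. y)"
    by (rule prod.reindex_bij_witness[of _ "\<lambda>y. y / x" "\<lambda>y. x * y"]) (use False in auto)
  finally show ?thesis by simp
qed (simp add: zero_power)

text \<open>An additive subgroup \<open>H\<close> of maximal p-power order is everything: adjoining
  the p multiples of some \<open>x\<close> outside \<open>H\<close> gives a subgroup p times as
  large. These multiples lie in distinct cosets of \<open>H\<close>, because differences of the
  multipliers are invertible modulo p.\<close>

lemma CARD_eq_CHAR_power: "\<exists>m. CARD('a :: {finite, field}) = CHAR('a) ^ m"
proof -
  let ?p = "CHAR('a)"
  have p: "prime ?p" by (rule prime_CHAR_finite_field)
  define sg where "sg H \<longleftrightarrow> (0::'a) \<in> H \<and> (\<forall>x\<in>H. \<forall>y\<in>H. x + y \<in> H)" for H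
  define P where "P H \<longleftrightarrow> sg H \<and> (\<exists>k. card H = ?p ^ k)" for H :: "'a set"
  have mult: "of_nat k * x \<in> H" if "sg H" "x \<in> H" for H x k
    using that by (induction k) (auto simp: sg_def algebra_simps)
  \<comment> \<open>Subtracting \<open>y\<close> is adding it p - 1 times, so closure under addition
    makes \<open>sg\<close> mean subgroup.\<close>
  have minus: "x - y \<in> H" if "sg H" "x \<in> H" "y \<in> H" for H x y
  proof -
    have "(of_nat (?p - 1) :: 'a) = - 1"
    proof -
      have "(of_nat (?p - 1) :: 'a) + 1 = of_nat (Suc (?p - 1))" by simp
      also have "Suc (?p - 1) = ?p" using prime_gt_0_nat[OF p] by simp
      finally show ?thesis by (simp add: eq_neg_iff_add_eq_0)
    qed
    then have "x + of_nat (?p - 1) * y = x - y" by simp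
    with mult[OF that(1,3), of "?p - 1"] that show ?thesis unfolding sg_def by metis
  qed
  have "P {0}" by (auto simp: P_def sg_def intro!: exI[of _ 0])
  moreover have "\<forall>G. P G \<longrightarrow> card G < Suc CARD('a)"
    by (simp add: card_mono less_Suc_eq_le)
  ultimately have "\<exists>H. P H \<and> (\<forall>G. P G \<longrightarrow> card G \<le> card H)"
    by (rule ex_has_greatest_nat)
  then obtain H where PH: "P H" and max: "\<And>G. P G \<Longrightarrow> card G \<le> card H"
    by metis
  from PH obtain k where sgH: "sg H" and k: "card H = ?p ^ k" unfolding P_def by blast
  have "H = UNIV"
  proof (rule ccontr)
    assume "H \<noteq> UNIV"
    then obtain x where x: "x \<notin> H" by auto
    let ?f = "\<lambda>(h, i). h + of_nat i * x"
    let ?G = "?f ` (H \<times> {..<?p})"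
    have aux: False if "h + of_nat i * x = h' + of_nat j * x" "h \<in> H" "h' \<in> H" "i < j" "j < ?p" for h h' i j
    proof -
      have "of_nat (j - i) * x = h - h'" using that by (simp add: of_nat_diff algebra_simps)
      then have 1: "of_nat (j - i) * x \<in> H" using minus sgH that by metis
      have "coprime (j - i) ?p"
        using that p by (intro prime_imp_coprime_nat[THEN coprime_commute[THEN iffD1]])
           (auto dest: dvd_imp_le)
      then obtain l where "[(j - i) * l = 1] (mod ?p)" using cong_solve_coprime_nat by auto
      then have "(of_nat ((j - i) * l) :: 'a) = of_nat 1" by (simp only: of_nat_eq_iff_cong_CHAR One_nat_def)
      then have "of_nat l * (of_nat (j - i) * x) = x" by (metis mult.assoc mult.commute mult_1 of_nat_1 of_nat_mult)
      with mult[OF sgH 1, of l] x show False by simp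
    qed
    have inj: "inj_on ?f (H \<times> {..<?p})"
    proof (rule inj_onI)
      fix u v assume u: "u \<in> H \<times> {..<?p}" and v: "v \<in> H \<times> {..<?p}" and eq: "?f u = ?f v"
      obtain h i h' j where uv: "u = (h, i)" "v = (h', j)" by (metis surj_pair)
      have eq': "h + of_nat i * x = h' + of_nat j * x" using eq uv by simp
      have "\<not> i < j" using aux[OF eq'] u v uv by auto
      moreover have "\<not> j < i" using aux[OF eq'[symmetric]] u v uv by auto
      ultimately have "i = j" by simp
      with eq' uv show "u = v" by simp
    qed
    have "card ?G = ?p ^ Suc k" using card_image[OF inj] k by (simp add: card_cartesian_product)
    moreover have "sg ?G"
    proof -
      have "0 \<in> ?G" using sgH p by (intro image_eqI[of _ _ "(0, 0)"]) (auto simp: sg_def prime_gt_0_nat)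
      moreover have "a + b \<in> ?G" if "a \<in> ?G" "b \<in> ?G" for a b
      proof -
        from that obtain h i h' j where *: "h \<in> H" "h' \<in> H" "a = h + of_nat i * x" "b = h' + of_nat j * x" by auto
        have "(of_nat ((i + j) mod ?p) :: 'a) = of_nat (i + j)"
          by (simp only: of_nat_eq_iff_cong_CHAR cong_mod_left cong_refl)
        then have "a + b = ?f (h + h', (i + j) mod ?p)" using * by (simp add: algebra_simps)
        moreover have "(h + h', (i + j) mod ?p) \<in> H \<times> {..<?p}"
          using * sgH p by (auto simp: sg_def prime_gt_0_nat)
        ultimately show ?thesis by (rule image_eqI)
      qed
      ultimately show ?thesis by (auto simp: sg_def)
    qed
    ultimately have "P ?G" unfolding P_def by blast
    then have "card ?G \<le> card H" by (rule max)
    with \<open>card ?G = ?p ^ Suc k\<close> k prime_gt_1_nat[OF p] show False by simp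
  qed
  with k show ?thesis by auto
qed

lemma field_trace_eq:
  assumes "CARD('a) = CHAR('a) ^ m"
  shows "field_trace (y :: 'a :: {finite, field}) = (\<Sum>i<m. y ^ (CHAR('a) ^ i))"
proof -
  have "1 < CHAR('a)" using prime_CHAR_finite_field prime_gt_1_nat by blast
  then have "(THE m. CARD('a) = CHAR('a) ^ m) = m" using assms by (auto intro!: the_equality)
  then show ?thesis by (simp add: field_trace_def)
qed

lemma field_trace_add: "field_trace (x + y) = field_trace x + field_trace (y :: 'a :: {finite, field})"
  unfolding field_trace_def by (simp add: freshmans_dream'[OF prime_CHAR_finite_field refl] sum.distrib)

text \<open>Frobenius shifts the summands cyclically, since \<open>y ^ CARD('a) = y\<close>.\<close>

lemma field_trace_power_CHAR: "field_trace y ^ CHAR('a) = field_trace (y :: 'a :: {finite, field})"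
proof -
  obtain m where m: "CARD('a) = CHAR('a) ^ m" using CARD_eq_CHAR_power by blast
  let ?g = "\<lambda>i. y ^ (CHAR('a) ^ i)"
  have "field_trace y ^ CHAR('a) = (\<Sum>i<m. ?g (Suc i))"
    by (simp add: field_trace_eq[OF m] freshmans_dream_sum[OF prime_CHAR_finite_field refl] mult.commute
        flip: power_mult)
  also have "\<dots> = (\<Sum>i<m. ?g i) + ?g m - ?g 0"
    using sum.lessThan_Suc[of ?g m] sum.lessThan_Suc_shift[of ?g m] by simp
  also have "?g m = ?g 0" using power_CARD_eq_same[of y] by (simp add: m)
  finally show ?thesis by (simp add: field_trace_eq[OF m])
qed

text \<open>X^p - X has at most p roots, and the p images of natural numbers already are
  roots.\<close>

lemma power_CHAR_fixed_imp_of_nat: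
  assumes "x ^ CHAR('a) = (x :: 'a :: {finite, field})"
  shows "\<exists>t. x = of_nat t"
proof -
  let ?p = "CHAR('a)" and ?P = "monom 1 CHAR('a) - monom 1 1 :: 'a poly"
  have p: "1 < ?p" using prime_CHAR_finite_field prime_gt_1_nat by blast
  have deg: "degree ?P \<le> ?p" using p by (intro degree_diff_le) (auto simp: degree_monom_eq)
  have "coeff ?P ?p = 1" using p by simp
  then have nz: "?P \<noteq> 0" by (metis coeff_0 zero_neq_one)
  let ?R = "{z. poly ?P z = 0}"
  have R: "?R = {z. z ^ ?p = z}" by (auto simp: poly_monom)
  have "(of_nat t :: 'a) ^ ?p = of_nat t" for t
    using freshmans_dream_sum[OF prime_CHAR_finite_field refl, of "\<lambda>_. 1 :: 'a" "{..<t}"] by simp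
  then have sub: "of_nat ` {..<?p} \<subseteq> ?R" unfolding R by auto
  have "card (of_nat ` {..<?p} :: 'a set) = ?p"
    by (subst card_image) (auto simp: inj_on_def of_nat_eq_iff_cong_CHAR cong_def)
  moreover have "card ?R \<le> ?p"
    using card_poly_roots_bound[OF nz] deg by linarith
  ultimately have "of_nat ` {..<?p} = ?R"
    using sub by (intro card_seteq) auto
  moreover have "x \<in> ?R" using assms unfolding R by simp
  ultimately show ?thesis by blast
qed

text \<open>Otherwise the trace polynomial, which is nonzero of degree at most p^(m-1), would have
  all p^m field elements as roots.\<close>

lemma field_trace_nontrivial: "\<exists>y :: 'a :: {finite, field}. field_trace y \<noteq> 0"
proof (rule ccontr)
  assume "\<not> ?thesis"
  then have all0: "field_trace y = 0" for y :: 'a by auto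
  obtain m where m: "CARD('a) = CHAR('a) ^ m" using CARD_eq_CHAR_power by blast
  have p: "1 < CHAR('a)" using prime_CHAR_finite_field prime_gt_1_nat by blast
  have "1 < CARD('a)" using card_mono[of UNIV "{0, 1 :: 'a}"] by simp
  then obtain l where l: "m = Suc l" using m by (cases m) auto
  define P where "P = (\<Sum>i<m. monom (1 :: 'a) (CHAR('a) ^ i))"
  have "poly P y = 0" for y using all0[of y] by (simp add: P_def poly_sum poly_monom field_trace_eq[OF m])
  moreover have "coeff P 1 = (\<Sum>i<m. if i = 0 then 1 else 0)"
    unfolding P_def coeff_sum using p by (intro sum.cong) auto
  then have "coeff P 1 = 1" by (simp add: l)
  then have nz: "P \<noteq> 0" by (metis coeff_0 zero_neq_one)
  ultimately have "CARD('a) \<le> degree P"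
    using card_poly_roots_bound[OF nz] by simp
  also have "degree P \<le> CHAR('a) ^ l"
    unfolding P_def using p by (intro degree_sum_le) (auto simp: degree_monom_eq l power_increasing)
  also have "\<dots> < CARD('a)" using p by (simp add: m l)
  finally show False by simp
qed

text \<open>Because \<open>\<omega>\<close> has order p, the exponent that \<open>LEAST\<close>
  selects in \<open>add_char\<close> may be replaced by any natural number representing the trace;
  additivity of the character rests on this freedom.\<close>

lemma add_char_facts:
  fixes \<omega> defines "\<omega> \<equiv> exp (2 * of_real pi * \<i> / of_nat CHAR('a))"
  shows add_char_of_nat: "of_nat t = field_trace (y :: 'a :: {finite, field}) \<Longrightarrow> add_char y = \<omega> ^ t"
    and cmod_root: "cmod \<omega> = 1"
    and root_power_eq_1_iff: "\<omega> ^ t = 1 \<longleftrightarrow> CHAR('a) dvd t"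
proof -
  let ?p = "CHAR('a)"
  have p: "0 < ?p" using prime_CHAR_finite_field prime_gt_0_nat by blast
  have \<omega>: "\<omega> = cis (2 * pi / real ?p)"
    unfolding \<omega>_def cis_conv_exp by (simp add: mult_ac)
  then show "cmod \<omega> = 1" by simp
  have pw: "\<omega> ^ k = cis (2 * pi * real k / real ?p)" for k
    by (simp add: \<omega> DeMoivre mult_ac)
  have wp: "\<omega> ^ ?p = 1" using p by (simp add: pw)
  have mod: "\<omega> ^ k = \<omega> ^ (k mod ?p)" for k
  proof -
    have "\<omega> ^ k = \<omega> ^ (?p * (k div ?p) + k mod ?p)" by simp
    then show ?thesis unfolding power_add power_mult wp by simp
  qed
  have inj: "inj_on (\<lambda>k. \<omega> ^ k) {..<?p}"
    using bij_betw_roots_unity[OF p] unfolding bij_betw_def pw by blast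
  show *: "\<omega> ^ t = 1 \<longleftrightarrow> ?p dvd t" for t
  proof
    assume "\<omega> ^ t = 1"
    then have "\<omega> ^ (t mod ?p) = \<omega> ^ 0" using mod[of t] by simp
    then have "t mod ?p = 0" using inj p by (meson inj_onD lessThan_iff mod_less_divisor)
    then show "?p dvd t" by auto
  next
    assume "?p dvd t" then have "t mod ?p = 0" by simp
    with mod[of t] show "\<omega> ^ t = 1" by simp
  qed
  assume t: "of_nat t = field_trace y"
  let ?s = "LEAST t :: nat. of_nat t = field_trace y"
  have "of_nat ?s = field_trace y" using t by (rule LeastI)
  with t have "[?s = t] (mod ?p)" by (simp flip: of_nat_eq_iff_cong_CHAR)
  then have "\<omega> ^ ?s = \<omega> ^ t" by (metis mod cong_def)
  then show "add_char y = \<omega> ^ t" by (simp add: add_char_def \<omega>_def)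
qed

lemma field_trace_of_nat: "\<exists>t. of_nat t = field_trace (y :: 'a :: {finite, field})"
  using power_CHAR_fixed_imp_of_nat[OF field_trace_power_CHAR] by metis

lemma add_char_add: "add_char (x + y) = add_char x * add_char (y :: 'a :: {finite, field})"
proof -
  obtain s t where "of_nat s = field_trace x" "of_nat t = field_trace y"
    using field_trace_of_nat by metis
  then show ?thesis using add_char_of_nat[of s x] add_char_of_nat[of t y] add_char_of_nat[of "s + t" "x + y"]
    by (simp add: field_trace_add power_add)
qed

lemma cmod_add_char [simp]: "cmod (add_char (y :: 'a :: {finite, field})) = 1"
proof -
  obtain t where "of_nat t = field_trace y" using field_trace_of_nat by metis
  then show ?thesis by (simp add: add_char_of_nat norm_power cmod_root del: norm_exp_eq_Re)
qed

lemma add_char_nonzero [simp]: "add_char y \<noteq> 0"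
  by (metis cmod_add_char norm_zero zero_neq_one)

lemma add_char_zero [simp]: "add_char (0 :: 'a :: {finite, field}) = 1"
  using add_char_add[of 0 "0 :: 'a"] by simp

lemma add_char_minus: "add_char (- y) = cnj (add_char (y :: 'a :: {finite, field}))"
proof -
  have "add_char y * add_char (- y) = 1" using add_char_add[of y "- y"] by simp
  moreover have "add_char y * cnj (add_char y) = 1" by (simp add: complex_norm_square[symmetric])
  ultimately show ?thesis by (metis add_char_nonzero mult_left_cancel)
qed

lemma add_char_sum: "add_char (\<Sum>i\<in>I. f i :: 'a :: {finite, field}) = (\<Prod>i\<in>I. add_char (f i))"
  by (induction I rule: infinite_finite_induct) (auto simp: add_char_add)

text \<open>The step from phases to linear equations: for \<open>z \<noteq> 0\<close> the multiples
  of \<open>z\<close> run through the whole field, and the trace does not vanish on all of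
  it.\<close>

lemma add_char_mult_eq_1_imp:
  assumes "\<And>t. add_char (t * z) = 1"
  shows "z = (0 :: 'a :: {finite, field})"
proof (rule ccontr)
  assume "z \<noteq> 0"
  obtain y :: 'a where y: "field_trace y \<noteq> 0" using field_trace_nontrivial by blast
  obtain t where t: "of_nat t = field_trace y" using field_trace_of_nat by metis
  have "add_char y = 1" using assms[of "y / z"] \<open>z \<noteq> 0\<close> by simp
  then have "CHAR('a) dvd t" using add_char_of_nat[OF t] root_power_eq_1_iff[where 'a = 'a, of t] by simp
  then have "field_trace y = 0" using t by (metis of_nat_eq_0_iff_char_dvd)
  with y show False by simp
qed

text \<open>The usual argument for character orthogonality: reindexing shows that the sum equals
  \<open>z\<close> times itself.\<close>

lemma sum_eq_0_if_shift:
  fixes f :: "'b \<Rightarrow> complex"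
  assumes "bij_betw \<tau> G G" and "\<And>x. x \<in> G \<Longrightarrow> f (\<tau> x) = z * f x" and "z \<noteq> 1"
  shows "sum f G = 0"
proof -
  have "sum f G = (\<Sum>x\<in>G. f (\<tau> x))" using sum.reindex_bij_betw[OF assms(1)] by metis
  also have "\<dots> = z * sum f G" using assms(2) by (simp add: sum_distrib_left)
  finally have "(1 - z) * sum f G = 0" by (simp add: algebra_simps)
  with assms(3) show ?thesis by simp
qed

section \<open>Kraus channels\<close>

lemma finite_confs [simp]: "finite A \<Longrightarrow> finite (confs A :: 'a :: finite conf set)"
  by (simp add: confs_def finite_PiE)

lemma sum_rotate: "(\<Sum>x\<in>A. \<Sum>y\<in>B. \<Sum>z\<in>C. f x y z) = (\<Sum>z\<in>C. \<Sum>x\<in>A. \<Sum>y\<in>B. f x y z)"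
proof -
  have "(\<Sum>x\<in>A. \<Sum>y\<in>B. \<Sum>z\<in>C. f x y z) = (\<Sum>x\<in>A. \<Sum>z\<in>C. \<Sum>y\<in>B. f x y z)"
    by (intro sum.cong refl sum.swap)
  also have "\<dots> = (\<Sum>z\<in>C. \<Sum>x\<in>A. \<Sum>y\<in>B. f x y z)" by (rule sum.swap)
  finally show ?thesis .
qed

definition kraus :: "site set \<Rightarrow> 'j set \<Rightarrow> ('j \<Rightarrow> 'a oper) \<Rightarrow> 'a oper \<Rightarrow> 'a oper" where
  "kraus L J K M = (\<lambda>x y. if x \<in> confs L \<and> y \<in> confs L
     then (\<Sum>j\<in>J. \<Sum>u\<in>confs L. \<Sum>v\<in>confs L. K j x u * M u v * cnj (K j y v)) else 0)"

lemma linear_on_opers_kraus: "linear_on_opers L (kraus L J K)"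
  unfolding linear_on_opers_def
proof (intro conjI ballI allI)
  fix M N :: "'a oper" and \<alpha> \<beta>
  show "kraus L J K M \<in> opers L" by (simp add: opers_def kraus_def)
  show "kraus L J K (\<lambda>x y. \<alpha> * M x y + \<beta> * N x y) =
      (\<lambda>x y. \<alpha> * kraus L J K M x y + \<beta> * kraus L J K N x y)"
    by (intro ext) (simp add: kraus_def sum_distrib_left sum.distrib algebra_simps)
qed

text \<open>\<open>TP\<close> is the Kraus condition, that the products of the adjoint of each K_j
  with K_j sum to the identity, written in entries.\<close>

lemma trace_preserving_kraus:
  fixes K :: "'j \<Rightarrow> 'a :: finite oper"
  assumes "finite L" and TP: "\<And>u v. u \<in> confs L \<Longrightarrow> v \<in> confs L \<Longrightarrow>
    (\<Sum>j\<in>J. \<Sum>x\<in>confs L. cnj (K j x u) * K j x v) = (if u = v then 1 else 0)"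
  shows "trace_preserving L (kraus L J K)"
  unfolding trace_preserving_def
proof
  fix M :: "'a oper"
  let ?C = "confs L :: 'a conf set"
  let ?f = "\<lambda>x j u v. K j x u * M u v * cnj (K j x v)"
  have "op_trace L (kraus L J K M) = (\<Sum>x\<in>?C. \<Sum>j\<in>J. \<Sum>u\<in>?C. \<Sum>v\<in>?C. ?f x j u v)"
    by (simp add: op_trace_def kraus_def)
  also have "\<dots> = (\<Sum>u\<in>?C. \<Sum>x\<in>?C. \<Sum>j\<in>J. \<Sum>v\<in>?C. ?f x j u v)" by (rule sum_rotate)
  also have "\<dots> = (\<Sum>u\<in>?C. \<Sum>v\<in>?C. \<Sum>x\<in>?C. \<Sum>j\<in>J. ?f x j u v)"
    by (intro sum.cong refl sum_rotate)
  also have "\<dots> = (\<Sum>u\<in>?C. \<Sum>v\<in>?C. M u v * (\<Sum>j\<in>J. \<Sum>x\<in>?C. cnj (K j x v) * K j x u))"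
    unfolding sum_distrib_left
    by (intro sum.cong refl trans[OF sum.swap]) (simp add: mult_ac)
  also have "\<dots> = (\<Sum>u\<in>?C. \<Sum>v\<in>?C. if u = v then M u v else 0)"
    by (intro sum.cong refl) (simp add: TP)
  also have "\<dots> = op_trace L M" using assms(1) by (simp add: op_trace_def)
  finally show "op_trace L (kraus L J K M) = op_trace L M" .
qed

lemma sum_pairs_regroup:
  "(\<Sum>p\<in>C \<times> K. \<Sum>q\<in>C \<times> K. g p q) = (\<Sum>k\<in>K. \<Sum>l\<in>K. \<Sum>x\<in>C. \<Sum>y\<in>C. g (x, k) (y, l))"
proof -
  have "(\<Sum>p\<in>C \<times> K. \<Sum>q\<in>C \<times> K. g p q) = (\<Sum>x\<in>C. \<Sum>k\<in>K. \<Sum>y\<in>C. \<Sum>l\<in>K. g (x, k) (y, l))"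
    by (simp add: sum.cartesian_product')
  also have "\<dots> = (\<Sum>k\<in>K. \<Sum>x\<in>C. \<Sum>y\<in>C. \<Sum>l\<in>K. g (x, k) (y, l))" by (rule sum.swap)
  also have "\<dots> = (\<Sum>k\<in>K. \<Sum>l\<in>K. \<Sum>x\<in>C. \<Sum>y\<in>C. g (x, k) (y, l))"
    by (intro sum.cong refl sum_rotate)
  finally show ?thesis .
qed

lemma nonneg_Reals_sum: "(\<And>i. i \<in> I \<Longrightarrow> f i \<in> \<real>\<^sub>\<ge>\<^sub>0) \<Longrightarrow> sum f I \<in> \<real>\<^sub>\<ge>\<^sub>0"
  by (induction I rule: infinite_finite_induct) auto

lemma completely_positive_kraus:
  fixes K :: "'j \<Rightarrow> 'a :: finite oper"
  assumes "finite L"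
  shows "completely_positive L (kraus L J K)"
  unfolding completely_positive_def
proof (intro allI impI)
  fix m :: nat and M :: "'a conf \<times> nat \<Rightarrow> 'a conf \<times> nat \<Rightarrow> complex"
  let ?C = "confs L :: 'a conf set"
  assume M: "psd (?C \<times> {..<m}) M"
  show "psd (?C \<times> {..<m}) (\<lambda>(x, k) (y, l).
      kraus L J K (\<lambda>a b. if a \<in> ?C \<and> b \<in> ?C then M (a, k) (b, l) else 0) x y)"
    unfolding psd_def
  proof
    fix v :: "'a conf \<times> nat \<Rightarrow> complex"
    \<comment> \<open>\<open>w j\<close> is the adjoint of K_j, tensored with the identity, applied
      to \<open>v\<close>. The quadratic form of the output at \<open>v\<close> becomes the sum over
      \<open>j\<close> of the forms of \<open>M\<close> at \<open>w j\<close>.\<close>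
    define w where "w j p = (\<Sum>x\<in>?C. cnj (K j x (fst p)) * v (x, snd p))" for j p
    let ?B = "\<lambda>k l. kraus L J K (\<lambda>a b. if a \<in> ?C \<and> b \<in> ?C then M (a, k) (b, l) else 0)"
    have block: "(\<Sum>x\<in>?C. \<Sum>y\<in>?C. cnj (v (x, k)) * ?B k l x y * v (y, l)) =
        (\<Sum>j\<in>J. \<Sum>a\<in>?C. \<Sum>b\<in>?C. cnj (w j (a, k)) * M (a, k) (b, l) * w j (b, l))" for k l
    proof -
      let ?f = "\<lambda>x y j a b. cnj (v (x, k)) * (K j x a * M (a, k) (b, l) * cnj (K j y b)) * v (y, l)"
      have "(\<Sum>x\<in>?C. \<Sum>y\<in>?C. cnj (v (x, k)) * ?B k l x y * v (y, l)) =
          (\<Sum>x\<in>?C. \<Sum>y\<in>?C. \<Sum>j\<in>J. \<Sum>a\<in>?C. \<Sum>b\<in>?C. ?f x y j a b)"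
        by (intro sum.cong refl) (simp add: kraus_def sum_distrib_left sum_distrib_right)
      also have "\<dots> = (\<Sum>j\<in>J. \<Sum>x\<in>?C. \<Sum>y\<in>?C. \<Sum>a\<in>?C. \<Sum>b\<in>?C. ?f x y j a b)"
        by (rule sum_rotate)
      also have "\<dots> = (\<Sum>j\<in>J. \<Sum>a\<in>?C. \<Sum>x\<in>?C. \<Sum>y\<in>?C. \<Sum>b\<in>?C. ?f x y j a b)"
        by (intro sum.cong refl sum_rotate)
      also have "\<dots> = (\<Sum>j\<in>J. \<Sum>a\<in>?C. \<Sum>b\<in>?C. \<Sum>x\<in>?C. \<Sum>y\<in>?C. ?f x y j a b)"
        by (intro sum.cong refl sum_rotate)
      also have "\<dots> = (\<Sum>j\<in>J. \<Sum>a\<in>?C. \<Sum>b\<in>?C. cnj (w j (a, k)) * M (a, k) (b, l) * w j (b, l))"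
        by (intro sum.cong refl)
          (simp add: w_def sum_distrib_left sum_distrib_right mult_ac)
      finally show ?thesis .
    qed
    have "(\<Sum>p\<in>?C \<times> {..<m}. \<Sum>q\<in>?C \<times> {..<m}.
        cnj (v p) * (case p of (x, k) \<Rightarrow> \<lambda>(y, l). ?B k l x y) q * v q) =
        (\<Sum>k<m. \<Sum>l<m. \<Sum>j\<in>J. \<Sum>a\<in>?C. \<Sum>b\<in>?C. cnj (w j (a, k)) * M (a, k) (b, l) * w j (b, l))"
      unfolding sum_pairs_regroup by (simp add: block)
    also have "\<dots> = (\<Sum>j\<in>J. \<Sum>p\<in>?C \<times> {..<m}. \<Sum>q\<in>?C \<times> {..<m}. cnj (w j p) * M p q * w j q)"
      unfolding sum_pairs_regroup by (rule sum_rotate)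
    also have "\<dots> \<in> \<real>\<^sub>\<ge>\<^sub>0" using M unfolding psd_def by (intro nonneg_Reals_sum[of J]) blast
    finally show "(\<Sum>p\<in>?C \<times> {..<m}. \<Sum>q\<in>?C \<times> {..<m}.
        cnj (v p) * (case p of (x, k) \<Rightarrow> \<lambda>(y, l). ?B k l x y) q * v q) \<in> \<real>\<^sub>\<ge>\<^sub>0" .
  qed
qed

section \<open>Operators that act on a sub-register\<close>

definition basis_state :: "'a conf \<Rightarrow> 'a state" where
  "basis_state u = (\<lambda>x. if x = u then 1 else 0)"

definition op_matrix :: "('a state \<Rightarrow> 'a state) \<Rightarrow> 'a oper" where
  "op_matrix F = (\<lambda>x u. F (basis_state u) x)"

text \<open>\<open>F\<close> acts on the register \<open>A\<close> as \<open>op_matrix F\<close> on \<open>L\<close> tensored with the identity.\<close>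

definition local_on :: "site set \<Rightarrow> site set \<Rightarrow> ('a state \<Rightarrow> 'a state) \<Rightarrow> bool" where
  "local_on L A F \<longleftrightarrow> (\<forall>\<psi>. \<forall>x\<in>confs A.
     F \<psi> x = (\<Sum>u\<in>confs L. op_matrix F (restrict x L) u * \<psi> (override_on x u L)))"

text \<open>Reduces the extended channel to state vectors: on a mixture of pure states, the
  blockwise extension amounts to applying each \<open>F j\<close> to states of the whole
  register.\<close>

lemma chan_ext_kraus:
  fixes F :: "'j \<Rightarrow> 'a state \<Rightarrow> 'a state"
  assumes "\<And>j. j \<in> J \<Longrightarrow> local_on L (L \<union> E) (F j)"
    and "x \<in> confs (L \<union> E)" and "y \<in> confs (L \<union> E)"
  shows "chan_ext L E (kraus L J (\<lambda>j. op_matrix (F j)))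
      (\<lambda>x y. \<Sum>i\<in>I. c i * (\<psi> i x * cnj (\<psi> i y))) x y =
    (\<Sum>i\<in>I. c i * (\<Sum>j\<in>J. F j (\<psi> i) x * cnj (F j (\<psi> i) y)))"
proof -
  let ?K = "\<lambda>j. op_matrix (F j)"
  have loc: "F j \<phi> z = (\<Sum>u\<in>confs L. ?K j (restrict z L) u * \<phi> (override_on z u L))"
    if "j \<in> J" "z \<in> confs (L \<union> E)" for j \<phi> z
    using assms(1) that unfolding local_on_def by blast
  have r: "restrict z L \<in> confs L" for z :: "'a conf" by (simp add: confs_def)
  let ?f = "\<lambda>j u v i. ?K j (restrict x L) u * (c i * (\<psi> i (override_on x u L) * cnj (\<psi> i (override_on y v L)))) *
    cnj (?K j (restrict y L) v)"
  have "chan_ext L E (kraus L J ?K) (\<lambda>x y. \<Sum>i\<in>I. c i * (\<psi> i x * cnj (\<psi> i y))) x y =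
      (\<Sum>j\<in>J. \<Sum>u\<in>confs L. \<Sum>v\<in>confs L. \<Sum>i\<in>I. ?f j u v i)"
    using assms(2,3) by (simp add: chan_ext_def kraus_def r sum_distrib_left sum_distrib_right)
  also have "\<dots> = (\<Sum>j\<in>J. \<Sum>i\<in>I. \<Sum>u\<in>confs L. \<Sum>v\<in>confs L. ?f j u v i)"
    by (intro sum.cong refl sum_rotate)
  also have "\<dots> = (\<Sum>i\<in>I. \<Sum>j\<in>J. \<Sum>u\<in>confs L. \<Sum>v\<in>confs L. ?f j u v i)" by (rule sum.swap)
  also have "\<dots> = (\<Sum>i\<in>I. c i * (\<Sum>j\<in>J. F j (\<psi> i) x * cnj (F j (\<psi> i) y)))"
  proof (intro sum.cong refl)
    fix i
    have eq: "(\<Sum>j\<in>J. F j (\<psi> i) x * cnj (F j (\<psi> i) y)) = (\<Sum>j\<in>J.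
        (\<Sum>u\<in>confs L. ?K j (restrict x L) u * \<psi> i (override_on x u L)) *
        (\<Sum>v\<in>confs L. cnj (?K j (restrict y L) v * \<psi> i (override_on y v L))))"
      using assms(2,3) by (intro sum.cong refl) (simp add: loc)
    show "(\<Sum>j\<in>J. \<Sum>u\<in>confs L. \<Sum>v\<in>confs L. ?f j u v i) =
        c i * (\<Sum>j\<in>J. F j (\<psi> i) x * cnj (F j (\<psi> i) y))"
      unfolding eq sum_product unfolding sum_distrib_left by (intro sum.cong refl) (simp add: mult_ac)
  qed
  finally show ?thesis .
qed

section \<open>Weyl operators\<close>

definition supported :: "site set \<Rightarrow> 'a :: zero conf set" where
  "supported T = {a. \<forall>s. s \<notin> T \<longrightarrow> a s = 0}"

definition dotp :: "site set \<Rightarrow> 'a :: field conf \<Rightarrow> 'a conf \<Rightarrow> 'a" where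
  "dotp A b x = (\<Sum>s\<in>A. b s * x s)"

lemma dotp_add_left: "dotp A (b + b') x = dotp A b x + dotp A b' x"
  and dotp_add_right: "dotp A b (x + x') = dotp A b x + dotp A b x'"
  and dotp_diff_left: "dotp A (b - b') x = dotp A b x - dotp A b' x"
  and dotp_diff_right: "dotp A b (x - x') = dotp A b x - dotp A b x'"
  and dotp_zero_left [simp]: "dotp A 0 x = 0"
  and dotp_zero_right [simp]: "dotp A b 0 = 0"
  by (simp_all add: dotp_def algebra_simps sum.distrib sum_subtractf sum_negf)

lemma supported_zero [simp]: "0 \<in> supported T"
  and supported_add: "a \<in> supported T \<Longrightarrow> b \<in> supported T \<Longrightarrow> a + b \<in> supported T"
  and supported_diff: "a \<in> supported T \<Longrightarrow> b \<in> supported T \<Longrightarrow> a - b \<in> supported T"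
  and supported_minus: "a \<in> supported T \<Longrightarrow> - a \<in> supported T"
  for a b :: "'a :: ab_group_add conf"
  by (auto simp: supported_def)

lemma supported_mono: "T \<subseteq> L \<Longrightarrow> supported T \<subseteq> supported L"
  by (auto simp: supported_def)

lemma bij_betw_supported_confs: "bij_betw (\<lambda>a. restrict a T) (supported T) (confs T)"
  by (rule bij_betw_byWitness[of _ "\<lambda>x s. if s \<in> T then x s else 0"])
    (auto simp: supported_def confs_def PiE_def extensional_def restrict_def fun_eq_iff)

lemma finite_supported [simp]: "finite T \<Longrightarrow> finite (supported T :: 'a :: {finite, zero} conf set)"
  by (metis bij_betw_finite bij_betw_supported_confs finite_confs)

lemma card_confs: "finite T \<Longrightarrow> card (confs T :: 'a :: finite conf set) = CARD('a) ^ card T"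
  by (simp add: confs_def card_PiE)

lemma card_supported: "finite T \<Longrightarrow> card (supported T :: 'a :: {finite, zero} conf set) = CARD('a) ^ card T"
  using bij_betw_same_card[OF bij_betw_supported_confs, of T] card_confs by metis

text \<open>Outside \<open>A\<close> a configuration is \<open>undefined\<close> while a label is 0,
  and subtracting 0 leaves \<open>undefined\<close>. This is why extensional configurations can be
  shifted by total labels with plain subtraction.\<close>

lemma diff_mem_confs_iff:
  "a \<in> supported A \<Longrightarrow> x - a \<in> confs A \<longleftrightarrow> x \<in> (confs A :: 'a :: ab_group_add conf set)"
  by (auto simp: supported_def confs_def PiE_def extensional_def)

lemma bij_betw_shift_confs:
  assumes "a \<in> supported L"
  shows "bij_betw (\<lambda>x. x - a) (confs L) (confs L :: 'a :: ab_group_add conf set)"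
proof (rule bij_betw_byWitness[of _ "\<lambda>x. x + a"])
  have "x + a \<in> confs L" if "x \<in> confs L" for x
    using that diff_mem_confs_iff[OF assms, of "x + a"] by simp
  then show "(\<lambda>x. x + a) ` confs L \<subseteq> confs L" by auto
qed (auto simp: diff_mem_confs_iff[OF assms])

text \<open>The label \<open>(a, b)\<close> stands for \<open>X(a) Z(b)\<close>. Its components are total functions that vanish off the
  support of the operator, so that labels form a group and act on every larger register.\<close>

type_synonym 'a weyl_label = "'a conf \<times> 'a conf"

definition weyl :: "site set \<Rightarrow> 'a :: {finite, field} weyl_label \<Rightarrow> 'a state \<Rightarrow> 'a state" where
  "weyl A w \<psi> = (\<lambda>x. add_char (dotp A (snd w) (x - fst w)) * \<psi> (x - fst w))"

text \<open>The symplectic form on labels; by \<open>weyl_commute\<close> its character is the phase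
  picked up when two operators are exchanged.\<close>

definition symp_form :: "site set \<Rightarrow> 'a :: field weyl_label \<Rightarrow> 'a weyl_label \<Rightarrow> 'a" where
  "symp_form A s e = dotp A (snd s) (fst e) - dotp A (snd e) (fst s)"

lemma symp_form_add_left: "symp_form A (s + t) e = symp_form A s e + symp_form A t e"
  and symp_form_diff_right: "symp_form A s (e - f) = symp_form A s e - symp_form A s f"
  by (simp_all add: symp_form_def dotp_add_left dotp_add_right dotp_diff_left dotp_diff_right)

text \<open>Moving the Z part of the left operator past the X part of the right one costs the
  phase.\<close>

lemma weyl_weyl:
  "weyl A w (weyl A w' \<psi>) = (\<lambda>x. add_char (dotp A (snd w) (fst w')) * weyl A (w + w') \<psi> x)"
proof
  fix x
  have "add_char (dotp A (snd w) (x - fst w)) =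
      add_char (dotp A (snd w) (fst w')) * add_char (dotp A (snd w) (x - fst w - fst w'))"
    by (simp add: dotp_diff_right flip: add_char_add)
  then show "weyl A w (weyl A w' \<psi>) x = add_char (dotp A (snd w) (fst w')) * weyl A (w + w') \<psi> x"
    by (simp add: weyl_def dotp_add_left add_char_add diff_diff_add mult_ac)
qed

lemma weyl_scale: "weyl A w (\<lambda>x. k * \<psi> x) = (\<lambda>x. k * weyl A w \<psi> x)"
  by (simp add: weyl_def fun_eq_iff)

lemma weyl_sum: "weyl A w (\<lambda>x. \<Sum>i\<in>I. \<psi> i x) = (\<lambda>x. \<Sum>i\<in>I. weyl A w (\<psi> i) x)"
  by (simp add: weyl_def fun_eq_iff sum_distrib_left)

lemma weyl_zero [simp]: "weyl A 0 \<psi> = \<psi>"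
  by (simp add: weyl_def)

lemma weyl_in_hilb:
  assumes "fst w \<in> supported A" "\<psi> \<in> hilb A" shows "weyl A w \<psi> \<in> hilb A"
  using assms by (auto simp: hilb_def weyl_def diff_mem_confs_iff)

lemma weyl_commute:
  "weyl A s (weyl A e \<psi>) = (\<lambda>x. add_char (symp_form A s e) * weyl A e (weyl A s \<psi>) x)"
proof -
  have "add_char (dotp A (snd s) (fst e)) = add_char (symp_form A s e) * add_char (dotp A (snd e) (fst s))"
    by (simp add: symp_form_def flip: add_char_add)
  then show ?thesis by (simp add: weyl_weyl add.commute mult_ac)
qed

section \<open>Inner products and locality of Weyl operators\<close>

definition inner_on :: "site set \<Rightarrow> 'a state \<Rightarrow> 'a state \<Rightarrow> complex" where
  "inner_on L \<phi> \<psi> = (\<Sum>x\<in>confs L. cnj (\<phi> x) * \<psi> x)"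

lemma cnj_add_char_mult [simp]: "cnj (add_char y) * add_char (y :: 'a :: {finite, field}) = 1"
  by (metis add_char_minus add_char_add add_char_zero add.left_inverse)

lemma add_char_mult_cnj [simp]: "add_char y * cnj (add_char (y :: 'a :: {finite, field})) = 1"
  by (metis cnj_add_char_mult mult.commute)

text \<open>The phases cancel whatever register \<open>A\<close> they are computed on, so for
  unitarity on a sub-register \<open>L\<close> it is enough that the shift stays in
  \<open>L\<close>. Trace preservation of channels on \<open>L\<close> is obtained this way.\<close>

lemma inner_on_weyl:
  assumes "fst w \<in> supported L"
  shows "inner_on L (weyl A w \<phi>) (weyl A w \<psi>) = inner_on L \<phi> \<psi>"
proof -
  have "inner_on L (weyl A w \<phi>) (weyl A w \<psi>) =
      (\<Sum>x\<in>confs L. cnj (\<phi> (x - fst w)) * \<psi> (x - fst w))"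
    unfolding inner_on_def
  proof (intro sum.cong refl)
    fix x
    let ?c = "add_char (dotp A (snd w) (x - fst w))"
    have "cnj (weyl A w \<phi> x) * weyl A w \<psi> x = (cnj ?c * ?c) * (cnj (\<phi> (x - fst w)) * \<psi> (x - fst w))"
      unfolding weyl_def complex_cnj_mult by (simp only: mult_ac)
    then show "cnj (weyl A w \<phi> x) * weyl A w \<psi> x = cnj (\<phi> (x - fst w)) * \<psi> (x - fst w)" by simp
  qed
  also have "\<dots> = inner_on L \<phi> \<psi>" unfolding inner_on_def
    by (rule sum.reindex_bij_betw[OF bij_betw_shift_confs[OF assms]])
  finally show ?thesis .
qed

lemma cnj_inner_on: "cnj (inner_on L \<phi> \<psi>) = inner_on L \<psi> \<phi>"
  by (simp add: inner_on_def mult.commute)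

lemma inner_on_diff:
  "inner_on L (\<lambda>x. \<phi> x - \<phi>' x) \<psi> = inner_on L \<phi> \<psi> - inner_on L \<phi>' \<psi>"
  "inner_on L \<phi> (\<lambda>x. \<psi> x - \<psi>' x) = inner_on L \<phi> \<psi> - inner_on L \<phi> \<psi>'"
  by (simp_all add: inner_on_def algebra_simps sum_subtractf)

lemma inner_on_sum:
  "inner_on L (\<lambda>x. \<Sum>i\<in>I. \<phi> i x) \<psi> = (\<Sum>i\<in>I. inner_on L (\<phi> i) \<psi>)"
  "inner_on L \<psi> (\<lambda>x. \<Sum>i\<in>I. \<phi> i x) = (\<Sum>i\<in>I. inner_on L \<psi> (\<phi> i))"
  by (simp_all add: inner_on_def sum_distrib_right sum_distrib_left sum.swap[of _ I])

lemma inner_on_scale: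
  "inner_on L (\<lambda>x. k * \<phi> x) \<psi> = cnj k * inner_on L \<phi> \<psi>"
  "inner_on L \<phi> (\<lambda>x. k * \<psi> x) = k * inner_on L \<phi> \<psi>"
  by (simp_all add: inner_on_def sum_distrib_left mult_ac)

lemma local_on_weyl:
  fixes A L :: "site set"
  assumes "finite A" "L \<subseteq> A" "fst w \<in> supported L" "snd w \<in> supported L"
  shows "local_on L A (weyl A w)"
  unfolding local_on_def
proof (intro allI ballI)
  fix \<psi> :: "'a :: {finite, field} state" and x :: "'a conf" assume x: "x \<in> confs A"
  let ?y = "restrict x L - fst w"
  have fin: "finite L" using assms by (auto intro: finite_subset)
  have y: "?y \<in> confs L" using assms(3) by (simp add: diff_mem_confs_iff) (simp add: confs_def)
  have 1: "override_on x ?y L = x - fst w"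
    using assms(3) by (auto simp: override_on_def supported_def fun_eq_iff)
  \<comment> \<open>Off \<open>L\<close> the restricted configuration is \<open>undefined\<close>,
    but \<open>snd w\<close> vanishes there.\<close>
  have 2: "dotp A (snd w) ?y = dotp A (snd w) (x - fst w)"
    unfolding dotp_def using assms(4) by (intro sum.cong) (auto simp: supported_def)
  have "(\<Sum>u\<in>confs L. op_matrix (weyl A w) (restrict x L) u * \<psi> (override_on x u L)) =
      (\<Sum>u\<in>confs L. if ?y = u then add_char (dotp A (snd w) ?y) * \<psi> (override_on x u L) else 0)"
    by (intro sum.cong) (auto simp: op_matrix_def weyl_def basis_state_def)
  also have "\<dots> = weyl A w \<psi> x" using fin y by (simp add: 1 2 weyl_def)
  finally show "weyl A w \<psi> x =
      (\<Sum>u\<in>confs L. op_matrix (weyl A w) (restrict x L) u * \<psi> (override_on x u L))" by simp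
qed

lemma local_on_sum:
  fixes F :: "'i \<Rightarrow> 'a state \<Rightarrow> 'a state"
  assumes "\<And>i. i \<in> I \<Longrightarrow> local_on L A (F i)"
  shows "local_on L A (\<lambda>\<psi> x. \<Sum>i\<in>I. F i \<psi> x)"
  unfolding local_on_def
proof (intro allI ballI)
  fix \<psi> :: "'a state" and x :: "'a conf" assume x: "x \<in> confs A"
  have "(\<Sum>i\<in>I. F i \<psi> x) = (\<Sum>i\<in>I. \<Sum>u\<in>confs L. op_matrix (F i) (restrict x L) u * \<psi> (override_on x u L))"
    using assms x unfolding local_on_def by (intro sum.cong refl) blast
  also have "\<dots> = (\<Sum>u\<in>confs L. \<Sum>i\<in>I. op_matrix (F i) (restrict x L) u * \<psi> (override_on x u L))"
    by (rule sum.swap)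
  finally show "(\<Sum>i\<in>I. F i \<psi> x) =
      (\<Sum>u\<in>confs L. op_matrix (\<lambda>\<psi> x. \<Sum>i\<in>I. F i \<psi> x) (restrict x L) u * \<psi> (override_on x u L))"
    by (simp add: op_matrix_def sum_distrib_right)
qed

lemma local_on_scale:
  fixes F :: "'a state \<Rightarrow> 'a state"
  assumes "local_on L A F"
  shows "local_on L A (\<lambda>\<psi> x. k * F \<psi> x)"
  unfolding local_on_def
proof (intro allI ballI)
  fix \<psi> :: "'a state" and x :: "'a conf" assume "x \<in> confs A"
  then have "F \<psi> x = (\<Sum>u\<in>confs L. op_matrix F (restrict x L) u * \<psi> (override_on x u L))"
    using assms unfolding local_on_def by blast
  then show "k * F \<psi> x = (\<Sum>u\<in>confs L. op_matrix (\<lambda>\<psi> x. k * F \<psi> x) (restrict x L) u * \<psi> (override_on x u L))"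
    by (simp add: op_matrix_def sum_distrib_left mult_ac)
qed

lemma local_on_diff:
  fixes F :: "'a state \<Rightarrow> 'a state"
  assumes "local_on L A F" "local_on L A G"
  shows "local_on L A (\<lambda>\<psi> x. F \<psi> x - G \<psi> x)"
  unfolding local_on_def
proof (intro allI ballI)
  fix \<psi> :: "'a state" and x :: "'a conf" assume x: "x \<in> confs A"
  have "F \<psi> x = (\<Sum>u\<in>confs L. op_matrix F (restrict x L) u * \<psi> (override_on x u L))"
    "G \<psi> x = (\<Sum>u\<in>confs L. op_matrix G (restrict x L) u * \<psi> (override_on x u L))"
    using assms x unfolding local_on_def by blast+
  then show "F \<psi> x - G \<psi> x =
      (\<Sum>u\<in>confs L. op_matrix (\<lambda>\<psi> x. F \<psi> x - G \<psi> x) (restrict x L) u * \<psi> (override_on x u L))"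
    by (simp add: op_matrix_def sum_subtractf algebra_simps)
qed

text \<open>A group of labels of commuting operators that multiply without phases.\<close>

definition isotropic_group :: "site set \<Rightarrow> 'a :: field weyl_label set \<Rightarrow> bool" where
  "isotropic_group A S \<longleftrightarrow> finite S \<and> 0 \<in> S \<and> (\<forall>s\<in>S. - s \<in> S) \<and> (\<forall>s\<in>S. \<forall>t\<in>S. s + t \<in> S) \<and>
     (\<forall>s\<in>S. \<forall>t\<in>S. dotp A (snd s) (fst t) = 0)"

section \<open>Syndromes and their projections\<close>

definition same_syndrome ::
    "site set \<Rightarrow> 'a :: {finite, field} weyl_label set \<Rightarrow> 'a weyl_label \<Rightarrow> 'a weyl_label \<Rightarrow> bool" where
  "same_syndrome A S e f \<longleftrightarrow> (\<forall>s\<in>S. add_char (symp_form A s (e - f)) = 1)"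

lemma add_char_eq_iff: "add_char (x - y) = 1 \<longleftrightarrow> add_char x = add_char (y :: 'a :: {finite, field})"
  using add_char_add[of "x - y" y] by auto

lemma same_syndrome_iff:
  "same_syndrome A S e f \<longleftrightarrow> (\<forall>s\<in>S. add_char (symp_form A s e) = add_char (symp_form A s f))"
  by (simp add: same_syndrome_def symp_form_diff_right add_char_eq_iff)

lemma bij_betw_group_shift:
  assumes "isotropic_group A S" "t \<in> S"
  shows "bij_betw (\<lambda>s. t + s) S S"
proof (rule bij_betw_byWitness[of _ "\<lambda>s. s + - t"])
  show "(\<lambda>s. t + s) ` S \<subseteq> S" "(\<lambda>s. s + - t) ` S \<subseteq> S"
    using assms unfolding isotropic_group_def by blast+
qed (simp_all add: algebra_simps)

text \<open>Orthogonality of the two characters of \<open>S\<close> given by pairing with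
  \<open>e\<close> and with \<open>f\<close>.\<close>

lemma character_average:
  assumes "isotropic_group A S"
  shows "(\<Sum>s\<in>S. add_char (symp_form A s e) * cnj (add_char (symp_form A s f))) =
    (if same_syndrome A S e f then of_nat (card S) else 0)"
proof -
  have eq: "(\<Sum>s\<in>S. add_char (symp_form A s e) * cnj (add_char (symp_form A s f))) =
      (\<Sum>s\<in>S. add_char (symp_form A s (e - f)))"
    by (simp add: symp_form_diff_right flip: add_char_minus add_char_add)
  show ?thesis
  proof (cases "same_syndrome A S e f")
    case True
    then show ?thesis unfolding eq by (simp add: same_syndrome_def)
  next
    case False
    then obtain t where t: "t \<in> S" "add_char (symp_form A t (e - f)) \<noteq> 1"
      by (auto simp: same_syndrome_def)
    have "(\<Sum>s\<in>S. add_char (symp_form A s (e - f))) = 0"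
      by (rule sum_eq_0_if_shift[OF bij_betw_group_shift[OF assms t(1)] _ t(2)])
        (simp add: symp_form_add_left add_char_add)
    then show ?thesis using False unfolding eq by simp
  qed
qed

text \<open>The projection onto the joint eigenspace in which every \<open>s \<in> S\<close> acts as
  the phase \<open>add_char (symp_form A s e)\<close>. By \<open>weyl_commute\<close> the error
  \<open>e\<close> sends states fixed by \<open>S\<close> into this eigenspace.\<close>

definition syndrome_proj ::
    "site set \<Rightarrow> 'a :: {finite, field} weyl_label set \<Rightarrow> 'a weyl_label \<Rightarrow> 'a state \<Rightarrow> 'a state" where
  "syndrome_proj A S e \<phi> =
     (\<lambda>x. \<Sum>s\<in>S. (cnj (add_char (symp_form A s e)) / of_nat (card S)) * weyl A s \<phi> x)"

lemma weyl_weyl_isotropic: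
  assumes "isotropic_group A S" "s \<in> S" "t \<in> S"
  shows "weyl A s (weyl A t \<psi>) = weyl A (s + t) \<psi>"
  using assms by (simp add: weyl_weyl isotropic_group_def)

text \<open>Idempotence, self-adjointness and mutual orthogonality in one formula. After
  substituting \<open>t = s + u\<close>, unitarity removes \<open>s\<close> from the inner product,
  and the sum over \<open>s\<close> is left to \<open>character_average\<close>.\<close>

lemma inner_on_syndrome_proj:
  assumes S: "isotropic_group A S" and sup: "\<And>s. s \<in> S \<Longrightarrow> fst s \<in> supported L"
  shows "inner_on L (syndrome_proj A S e \<phi>) (syndrome_proj A S f \<psi>) =
    (if same_syndrome A S e f then inner_on L \<phi> (syndrome_proj A S f \<psi>) else 0)"
proof -
  let ?N = "of_nat (card S) :: complex"
  have "card S \<noteq> 0" using S by (auto simp: isotropic_group_def)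
  then have N: "?N \<noteq> 0" by simp
  let ?c = "\<lambda>s e. add_char (symp_form A s e)"
  have "inner_on L (syndrome_proj A S e \<phi>) (syndrome_proj A S f \<psi>) =
      (\<Sum>s\<in>S. \<Sum>t\<in>S. ?c s e / ?N * (cnj (?c t f) / ?N) * inner_on L (weyl A s \<phi>) (weyl A t \<psi>))"
    unfolding syndrome_proj_def inner_on_sum inner_on_scale
    by (simp add: sum_distrib_left mult_ac)
  also have "\<dots> = (\<Sum>s\<in>S. \<Sum>u\<in>S. ?c s e / ?N * (cnj (?c (s + u) f) / ?N) *
      inner_on L (weyl A s \<phi>) (weyl A (s + u) \<psi>))"
    by (intro sum.cong refl sum.reindex_bij_betw[OF bij_betw_group_shift[OF S], symmetric])
  also have "\<dots> = (\<Sum>s\<in>S. \<Sum>u\<in>S. (?c s e * cnj (?c s f) / ?N) *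
      (cnj (?c u f) / ?N * inner_on L \<phi> (weyl A u \<psi>)))"
  proof (intro sum.cong refl)
    fix s u assume su: "s \<in> S" "u \<in> S"
    have "inner_on L (weyl A s \<phi>) (weyl A (s + u) \<psi>) = inner_on L \<phi> (weyl A u \<psi>)"
      using weyl_weyl_isotropic[OF S su, of \<psi>, symmetric] inner_on_weyl[OF sup[OF su(1)]] by simp
    then show "?c s e / ?N * (cnj (?c (s + u) f) / ?N) * inner_on L (weyl A s \<phi>) (weyl A (s + u) \<psi>) =
        (?c s e * cnj (?c s f) / ?N) * (cnj (?c u f) / ?N * inner_on L \<phi> (weyl A u \<psi>))"
      by (simp add: symp_form_add_left add_char_add mult_ac)
  qed
  also have "\<dots> = (\<Sum>s\<in>S. ?c s e * cnj (?c s f)) / ?N * inner_on L \<phi> (syndrome_proj A S f \<psi>)"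
    unfolding syndrome_proj_def inner_on_sum inner_on_scale sum_divide_distrib sum_product ..
  also have "\<dots> = (if same_syndrome A S e f then inner_on L \<phi> (syndrome_proj A S f \<psi>) else 0)"
    using N by (simp add: character_average[OF S])
  finally show ?thesis .
qed

text \<open>Since \<open>s\<close> fixes \<open>\<psi>\<close>, exchanging it with the error leaves
  only the syndrome phase, and the average is again a character sum.\<close>

lemma syndrome_proj_error:
  assumes S: "isotropic_group A S" and fixed: "\<And>s. s \<in> S \<Longrightarrow> weyl A s \<psi> = \<psi>"
  shows "syndrome_proj A S e (weyl A f \<psi>) = (if same_syndrome A S e f then weyl A f \<psi> else (\<lambda>x. 0))"
proof
  fix x
  let ?N = "of_nat (card S) :: complex"
  have "card S \<noteq> 0" using S by (auto simp: isotropic_group_def)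
  then have N: "?N \<noteq> 0" by simp
  have sym: "same_syndrome A S f e = same_syndrome A S e f" by (auto simp: same_syndrome_iff)
  have "syndrome_proj A S e (weyl A f \<psi>) x =
      (\<Sum>s\<in>S. (add_char (symp_form A s f) * cnj (add_char (symp_form A s e))) / ?N * weyl A f \<psi> x)"
    unfolding syndrome_proj_def
    by (intro sum.cong refl) (simp add: weyl_commute[of _ _ f] fixed)
  also have "\<dots> = (\<Sum>s\<in>S. add_char (symp_form A s f) * cnj (add_char (symp_form A s e))) / ?N * weyl A f \<psi> x"
    by (simp add: sum_distrib_right sum_divide_distrib)
  finally show "syndrome_proj A S e (weyl A f \<psi>) x =
      (if same_syndrome A S e f then weyl A f \<psi> else (\<lambda>x. 0)) x"
    using N by (simp add: character_average[OF S] sym)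
qed

section \<open>Recovery of erasures\<close>

lemma sum_add_char_supported:
  fixes z :: "'a :: {finite, field} conf"
  assumes "finite A" "T \<subseteq> A"
  shows "(\<Sum>b\<in>supported T. add_char (dotp A b z)) =
    (if \<forall>s\<in>T. z s = 0 then of_nat (CARD('a) ^ card T) else 0)"
proof (cases "\<forall>s\<in>T. z s = 0")
  case True
  have fin: "finite T" using assms finite_subset by blast
  have "dotp A b z = 0" if "b \<in> supported T" for b
    using that True unfolding dotp_def supported_def by (intro sum.neutral) force
  then show ?thesis using True fin by (simp add: card_supported)
next
  case False
  then obtain s where s: "s \<in> T" "z s \<noteq> 0" by auto
  then obtain t where t: "add_char (t * z s) \<noteq> 1" using add_char_mult_eq_1_imp by blast
  let ?d = "(\<lambda>s'. if s' = s then t else 0) :: 'a conf"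
  have d: "?d \<in> supported T" using s by (auto simp: supported_def)
  have "s \<in> A" using s assms by auto
  then have dz: "dotp A ?d z = t * z s"
    using assms(1) by (simp add: dotp_def if_distrib[of "\<lambda>u. u * _"] cong: if_cong)
  have bij: "bij_betw (\<lambda>b. b + ?d) (supported T) (supported T)"
    by (rule bij_betw_byWitness[of _ "\<lambda>b. b - ?d"])
      (use d in \<open>auto simp: supported_add supported_diff\<close>)
  have "(\<Sum>b\<in>supported T. add_char (dotp A b z)) = 0"
    by (rule sum_eq_0_if_shift[OF bij _ t]) (simp add: dotp_add_left add_char_add dz)
  with False show ?thesis by simp
qed

text \<open>Turns the sum over \<open>confs T\<close> in the partial trace into a sum over the X
  shifts supported on \<open>T\<close>.\<close>

lemma bij_betw_supported_override:
  fixes x :: "'a :: ab_group_add conf"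
  shows "bij_betw (\<lambda>a. restrict (x - a) T) (supported T) (confs T)"
proof (rule bij_betw_byWitness[of _ "\<lambda>t s. if s \<in> T then x s - t s else 0"])
  show "(\<lambda>a. restrict (x - a) T) ` supported T \<subseteq> confs T" by (auto simp: confs_def)
  show "(\<lambda>t s. if s \<in> T then x s - t s else 0) ` confs T \<subseteq> supported T"
    by (auto simp: supported_def)
qed (auto simp: supported_def confs_def PiE_def extensional_def restrict_def fun_eq_iff)

text \<open>The sum over the Z parts is a character sum that kills all entries whose two arguments
  differ on \<open>T\<close>; the sum over the X parts is the partial trace. One factor q^|T| of the
  weight is consumed by the character sum, the other normalises the maximally mixed state.\<close>

lemma erase_eq_twirl:
  fixes \<psi> :: "'a :: {finite, field} state"
  assumes A: "finite A" and T: "T \<subseteq> A" and \<psi>: "\<psi> \<in> hilb A"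
  shows "erase A T (proj \<psi>) = (\<lambda>x y. \<Sum>f\<in>supported T \<times> supported T.
    1 / of_nat (CARD('a) ^ card T * CARD('a) ^ card T) * (weyl A f \<psi> x * cnj (weyl A f \<psi> y)))"
proof (intro ext)
  fix x y :: "'a conf"
  let ?q = "of_nat (CARD('a) ^ card T) :: complex"
  let ?S = "supported T :: 'a conf set"
  let ?w = "\<lambda>f. weyl A f \<psi> x * cnj (weyl A f \<psi> y)"
  have TA: "T \<union> (A - T) = A" "T \<union> A = A" using T by auto
  have q: "?q \<noteq> 0" by simp
  have "erase A T (proj \<psi>) x y = (\<Sum>f\<in>?S \<times> ?S. 1 / (?q * ?q) * ?w f)"
  proof (cases "x \<in> confs A \<and> y \<in> confs A")
    case False
    have "?w f = 0" if "f \<in> ?S \<times> ?S" for f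
    proof -
      have "fst f \<in> supported A" using that supported_mono[OF T] by auto
      then have "weyl A f \<psi> \<in> hilb A" using \<psi> weyl_in_hilb by blast
      then show ?thesis using False by (auto simp: hilb_def)
    qed
    then show ?thesis using False by (auto simp: erase_def op_tensor_def TA)
  next
    case True
    have o: "override_on (restrict z (A - T)) t T = override_on z t T" if "z \<in> confs A" for z t :: "'a conf"
      using that T by (auto simp: override_on_def confs_def PiE_def extensional_def fun_eq_iff)
    let ?P = "\<Sum>t\<in>confs T. \<psi> (override_on x t T) * cnj (\<psi> (override_on y t T))"
    have r: "restrict z B \<in> confs B" for z :: "'a conf" and B by (simp add: confs_def)
    have pt: "ptrace A T (proj \<psi>) (restrict x (A - T)) (restrict y (A - T)) = ?P"
      using True by (simp add: ptrace_def proj_def o r)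
    let ?same = "\<forall>s\<in>T. (x - y) s = 0"
    have same: "?same \<longleftrightarrow> restrict x T = restrict y T"
      by (auto simp: restrict_def fun_eq_iff)
    have lhs: "erase A T (proj \<psi>) x y = (if ?same then ?P / ?q else 0)"
      using True unfolding same by (simp add: erase_def op_tensor_def TA pt op_one_def r)
    have "(\<Sum>f\<in>?S \<times> ?S. 1 / (?q * ?q) * ?w f) = (\<Sum>a\<in>?S. \<Sum>b\<in>?S. 1 / (?q * ?q) * ?w (a, b))"
      by (simp add: sum.cartesian_product)
    also have "\<dots> = (\<Sum>a\<in>?S. \<Sum>b\<in>?S. 1 / (?q * ?q) *
        (add_char (dotp A b (x - y)) * (\<psi> (x - a) * cnj (\<psi> (y - a)))))"
    proof (intro sum.cong refl arg_cong[of _ _ "(*) (1 / (?q * ?q))"])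
      fix a b
      have "dotp A b (x - y) = dotp A b (x - a) - dotp A b (y - a)"
        by (simp flip: dotp_diff_right)
      then have "add_char (dotp A b (x - y)) = add_char (dotp A b (x - a)) * cnj (add_char (dotp A b (y - a)))"
        using add_char_add[of "dotp A b (x - a)" "- dotp A b (y - a)"] by (simp add: add_char_minus)
      then show "?w (a, b) = add_char (dotp A b (x - y)) * (\<psi> (x - a) * cnj (\<psi> (y - a)))"
        by (simp add: weyl_def mult_ac)
    qed
    also have "\<dots> = 1 / (?q * ?q) * (\<Sum>a\<in>?S. (\<Sum>b\<in>?S. add_char (dotp A b (x - y))) *
        (\<psi> (x - a) * cnj (\<psi> (y - a))))"
      by (simp add: sum_distrib_left sum_distrib_right mult_ac)
    also have "\<dots> = (if ?same then (\<Sum>a\<in>?S. \<psi> (x - a) * cnj (\<psi> (y - a))) / ?q else 0)"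
      unfolding sum_add_char_supported[OF A T] using q
      by (auto simp flip: sum_distrib_left)
    also have "\<dots> = (if ?same then ?P / ?q else 0)"
    proof (cases ?same)
      case True
      have ov: "override_on x (restrict (x - a) T) T = x - a" "override_on y (restrict (x - a) T) T = y - a"
        if "a \<in> ?S" for a
        using that True by (auto simp: override_on_def supported_def fun_eq_iff)
      have "?P = (\<Sum>a\<in>?S. \<psi> (override_on x (restrict (x - a) T) T) * cnj (\<psi> (override_on y (restrict (x - a) T) T)))"
        by (rule sum.reindex_bij_betw[OF bij_betw_supported_override, symmetric])
      also have "\<dots> = (\<Sum>a\<in>?S. \<psi> (x - a) * cnj (\<psi> (y - a)))"
        by (intro sum.cong refl) (simp only: ov)
      finally show ?thesis by simp
    next
      case False
      show ?thesis unfolding if_not_P[OF False] ..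
    qed
    finally show ?thesis using lhs by simp
  qed
  then show "erase A T (proj \<psi>) x y = (\<Sum>f\<in>?S \<times> ?S.
    1 / of_nat (CARD('a) ^ card T * CARD('a) ^ card T) * ?w f)" by simp
qed

section \<open>Measuring a syndrome and undoing an error\<close>

lemma exists_representatives:
  assumes "\<And>x. sim x x" "\<And>x y. sim x y \<Longrightarrow> sim y x" "\<And>x y z. sim x y \<Longrightarrow> sim y z \<Longrightarrow> sim x z"
  obtains R where "R \<subseteq> X" "\<And>x. x \<in> X \<Longrightarrow> \<exists>e\<in>R. sim e x" "\<And>e f. e \<in> R \<Longrightarrow> f \<in> R \<Longrightarrow> sim e f \<Longrightarrow> e = f"
proof
  let ?r = "\<lambda>x. SOME y. y \<in> X \<and> sim x y"
  have r: "?r x \<in> X \<and> sim x (?r x)" if "x \<in> X" for x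
    using that assms(1) by (intro someI[of "\<lambda>y. y \<in> X \<and> sim x y" x]) auto
  show "?r ` X \<subseteq> X" using r by auto
  show "\<exists>e\<in>?r ` X. sim e x" if "x \<in> X" for x using r[OF that] assms(2) that by blast
  show "e = f" if ef: "e \<in> ?r ` X" "f \<in> ?r ` X" "sim e f" for e f
  proof -
    obtain x y where xy: "x \<in> X" "y \<in> X" "e = ?r x" "f = ?r y" using ef by auto
    then have "sim x y" using r[of x] r[of y] ef(3) assms(2,3) by metis
    then have "(\<lambda>z. z \<in> X \<and> sim x z) = (\<lambda>z. z \<in> X \<and> sim y z)" using assms(2,3) by blast
    then show ?thesis using xy by simp
  qed
qed

text \<open>Kraus operators of the recovery, with \<open>R\<close> holding one representative error
  per syndrome. The outcome \<open>None\<close> is the part of the space that the syndromes of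
  \<open>R\<close> leave over: it vanishes on erased code states, but it completes the operators to
  a trace-preserving channel.\<close>

definition correction ::
    "site set \<Rightarrow> 'a :: {finite, field} weyl_label set \<Rightarrow> 'a weyl_label set \<Rightarrow>
      'a weyl_label option \<Rightarrow> 'a state \<Rightarrow> 'a state" where
  "correction A S R j = (case j of
     None \<Rightarrow> (\<lambda>\<phi> x. \<phi> x - (\<Sum>e\<in>R. syndrome_proj A S e \<phi> x))
   | Some e \<Rightarrow> (\<lambda>\<phi>. weyl A (- e) (syndrome_proj A S e \<phi>)))"

lemma local_on_syndrome_proj:
  assumes "finite A" "L \<subseteq> A" "\<And>s. s \<in> S \<Longrightarrow> fst s \<in> supported L \<and> snd s \<in> supported L"
  shows "local_on L A (syndrome_proj A S e)"
  unfolding syndrome_proj_def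
  using assms by (intro local_on_sum local_on_scale local_on_weyl) auto

lemma local_on_id:
  assumes "finite A" "L \<subseteq> A"
  shows "local_on L A (\<lambda>\<phi> :: 'a :: {finite, field} state. \<phi>)"
proof -
  have "weyl A 0 = (\<lambda>\<phi> :: 'a state. \<phi>)" by (simp add: fun_eq_iff)
  then show ?thesis using local_on_weyl[OF assms, where w = "0 :: 'a weyl_label"] by simp
qed

lemma local_on_correction:
  fixes S :: "'a :: {finite, field} weyl_label set"
  assumes "finite A" "L \<subseteq> A" and S: "\<And>s. s \<in> S \<Longrightarrow> fst s \<in> supported L \<and> snd s \<in> supported L"
    and R: "\<And>e. e \<in> R \<Longrightarrow> fst e \<in> supported L \<and> snd e \<in> supported L"
    and j: "j \<in> insert None (Some ` R)"
  shows "local_on L A (correction A S R j)"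
proof (cases j)
  case None
  then show ?thesis
    using assms by (simp add: correction_def)
      (intro local_on_diff local_on_id local_on_sum local_on_syndrome_proj; blast)
next
  case (Some e)
  then have e: "e \<in> R" using j by auto
  \<comment> \<open>Expanding the projection leaves a linear combination of Weyl operators with
    labels \<open>- e + s\<close>, so locality can be checked term by term.\<close>
  have eq: "correction A S R j = (\<lambda>\<phi> x. \<Sum>s\<in>S. (cnj (add_char (symp_form A s e)) / of_nat (card S)) *
      (add_char (dotp A (snd (- e)) (fst s)) * weyl A (- e + s) \<phi> x))"
    unfolding Some correction_def syndrome_proj_def option.case weyl_sum weyl_scale weyl_weyl ..
  show ?thesis
    unfolding eq using assms(1,2) S R[OF e]
    by (intro local_on_sum local_on_scale local_on_weyl) (auto simp: supported_diff)
qed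

text \<open>The Kraus condition as an identity of forms. With P the sum of the projections, the
  outcomes \<open>Some e\<close> contribute the form of P, since undoing an error is unitary, and
  \<open>None\<close> contributes that of 1 - P, which is again a projection.\<close>

lemma sum_inner_on_correction:
  assumes S: "isotropic_group A S" and supS: "\<And>s. s \<in> S \<Longrightarrow> fst s \<in> supported L"
    and fin: "finite R" and supR: "\<And>e. e \<in> R \<Longrightarrow> fst e \<in> supported L"
    and inj: "\<And>e f. e \<in> R \<Longrightarrow> f \<in> R \<Longrightarrow> same_syndrome A S e f \<Longrightarrow> e = f"
  shows "(\<Sum>j\<in>insert None (Some ` R). inner_on L (correction A S R j \<phi>) (correction A S R j \<psi>)) =
    inner_on L \<phi> \<psi>"
proof -
  let ?P = "syndrome_proj A S"
  have PP: "inner_on L (?P e \<phi>) (?P f \<psi>) = (if e = f then inner_on L \<phi> (?P f \<psi>) else 0)"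
    if "e \<in> R" "f \<in> R" for e f \<phi> \<psi>
    using inner_on_syndrome_proj[OF S supS, where e = e and f = f] inj[OF that]
    by (auto simp: same_syndrome_iff)
  have P': "inner_on L (?P e \<phi>) \<psi> = inner_on L \<phi> (?P e \<psi>)" if "e \<in> R" for e
  proof -
    have "inner_on L (?P e \<phi>) \<psi> = cnj (inner_on L \<psi> (?P e \<phi>))" by (simp add: cnj_inner_on)
    also have "\<dots> = cnj (inner_on L (?P e \<psi>) (?P e \<phi>))" using PP[OF that that] by simp
    also have "\<dots> = inner_on L (?P e \<phi>) (?P e \<psi>)" by (simp add: cnj_inner_on)
    also have "\<dots> = inner_on L \<phi> (?P e \<psi>)" using PP[OF that that] by simp
    finally show ?thesis .
  qed
  let ?s = "\<Sum>e\<in>R. inner_on L \<phi> (?P e \<psi>)"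
  have "(\<Sum>e\<in>R. inner_on L (correction A S R (Some e) \<phi>) (correction A S R (Some e) \<psi>)) = ?s"
    using supR by (intro sum.cong refl) (simp add: correction_def inner_on_weyl supported_minus PP)
  moreover have "inner_on L (correction A S R None \<phi>) (correction A S R None \<psi>) = inner_on L \<phi> \<psi> - ?s"
  proof -
    have "(\<Sum>e\<in>R. \<Sum>f\<in>R. inner_on L (?P e \<phi>) (?P f \<psi>)) = ?s"
      using fin by (simp add: PP cong: sum.cong)
    then show ?thesis
      by (simp add: correction_def inner_on_diff inner_on_sum P' cong: sum.cong)
  qed
  ultimately show ?thesis using fin by (simp add: sum.reindex)
qed

text \<open>Only the outcome \<open>Some e\<close> survives, and undoing \<open>e\<close> instead of
  the true error \<open>f\<close> leaves \<open>f - e\<close>, which fixes \<open>\<psi>\<close>.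
  The remaining scalar has modulus one and cancels in the outer product.\<close>

lemma correction_error:
  assumes S: "isotropic_group A S" and fixed: "\<And>s. s \<in> S \<Longrightarrow> weyl A s \<psi> = \<psi>"
    and fin: "finite R"
    and inj: "\<And>e f. e \<in> R \<Longrightarrow> f \<in> R \<Longrightarrow> same_syndrome A S e f \<Longrightarrow> e = f"
    and e: "e \<in> R" "same_syndrome A S e f" and triv: "weyl A (f - e) \<psi> = \<psi>"
  shows "(\<Sum>j\<in>insert None (Some ` R). correction A S R j (weyl A f \<psi>) x *
    cnj (correction A S R j (weyl A f \<psi>) y)) = \<psi> x * cnj (\<psi> y)"
proof -
  have uniq: "same_syndrome A S e' f \<longleftrightarrow> e' = e" if "e' \<in> R" for e'
    using inj[OF that e(1)] e(2) by (auto simp: same_syndrome_iff)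
  have pr: "syndrome_proj A S e' (weyl A f \<psi>) = (if e' = e then weyl A f \<psi> else (\<lambda>x. 0))" if "e' \<in> R" for e'
    using syndrome_proj_error[OF S fixed] uniq[OF that] by simp
  have "correction A S R None (weyl A f \<psi>) = (\<lambda>x. weyl A f \<psi> x - (\<Sum>e'\<in>R. if e' = e then weyl A f \<psi> x else 0))"
    by (auto simp: correction_def pr fun_eq_iff intro!: sum.cong)
  then have none: "correction A S R None (weyl A f \<psi>) = (\<lambda>x. 0)"
    using fin e(1) by simp
  let ?c = "add_char (dotp A (snd (- e)) (fst f))"
  have c: "?c * cnj ?c = 1" by simp
  have some: "correction A S R (Some e') (weyl A f \<psi>) = (if e' = e then (\<lambda>x. ?c * \<psi> x) else (\<lambda>x. 0))"
    if "e' \<in> R" for e'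
    using that triv by (auto simp: correction_def pr weyl_weyl weyl_def[of _ _ "\<lambda>x. 0"])
  have "(\<Sum>j\<in>insert None (Some ` R). correction A S R j (weyl A f \<psi>) x *
      cnj (correction A S R j (weyl A f \<psi>) y)) =
      (\<Sum>e'\<in>R. correction A S R (Some e') (weyl A f \<psi>) x *
      cnj (correction A S R (Some e') (weyl A f \<psi>) y))"
    using fin by (simp add: none sum.reindex)
  also have "\<dots> = (\<Sum>e'\<in>R. if e' = e then (?c * cnj ?c) * (\<psi> x * cnj (\<psi> y)) else 0)"
  proof (intro sum.cong refl)
    fix e' assume "e' \<in> R"
    show "correction A S R (Some e') (weyl A f \<psi>) x * cnj (correction A S R (Some e') (weyl A f \<psi>) y) =
      (if e' = e then (?c * cnj ?c) * (\<psi> x * cnj (\<psi> y)) else 0)"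
      unfolding some[OF \<open>e' \<in> R\<close>] by (cases "e' = e") (simp_all add: mult_ac del: add_char_mult_cnj cnj_add_char_mult)
  qed
  finally show ?thesis using fin e(1) by (simp add: c)
qed

text \<open>\<open>L\<close> is where the recovery may act, \<open>E\<close> is the untouched rest.
  \<open>triv\<close> says that errors on \<open>T\<close> invisible to \<open>S\<close> act
  trivially on \<open>Q\<close>; it is applied to the difference of two errors with the same
  syndrome, so degenerate codes are covered.\<close>

theorem erasure_recovery:
  fixes Q :: "'a :: {finite, field} state set"
  assumes fin: "finite L" "finite E" and TL: "T \<subseteq> L"
    and S: "isotropic_group (L \<union> E) S"
    and supS: "\<And>s. s \<in> S \<Longrightarrow> fst s \<in> supported L \<and> snd s \<in> supported L"
    and hilb: "Q \<subseteq> hilb (L \<union> E)"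
    and fixed: "\<And>\<psi> s. \<psi> \<in> Q \<Longrightarrow> s \<in> S \<Longrightarrow> weyl (L \<union> E) s \<psi> = \<psi>"
    and triv: "\<And>\<psi> e. \<psi> \<in> Q \<Longrightarrow> e \<in> supported T \<times> supported T \<Longrightarrow>
      (\<And>s. s \<in> S \<Longrightarrow> add_char (symp_form (L \<union> E) s e) = 1) \<Longrightarrow> weyl (L \<union> E) e \<psi> = \<psi>"
  obtains \<Phi> where "quantum_channel L \<Phi>"
    "\<And>\<psi>. \<psi> \<in> Q \<Longrightarrow> chan_ext L E \<Phi> (erase (L \<union> E) T (proj \<psi>)) = proj \<psi>"
proof -
  let ?A = "L \<union> E" and ?X = "supported T \<times> supported T :: 'a weyl_label set"
  have finA: "finite ?A" and finT: "finite T" and TA: "T \<subseteq> ?A" and LA: "L \<subseteq> ?A"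
    using fin TL by (auto intro: finite_subset)
  obtain R where RX: "R \<subseteq> ?X" and rep: "\<And>f. f \<in> ?X \<Longrightarrow> \<exists>e\<in>R. same_syndrome ?A S e f"
    and inj: "\<And>e f. e \<in> R \<Longrightarrow> f \<in> R \<Longrightarrow> same_syndrome ?A S e f \<Longrightarrow> e = f"
    by (rule exists_representatives[of "same_syndrome ?A S" ?X]) (auto simp: same_syndrome_iff)
  have finR: "finite R" using RX finT by (auto intro: finite_subset)
  have supR: "fst e \<in> supported L \<and> snd e \<in> supported L" if "e \<in> R" for e
    using that RX supported_mono[OF TL] by (metis SigmaE2 subsetD surjective_pairing)
  let ?J = "insert None (Some ` R)" and ?F = "correction ?A S R"
  let ?\<Phi> = "kraus L ?J (\<lambda>j. op_matrix (?F j))"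
  have "(\<Sum>j\<in>?J. \<Sum>x\<in>confs L. cnj (op_matrix (?F j) x u) * op_matrix (?F j) x v) = (if u = v then 1 else 0)"
    if "u \<in> confs L" "v \<in> confs L" for u v
  proof -
    have "(\<Sum>j\<in>?J. inner_on L (?F j (basis_state u)) (?F j (basis_state v))) =
        inner_on L (basis_state u) (basis_state v)"
      by (rule sum_inner_on_correction[OF S _ finR]) (use supS supR inj in auto)
    also have "\<dots> = (\<Sum>x\<in>confs L. if x = u then (if u = v then 1 else 0) else 0)"
      unfolding inner_on_def by (intro sum.cong) (auto simp: basis_state_def)
    also have "\<dots> = (if u = v then 1 else 0)" using that fin by simp
    finally show ?thesis by (simp add: inner_on_def op_matrix_def)
  qed
  then have "quantum_channel L ?\<Phi>"
    unfolding quantum_channel_def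
    using fin(1) by (intro conjI linear_on_opers_kraus completely_positive_kraus trace_preserving_kraus)
  moreover have "chan_ext L E ?\<Phi> (erase ?A T (proj \<psi>)) = proj \<psi>" if \<psi>: "\<psi> \<in> Q" for \<psi>
  proof (intro ext)
    fix x y
    have h: "\<psi> \<in> hilb ?A" using \<psi> hilb by auto
    let ?k = "1 / of_nat (CARD('a) ^ card T * CARD('a) ^ card T) :: complex"
    show "chan_ext L E ?\<Phi> (erase ?A T (proj \<psi>)) x y = proj \<psi> x y"
    proof (cases "x \<in> confs ?A \<and> y \<in> confs ?A")
      case False
      then show ?thesis using h by (auto simp: chan_ext_def proj_def hilb_def)
    next
      case True
      have "chan_ext L E ?\<Phi> (erase ?A T (proj \<psi>)) x y =
          (\<Sum>f\<in>?X. ?k * (\<Sum>j\<in>?J. ?F j (weyl ?A f \<psi>) x * cnj (?F j (weyl ?A f \<psi>) y)))"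
        unfolding erase_eq_twirl[OF finA TA h]
      proof (rule chan_ext_kraus)
        show "local_on L ?A (?F j)" if "j \<in> ?J" for j
          using local_on_correction[OF finA LA supS supR that] by blast
      qed (use True in auto)
      also have "\<dots> = (\<Sum>f\<in>?X. ?k * (\<psi> x * cnj (\<psi> y)))"
      proof (intro sum.cong refl arg_cong2[of _ _ _ _ "(*)"])
        fix f assume f: "f \<in> ?X"
        then obtain e where e: "e \<in> R" "same_syndrome ?A S e f" using rep by blast
        have "f - e \<in> ?X" using f e(1) RX by (auto simp: supported_diff)
        moreover have "add_char (symp_form ?A s (f - e)) = 1" if "s \<in> S" for s
          using e(2) that by (simp add: same_syndrome_iff symp_form_diff_right add_char_eq_iff)
        ultimately have "weyl ?A (f - e) \<psi> = \<psi>" by (rule triv[OF \<psi>])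
        then show "(\<Sum>j\<in>?J. ?F j (weyl ?A f \<psi>) x * cnj (?F j (weyl ?A f \<psi>) y)) = \<psi> x * cnj (\<psi> y)"
          by (intro correction_error[OF S fixed[OF \<psi>] finR inj e])
      qed
      \<comment> \<open>The weights sum to one, as there are q^(2|T|) labels.\<close>
      also have "\<dots> = proj \<psi> x y"
        using finT by (simp add: card_cartesian_product card_supported proj_def)
      finally show ?thesis .
    qed
  qed
  ultimately show thesis by (rule that)
qed

section \<open>Counting in linear codes\<close>

lemma bij_betw_vec: "bij_betw (vec n) ({..<n} \<rightarrow>\<^sub>E (UNIV :: 'a set)) (carrier_vec n)"
proof (rule bij_betw_byWitness[of _ "\<lambda>v. restrict (\<lambda>i. v $ i) {..<n}"])
  show "\<forall>f\<in>{..<n} \<rightarrow>\<^sub>E (UNIV :: 'a set). restrict (\<lambda>i. vec n f $ i) {..<n} = f"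
    by (auto simp: PiE_def extensional_def restrict_def fun_eq_iff)
  show "\<forall>v\<in>carrier_vec n. vec n (restrict (\<lambda>i. v $ i :: 'a) {..<n}) = v"
    by (intro ballI eq_vecI) simp_all
  show "vec n ` ({..<n} \<rightarrow>\<^sub>E (UNIV :: 'a set)) \<subseteq> carrier_vec n"
    by (rule image_subsetI) simp
  show "(\<lambda>v. restrict (\<lambda>i. v $ i :: 'a) {..<n}) ` carrier_vec n \<subseteq> {..<n} \<rightarrow>\<^sub>E UNIV"
    by (rule image_subsetI) simp
qed

lemma finite_carrier_vec [simp]: "finite (carrier_vec n :: 'a :: finite vec set)"
  using bij_betw_finite[OF bij_betw_vec[of n, where 'a = 'a]] by (simp add: finite_PiE)

lemma card_carrier_vec: "card (carrier_vec n :: 'a :: finite vec set) = CARD('a) ^ n"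
  using bij_betw_same_card[OF bij_betw_vec[of n, where 'a = 'a]] by (simp add: card_PiE)

lemma (in vectorspace) card_carrier_eq_power_dim:
  assumes fin: "finite (carrier V)"
  shows "card (carrier V) = card (carrier K) ^ dim"
proof -
  have "gen_set (carrier V)"
    using in_own_span[of "carrier V"] span_is_subset2[of "carrier V"] by auto
  then have "fin_dim" using fin unfolding fin_dim_def by blast
  then obtain B where B: "finite B" "basis B" using finite_basis_exists by blast
  then have sub: "B \<subseteq> carrier V" by (simp add: basis_def)
  let ?F = "B \<rightarrow>\<^sub>E carrier K"
  have uniq: "\<exists>!a. a \<in> ?F \<and> lincomb a B = v" if "v \<in> carrier V" for v
    using basis_criterion[OF B(1) sub] B(2) that by blast
  have closed: "lincomb a B \<in> carrier V" if "a \<in> ?F" for a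
    using that sub by (intro lincomb_closed) auto
  have "bij_betw (\<lambda>a. lincomb a B) ?F (carrier V)"
    unfolding bij_betw_def inj_on_def using uniq closed by blast
  then have "card (carrier V) = card ?F" using bij_betw_same_card by metis
  also have "\<dots> = card (carrier K) ^ dim"
    using B by (simp add: card_PiE dim_basis)
  finally show ?thesis .
qed

lemma card_subspace_vec:
  fixes C :: "'a :: {finite, field} vec set"
  assumes "VectorSpace.subspace class_ring C (module_vec TYPE('a) n)"
  shows "card C = CARD('a) ^ code_dim n C"
proof -
  interpret vec_space "TYPE('a)" n .
  interpret W: vectorspace class_ring "(module_vec TYPE('a) n)\<lparr>carrier := C\<rparr>"
    using assms by (rule subspace_is_vs)
  have "C \<subseteq> carrier_vec n"
    using assms unfolding VectorSpace.subspace_def submodule_def by (simp add: module_vec_simps)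
  then have "finite C" using finite_carrier_vec finite_subset by blast
  then show ?thesis
    using W.card_carrier_eq_power_dim by (simp add: code_dim_def class_ring_simps)
qed

lemma card_image_mat_eq_power_rank:
  fixes M :: "'a :: {finite, field} mat"
  assumes "M \<in> carrier_mat m n"
  shows "card ((*\<^sub>v) M ` carrier_vec n) = CARD('a) ^ vec_space.rank m M"
proof -
  interpret vec_space "TYPE('a)" m .
  have cols: "set (cols M) \<subseteq> carrier_vec m" using assms cols_dim by blast
  have "col_space M = (*\<^sub>v) M ` carrier_vec n"
    using assms by (auto simp: col_space_eq[OF assms])
  moreover have "VectorSpace.subspace class_ring (span (set (cols M))) (module_vec TYPE('a) m)"
    using cols by (intro span_is_subspace) (simp add: module_vec_simps)
  note card_subspace_vec[OF this]
  ultimately show ?thesis by (simp add: rank_def col_space_def code_dim_def)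
qed

lemma mat_kernel_zero_mem: "M \<in> carrier_mat m n \<Longrightarrow> 0\<^sub>v n \<in> mat_kernel M"
  by (rule mat_kernelI) auto

lemma card_mat_fibre:
  fixes M :: "'a :: {finite, field} mat"
  assumes M: "M \<in> carrier_mat m n" and y: "y \<in> (*\<^sub>v) M ` carrier_vec n"
  shows "card {x \<in> carrier_vec n. M *\<^sub>v x = y} = card (mat_kernel M)"
proof -
  obtain x where x: "x \<in> carrier_vec n" "y = M *\<^sub>v x" using y by auto
  have "bij_betw (\<lambda>k. x + k) (mat_kernel M) {z \<in> carrier_vec n. M *\<^sub>v z = y}"
  proof (rule bij_betw_byWitness[of _ "\<lambda>z. z - x"])
    show "\<forall>k\<in>mat_kernel M. x + k - x = k"
    proof
      fix k assume "k \<in> mat_kernel M"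
      then have "k \<in> carrier_vec n" by (rule mat_kernelD(1)[OF M])
      with x show "x + k - x = k" by (intro eq_vecI) auto
    qed
    show "\<forall>z\<in>{z \<in> carrier_vec n. M *\<^sub>v z = y}. x + (z - x) = z"
      using x by (auto intro!: eq_vecI)
    show "(\<lambda>k. x + k) ` mat_kernel M \<subseteq> {z \<in> carrier_vec n. M *\<^sub>v z = y}"
      using x M mat_kernelD[OF M] by (auto simp: mult_add_distrib_mat_vec[OF M])
    show "(\<lambda>z. z - x) ` {z \<in> carrier_vec n. M *\<^sub>v z = y} \<subseteq> mat_kernel M"
      using x M by (auto intro!: mat_kernelI[OF M] simp: mult_minus_distrib_mat_vec[OF M])
  qed
  then show ?thesis using bij_betw_same_card by metis
qed

text \<open>Rank-nullity in multiplicative form, obtained by summing the fibres over the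
  image.\<close>

lemma card_image_times_kernel:
  fixes M :: "'a :: {finite, field} mat"
  assumes M: "M \<in> carrier_mat m n"
  shows "card ((*\<^sub>v) M ` carrier_vec n) * card (mat_kernel M) = CARD('a) ^ n"
proof -
  have "card (carrier_vec n :: 'a vec set) =
      (\<Sum>y\<in>(*\<^sub>v) M ` carrier_vec n. card {x \<in> carrier_vec n. M *\<^sub>v x = y})"
    using sum.image_gen[of "carrier_vec n :: 'a vec set" "\<lambda>_. 1 :: nat" "(*\<^sub>v) M"] by simp
  also have "\<dots> = card ((*\<^sub>v) M ` carrier_vec n) * card (mat_kernel M)"
    using card_mat_fibre[OF M] by simp
  finally show ?thesis by (simp add: card_carrier_vec)
qed

lemma eq_zero_if_orthogonal_all:
  fixes z :: "'a :: {finite, field} vec"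
  assumes "z \<in> carrier_vec n" "\<And>u. u \<in> carrier_vec n \<Longrightarrow> u \<bullet> z = 0"
  shows "z = 0\<^sub>v n"
proof
  fix i assume "i < dim_vec (0\<^sub>v n :: 'a vec)"
  then have i: "i < n" by simp
  then show "z $ i = 0\<^sub>v n $ i" using assms(2)[of "unit_vec n i"] assms(1) by simp
qed (use assms in auto)

lemma sum_add_char_scalar_prod:
  fixes z :: "'a :: {finite, field} vec"
  assumes z: "z \<in> carrier_vec n"
  shows "(\<Sum>u\<in>carrier_vec n. add_char (u \<bullet> z)) = (if z = 0\<^sub>v n then of_nat (CARD('a) ^ n) else 0)"
proof (cases "z = 0\<^sub>v n")
  case True
  then show ?thesis by (simp add: card_carrier_vec)
next
  case False
  then obtain v where v: "v \<in> carrier_vec n" "v \<bullet> z \<noteq> 0" using eq_zero_if_orthogonal_all[OF z] by blast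
  then obtain t where t: "add_char (t * (v \<bullet> z)) \<noteq> 1" using add_char_mult_eq_1_imp by blast
  have bij: "bij_betw (\<lambda>u. u + t \<cdot>\<^sub>v v) (carrier_vec n) (carrier_vec n)"
    by (rule bij_betw_byWitness[of _ "\<lambda>u. u - t \<cdot>\<^sub>v v"]) (use v in auto)
  have "(\<Sum>u\<in>carrier_vec n. add_char (u \<bullet> z)) = 0"
    by (rule sum_eq_0_if_shift[OF bij _ t])
      (use v z in \<open>simp add: add_scalar_prod_distrib[of _ n] add_char_add mult.commute\<close>)
  with False show ?thesis by simp
qed

text \<open>Both sides count \<open>\<Sum>\<^sub>u\<^sub>,\<^sub>x \<chi>(u \<bullet> M x)\<close>; this replaces the equality of row and column rank.\<close>

lemma card_kernel_transpose:
  fixes M :: "'a :: {finite, field} mat"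
  assumes M: "M \<in> carrier_mat m n"
  shows "CARD('a) ^ m * card (mat_kernel M) = CARD('a) ^ n * card (mat_kernel M\<^sup>T)"
proof -
  have T: "M\<^sup>T \<in> carrier_mat n m" using M by simp
  have aux: "(\<Sum>x\<in>carrier_vec b. \<Sum>u\<in>carrier_vec a. add_char (u \<bullet> (N *\<^sub>v x))) =
      of_nat (CARD('a) ^ a * card (mat_kernel N))" if N: "N \<in> carrier_mat a b" for N :: "'a mat" and a b
  proof -
    have "(\<Sum>x\<in>carrier_vec b. \<Sum>u\<in>carrier_vec a. add_char (u \<bullet> (N *\<^sub>v x))) =
        (\<Sum>x\<in>carrier_vec b. if x \<in> mat_kernel N then of_nat (CARD('a) ^ a) else 0)"
      using N by (intro sum.cong refl) (simp add: sum_add_char_scalar_prod mat_kernel[OF N])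
    also have "\<dots> = (\<Sum>x\<in>carrier_vec b \<inter> mat_kernel N. of_nat (CARD('a) ^ a))"
      by (rule sum.inter_restrict[symmetric]) simp
    also have "carrier_vec b \<inter> mat_kernel N = mat_kernel N" using mat_kernelD[OF N] by auto
    finally show ?thesis by (simp add: mult.commute)
  qed
  have "(\<Sum>x\<in>carrier_vec n. \<Sum>u\<in>carrier_vec m. add_char (u \<bullet> (M *\<^sub>v x))) =
      (\<Sum>x\<in>carrier_vec n. \<Sum>u\<in>carrier_vec m. add_char (x \<bullet> (M\<^sup>T *\<^sub>v u)))"
  proof (intro sum.cong refl arg_cong[of _ _ add_char])
    fix x u :: "'a vec" assume "x \<in> carrier_vec n" "u \<in> carrier_vec m"
    then show "u \<bullet> (M *\<^sub>v x) = x \<bullet> (M\<^sup>T *\<^sub>v u)"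
      using M transpose_vec_mult_scalar[OF M] comm_scalar_prod[of x n "M\<^sup>T *\<^sub>v u"] by simp
  qed
  also have "\<dots> = (\<Sum>u\<in>carrier_vec m. \<Sum>x\<in>carrier_vec n. add_char (x \<bullet> (M\<^sup>T *\<^sub>v u)))"
    by (rule sum.swap)
  finally show ?thesis unfolding aux[OF M] aux[OF T] of_nat_eq_iff .
qed

section \<open>Injectivity, surjectivity and rank factorizations\<close>

lemma card_mat_kernel_eq_1_iff:
  fixes M :: "'a :: {finite, field} mat"
  assumes M: "M \<in> carrier_mat m n"
  shows "card (mat_kernel M) = 1 \<longleftrightarrow> mat_kernel M = {0\<^sub>v n}"
  using mat_kernel_zero_mem[OF M] by (auto simp: card_1_singleton_iff)

lemma inj_on_mat_iff_kernel:
  fixes M :: "'a :: {finite, field} mat"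
  assumes M: "M \<in> carrier_mat m n"
  shows "inj_on ((*\<^sub>v) M) (carrier_vec n) \<longleftrightarrow> mat_kernel M = {0\<^sub>v n}"
proof -
  have "inj_on ((*\<^sub>v) M) (carrier_vec n) \<longleftrightarrow> card ((*\<^sub>v) M ` carrier_vec n) = CARD('a) ^ n"
    by (metis card_carrier_vec card_image eq_card_imp_inj_on finite_carrier_vec)
  also have "\<dots> \<longleftrightarrow> card (mat_kernel M) = 1"
    using card_image_times_kernel[OF M] by (metis mult.right_neutral mult_cancel_left
        power_not_zero zero_less_card_finite less_irrefl)
  finally show ?thesis using card_mat_kernel_eq_1_iff[OF M] by simp
qed

text \<open>\<open>card_image_times_kernel\<close> and \<open>card_kernel_transpose\<close> combine
  to q^m = |im M| |ker M^T|, so the image is full exactly if the kernel is trivial.\<close>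

lemma surj_mat_iff_inj_transpose:
  fixes M :: "'a :: {finite, field} mat"
  assumes M: "M \<in> carrier_mat m n"
  shows "(*\<^sub>v) M ` carrier_vec n = carrier_vec m \<longleftrightarrow> inj_on ((*\<^sub>v) M\<^sup>T) (carrier_vec m)"
proof -
  have T: "M\<^sup>T \<in> carrier_mat n m" using M by simp
  let ?I = "card ((*\<^sub>v) M ` carrier_vec n)" and ?k = "card (mat_kernel M)" and ?k' = "card (mat_kernel M\<^sup>T)"
  have q: "0 < CARD('a)" by simp
  have "?I * ?k = CARD('a) ^ n" by (rule card_image_times_kernel[OF M])
  moreover have "CARD('a) ^ m * ?k = CARD('a) ^ n * ?k'" by (rule card_kernel_transpose[OF M])
  ultimately have "CARD('a) ^ m * ?k = ?I * ?k' * ?k" "?k \<noteq> 0"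
    by (auto intro: Nat.gr0I)
  then have eq: "CARD('a) ^ m = ?I * ?k'" by simp
  have "(*\<^sub>v) M ` carrier_vec n = carrier_vec m \<longleftrightarrow> ?I = CARD('a) ^ m"
    by (metis (no_types, lifting) M card_carrier_vec card_subset_eq finite_carrier_vec image_subsetI mult_mat_vec_carrier)
  also have "\<dots> \<longleftrightarrow> ?k' = 1"
  proof
    assume "?I = CARD('a) ^ m" with eq q show "?k' = 1"
      by (metis mult_cancel_left mult.right_neutral power_not_zero less_irrefl)
  qed (use eq in simp)
  finally show ?thesis using card_mat_kernel_eq_1_iff[OF T] inj_on_mat_iff_kernel[OF T] by simp
qed

text \<open>The q^c values of \<open>F * G\<close> are images under \<open>F\<close> of values of
  \<open>G\<close>, and those lie in a space of only q^c vectors. So \<open>G\<close> must attain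
  all of them and \<open>F\<close> must keep them apart.\<close>

lemma rank_factorization:
  fixes F G :: "'a :: {finite, field} mat"
  assumes F: "F \<in> carrier_mat m c" and G: "G \<in> carrier_mat c n"
    and rank: "card ((*\<^sub>v) (F * G) ` carrier_vec n) = CARD('a) ^ c"
  shows "inj_on ((*\<^sub>v) F) (carrier_vec c)" and "(*\<^sub>v) G ` carrier_vec n = carrier_vec c"
proof -
  let ?GV = "(*\<^sub>v) G ` carrier_vec n"
  have sub: "?GV \<subseteq> carrier_vec c" using G by auto
  have eq: "(*\<^sub>v) (F * G) ` carrier_vec n = (*\<^sub>v) F ` ?GV"
    using F G by (auto simp: image_image)
  have "CARD('a) ^ c \<le> card ?GV"
    using card_image_le[of ?GV "(*\<^sub>v) F"] rank unfolding eq by simp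
  then show GV: "?GV = carrier_vec c"
    using sub by (intro card_seteq) (auto simp: card_carrier_vec)
  show "inj_on ((*\<^sub>v) F) (carrier_vec c)"
    using rank unfolding eq GV by (intro eq_card_imp_inj_on) (auto simp: card_carrier_vec)
qed

text \<open>Independence of the rows of \<open>H\<close> comes from counting: a kernel of size q^k
  forces an image of size q^(n-k), so \<open>H\<close> is onto and its transpose is
  injective.\<close>

lemma parity_check_facts:
  fixes C :: "'a :: {finite, field} vec set"
  assumes lin: "linear_code n k d C" and H: "parity_check_matrix n k C H"
  shows "k \<le> n" and "H \<in> carrier_mat (n - k) n" and "C = mat_kernel H"
    and "card C = CARD('a) ^ k"
    and "dual n C = (*\<^sub>v) H\<^sup>T ` carrier_vec (n - k)"
    and "inj_on ((*\<^sub>v) H\<^sup>T) (carrier_vec (n - k))"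
proof -
  have q: "1 < CARD('a)" using card_mono[of UNIV "{0, 1 :: 'a}"] by simp
  show M: "H \<in> carrier_mat (n - k) n" and C: "C = mat_kernel H"
    using H by (auto simp: parity_check_matrix_def)
  show cardC: "card C = CARD('a) ^ k"
    using lin card_subspace_vec by (auto simp: linear_code_def)
  have "card C \<le> CARD('a) ^ n"
    using card_mono[of "carrier_vec n" C] C mat_kernelD[OF M] by (auto simp: card_carrier_vec)
  then show k: "k \<le> n" using q by (simp add: cardC)
  have "card ((*\<^sub>v) H ` carrier_vec n) * CARD('a) ^ k = CARD('a) ^ (n - k) * CARD('a) ^ k"
    using card_image_times_kernel[OF M] cardC C k by (simp flip: power_add)
  then have "card ((*\<^sub>v) H ` carrier_vec n) = CARD('a) ^ (n - k)" using q by simp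
  then have "(*\<^sub>v) H ` carrier_vec n = carrier_vec (n - k)"
    using M by (intro card_subset_eq) (auto simp: card_carrier_vec)
  then show "inj_on ((*\<^sub>v) H\<^sup>T) (carrier_vec (n - k))" by (simp add: surj_mat_iff_inj_transpose[OF M])
  interpret vec_space "TYPE('a)" n .
  show "dual n C = (*\<^sub>v) H\<^sup>T ` carrier_vec (n - k)"
  proof -
    have "dual n C = {w \<in> carrier_vec n. \<exists>y\<in>carrier_vec (n - k). H\<^sup>T *\<^sub>v y = w}"
      using H M row_space_eq[OF M] by (simp add: parity_check_matrix_def)
    also have "\<dots> = (*\<^sub>v) H\<^sup>T ` carrier_vec (n - k)" using M by auto
    finally show ?thesis .
  qed
qed

lemma subspace_vecI:
  fixes W :: "'a :: field vec set"
  assumes "W \<subseteq> carrier_vec n" "0\<^sub>v n \<in> W" "\<And>v w. v \<in> W \<Longrightarrow> w \<in> W \<Longrightarrow> v + w \<in> W"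
    "\<And>c v. v \<in> W \<Longrightarrow> c \<cdot>\<^sub>v v \<in> W"
  shows "VectorSpace.subspace class_ring W (module_vec TYPE('a) n)"
proof -
  interpret vec_space "TYPE('a)" n .
  have "submodule class_ring W (module_vec TYPE('a) n)"
    using assms by unfold_locales (auto simp: module_vec_simps class_ring_simps)
  then show ?thesis using vec_vs unfolding VectorSpace.subspace_def by blast
qed

text \<open>Orthogonality of the pairs \<open>(u H\<^sub>X, u F\<^sub>X)\<close> and \<open>(v H\<^sub>Z, v F\<^sub>Z)\<close>, the form in which
  \<open>- H\<^sub>X H\<^sub>Z\<^sup>T = F\<^sub>X F\<^sub>Z\<^sup>T\<close> is used; unlike the matrix equation it is symmetric in X and Z.\<close>

locale ea_css_matrices =
  fixes n c mX mZ :: nat and HX HZ FX FZ :: "'a :: {finite, field} mat"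
  assumes HX: "HX \<in> carrier_mat mX n" and HZ: "HZ \<in> carrier_mat mZ n"
    and FX: "FX \<in> carrier_mat mX c" and FZ: "FZ \<in> carrier_mat mZ c"
    and orth: "\<And>u v. u \<in> carrier_vec mX \<Longrightarrow> v \<in> carrier_vec mZ \<Longrightarrow>
      (HX\<^sup>T *\<^sub>v u) \<bullet> (HZ\<^sup>T *\<^sub>v v) + (FX\<^sup>T *\<^sub>v u) \<bullet> (FZ\<^sup>T *\<^sub>v v) = 0"
    and inj_HX: "inj_on ((*\<^sub>v) HX\<^sup>T) (carrier_vec mX)"
    and inj_HZ: "inj_on ((*\<^sub>v) HZ\<^sup>T) (carrier_vec mZ)"
    and surj_FX: "(*\<^sub>v) FX\<^sup>T ` carrier_vec mX = carrier_vec c"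
    and surj_FZ: "(*\<^sub>v) FZ\<^sup>T ` carrier_vec mZ = carrier_vec c"
begin

text \<open>Through this symmetry a lemma about X rows also yields its Z version.\<close>

lemma ea_css_matrices_swap: "ea_css_matrices n c mZ mX HZ HX FZ FX"
proof unfold_locales
  fix u v :: "'a vec" assume uv: "u \<in> carrier_vec mZ" "v \<in> carrier_vec mX"
  have "(HZ\<^sup>T *\<^sub>v u) \<bullet> (HX\<^sup>T *\<^sub>v v) = (HX\<^sup>T *\<^sub>v v) \<bullet> (HZ\<^sup>T *\<^sub>v u)"
    using uv HX HZ by (intro comm_scalar_prod[of _ n]) auto
  moreover have "(FZ\<^sup>T *\<^sub>v u) \<bullet> (FX\<^sup>T *\<^sub>v v) = (FX\<^sup>T *\<^sub>v v) \<bullet> (FZ\<^sup>T *\<^sub>v u)"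
    using uv FX FZ by (intro comm_scalar_prod[of _ c]) auto
  ultimately show "(HZ\<^sup>T *\<^sub>v u) \<bullet> (HX\<^sup>T *\<^sub>v v) + (FZ\<^sup>T *\<^sub>v u) \<bullet> (FX\<^sup>T *\<^sub>v v) = 0"
    using orth[OF uv(2,1)] by simp
qed (rule HX HZ FX FZ inj_HX inj_HZ surj_FX surj_FZ)+

text \<open>Against any \<open>v\<close>, the syndrome of u HX pairs to minus the product of v FZ
  and u FX, and v FZ ranges over all vectors of length \<open>c\<close>. So Bob's qudits are touched
  exactly by the rows that violate checks of the other type.\<close>

lemma syndrome_row_eq_0_iff:
  assumes u: "u \<in> carrier_vec mX"
  shows "HZ *\<^sub>v (HX\<^sup>T *\<^sub>v u) = 0\<^sub>v mZ \<longleftrightarrow> FX\<^sup>T *\<^sub>v u = 0\<^sub>v c"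
proof -
  have h: "HX\<^sup>T *\<^sub>v u \<in> carrier_vec n" and f: "FX\<^sup>T *\<^sub>v u \<in> carrier_vec c" using HX FX u by auto
  have eq: "v \<bullet> (HZ *\<^sub>v (HX\<^sup>T *\<^sub>v u)) = - ((FZ\<^sup>T *\<^sub>v v) \<bullet> (FX\<^sup>T *\<^sub>v u))" if v: "v \<in> carrier_vec mZ" for v
  proof -
    have "v \<bullet> (HZ *\<^sub>v (HX\<^sup>T *\<^sub>v u)) = (HZ\<^sup>T *\<^sub>v v) \<bullet> (HX\<^sup>T *\<^sub>v u)"
      using transpose_vec_mult_scalar[OF HZ h v] by simp
    then show ?thesis
      using ea_css_matrices.orth[OF ea_css_matrices_swap v u] by (simp add: eq_neg_iff_add_eq_0)
  qed
  show ?thesis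
  proof
    assume "HZ *\<^sub>v (HX\<^sup>T *\<^sub>v u) = 0\<^sub>v mZ"
    then have "(FZ\<^sup>T *\<^sub>v v) \<bullet> (FX\<^sup>T *\<^sub>v u) = 0" if "v \<in> carrier_vec mZ" for v
      using eq[OF that] that by simp
    then have "w \<bullet> (FX\<^sup>T *\<^sub>v u) = 0" if "w \<in> carrier_vec c" for w
      using that unfolding surj_FZ[symmetric] by auto
    then show "FX\<^sup>T *\<^sub>v u = 0\<^sub>v c" by (rule eq_zero_if_orthogonal_all[OF f])
  next
    assume "FX\<^sup>T *\<^sub>v u = 0\<^sub>v c"
    then have "v \<bullet> (HZ *\<^sub>v (HX\<^sup>T *\<^sub>v u)) = 0" if "v \<in> carrier_vec mZ" for v
      using eq[OF that] that FZ by simp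
    then show "HZ *\<^sub>v (HX\<^sup>T *\<^sub>v u) = 0\<^sub>v mZ"
      using HZ h by (intro eq_zero_if_orthogonal_all) auto
  qed
qed

lemma card_kernel_FX: "CARD('a) ^ c * card (mat_kernel FX\<^sup>T) = CARD('a) ^ mX"
  using card_image_times_kernel[of "FX\<^sup>T" c mX] FX by (simp add: surj_FX card_carrier_vec)

text \<open>By \<open>syndrome_row_eq_0_iff\<close> the intersection is the injective image of the
  kernel of u \<mapsto> u FX, a map onto a space of dimension \<open>c\<close>. Together with the
  swap this gives both formulas for \<open>c\<close>.\<close>

lemma code_dim_rows_inter_kernel:
  "mX = code_dim n ((*\<^sub>v) HX\<^sup>T ` carrier_vec mX \<inter> mat_kernel HZ) + c"
proof -
  let ?D = "(*\<^sub>v) HX\<^sup>T ` carrier_vec mX \<inter> mat_kernel HZ"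
  have T: "HX\<^sup>T \<in> carrier_mat n mX" "FX\<^sup>T \<in> carrier_mat c mX" using HX FX by auto
  have q: "1 < CARD('a)" using card_mono[of UNIV "{0, 1 :: 'a}"] by simp
  have "?D = (*\<^sub>v) HX\<^sup>T ` mat_kernel FX\<^sup>T"
    using syndrome_row_eq_0_iff T by (auto simp: mat_kernel[OF HZ] mat_kernel[OF T(2)])
  moreover have "inj_on ((*\<^sub>v) HX\<^sup>T) (mat_kernel FX\<^sup>T)"
    using inj_HX mat_kernelD[OF T(2)] by (auto intro: inj_on_subset)
  ultimately have card: "card ?D = card (mat_kernel FX\<^sup>T)" by (simp add: card_image)
  have "VectorSpace.subspace class_ring ?D (module_vec TYPE('a) n)"
  proof (rule subspace_vecI)
    show "?D \<subseteq> carrier_vec n" using mat_kernelD[OF HZ] by auto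
    have "0\<^sub>v n = HX\<^sup>T *\<^sub>v 0\<^sub>v mX" using T by auto
    then have "0\<^sub>v n \<in> (*\<^sub>v) HX\<^sup>T ` carrier_vec mX" by (rule image_eqI) simp
    then show "0\<^sub>v n \<in> ?D" using mat_kernel_zero_mem[OF HZ] by simp
  next
    fix v w assume "v \<in> ?D" "w \<in> ?D"
    then obtain a b where ab: "a \<in> carrier_vec mX" "b \<in> carrier_vec mX" "v = HX\<^sup>T *\<^sub>v a" "w = HX\<^sup>T *\<^sub>v b"
      and k: "v \<in> mat_kernel HZ" "w \<in> mat_kernel HZ" by auto
    have "v + w = HX\<^sup>T *\<^sub>v (a + b)" using ab T(1) by (simp add: mult_add_distrib_mat_vec)
    moreover have "v + w \<in> mat_kernel HZ"
      using k mat_kernelD[OF HZ] HZ by (intro mat_kernelI[OF HZ]) (auto simp: mult_add_distrib_mat_vec[OF HZ])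
    ultimately show "v + w \<in> ?D" using ab by auto
  next
    fix t v assume "v \<in> ?D"
    then obtain a where a: "a \<in> carrier_vec mX" "v = HX\<^sup>T *\<^sub>v a" and k: "v \<in> mat_kernel HZ" by auto
    have "t \<cdot>\<^sub>v v = HX\<^sup>T *\<^sub>v (t \<cdot>\<^sub>v a)" using a T(1) by (simp add: mult_mat_vec)
    moreover have "t \<cdot>\<^sub>v v \<in> mat_kernel HZ" using mat_kernel_smult[OF HZ k] .
    ultimately show "t \<cdot>\<^sub>v v \<in> ?D" using a by auto
  qed
  then have "card ?D = CARD('a) ^ code_dim n ?D" by (rule card_subspace_vec)
  then have "CARD('a) ^ (code_dim n ?D + c) = CARD('a) ^ mX"
    using card card_kernel_FX by (simp add: power_add mult.commute)
  then show ?thesis using q by (simp only: power_inject_exp)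
qed

end

lemma ea_css_matricesI:
  fixes HX HZ FX FZ :: "'a :: {finite, field} mat"
  assumes HX: "HX \<in> carrier_mat mX n" and HZ: "HZ \<in> carrier_mat mZ n"
    and FX: "FX \<in> carrier_mat mX c" and FZ: "FZ \<in> carrier_mat mZ c"
    and rank: "c = vec_space.rank mX (HX * HZ\<^sup>T)"
    and factor: "- (HX * HZ\<^sup>T) = FX * FZ\<^sup>T"
    and inj: "inj_on ((*\<^sub>v) HX\<^sup>T) (carrier_vec mX)" "inj_on ((*\<^sub>v) HZ\<^sup>T) (carrier_vec mZ)"
  shows "ea_css_matrices n c mX mZ HX HZ FX FZ"
proof -
  have T: "HZ\<^sup>T \<in> carrier_mat n mZ" "FX\<^sup>T \<in> carrier_mat c mX" "FZ\<^sup>T \<in> carrier_mat c mZ" using HZ FX FZ by auto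
  have P: "HX * HZ\<^sup>T \<in> carrier_mat mX mZ" using HX T by simp
  \<comment> \<open>The factorization is that of the negated product. As negation preserves the
    number of values, \<open>FX * FZ\<^sup>T\<close> again has rank \<open>c\<close>, which is its
    inner dimension.\<close>
  have neg: "(FX * FZ\<^sup>T) *\<^sub>v v = - ((HX * HZ\<^sup>T) *\<^sub>v v)" if "v \<in> carrier_vec mZ" for v
    using that HX HZ unfolding factor[symmetric] by (intro uminus_mult_mat_vec) simp
  have "(*\<^sub>v) (FX * FZ\<^sup>T) ` carrier_vec mZ = uminus ` (*\<^sub>v) (HX * HZ\<^sup>T) ` carrier_vec mZ"
    unfolding image_image using neg by (intro image_cong refl) simp
  moreover have "inj_on uminus ((*\<^sub>v) (HX * HZ\<^sup>T) ` carrier_vec mZ)"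
    by (rule inj_onI) (metis uminus_uminus_vec)
  ultimately have "card ((*\<^sub>v) (FX * FZ\<^sup>T) ` carrier_vec mZ) = CARD('a) ^ c"
    using card_image_mat_eq_power_rank[OF P] rank by (simp add: card_image)
  note F = rank_factorization[OF FX T(3) this]
  show ?thesis
  proof
    fix u v :: "'a vec" assume u: "u \<in> carrier_vec mX" and v: "v \<in> carrier_vec mZ"
    have "(HX\<^sup>T *\<^sub>v u) \<bullet> (HZ\<^sup>T *\<^sub>v v) = u \<bullet> ((HX * HZ\<^sup>T) *\<^sub>v v)"
      using transpose_vec_mult_scalar[OF HX _ u, of "HZ\<^sup>T *\<^sub>v v"] HX T v by simp
    moreover have "(FX\<^sup>T *\<^sub>v u) \<bullet> (FZ\<^sup>T *\<^sub>v v) = u \<bullet> ((FX * FZ\<^sup>T) *\<^sub>v v)"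
      using transpose_vec_mult_scalar[OF FX _ u, of "FZ\<^sup>T *\<^sub>v v"] FX T v by simp
    moreover have "u \<bullet> (- ((HX * HZ\<^sup>T) *\<^sub>v v)) = - (u \<bullet> ((HX * HZ\<^sup>T) *\<^sub>v v))"
      using u HX by (intro scalar_prod_uminus_right) simp
    ultimately show "(HX\<^sup>T *\<^sub>v u) \<bullet> (HZ\<^sup>T *\<^sub>v v) + (FX\<^sup>T *\<^sub>v u) \<bullet> (FZ\<^sup>T *\<^sub>v v) = 0"
      using neg[OF v] by simp
  next
    have "inj_on ((*\<^sub>v) FX\<^sup>T\<^sup>T) (carrier_vec c)" using F(1) by simp
    then show "(*\<^sub>v) FX\<^sup>T ` carrier_vec mX = carrier_vec c"
      using surj_mat_iff_inj_transpose[OF T(2)] by simp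
  qed (rule HX HZ FX FZ inj F(2))+
qed

section \<open>Stabilizer elements and unitary extensions\<close>

lemma mem_Qreg [simp]: "Tx j \<in> Qreg S \<longleftrightarrow> j \<in> S" "Bob j \<notin> Qreg S"
  and mem_Breg [simp]: "Bob j \<in> Breg c \<longleftrightarrow> j < c" "Tx j \<notin> Breg c"
  by (auto simp: Qreg_def Breg_def)

lemma finite_Qreg [simp]: "finite S \<Longrightarrow> finite (Qreg S)"
  and finite_Breg [simp]: "finite (Breg c)"
  and card_Qreg: "card (Qreg S) = card S"
  and card_Breg: "card (Breg c) = c"
  and Qreg_Breg_disjoint: "Qreg S \<inter> Breg c = {}"
  by (auto simp: Qreg_def Breg_def card_image inj_on_def)

lemma sum_Qreg: "(\<Sum>s\<in>Qreg S. f s) = (\<Sum>j\<in>S. f (Tx j))"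
  and sum_Breg: "(\<Sum>s\<in>Breg c. f s) = (\<Sum>j<c. f (Bob j))"
  by (simp_all add: Qreg_def Breg_def sum.reindex inj_on_def)

lemma restrict_mem_confs [simp]: "restrict z R \<in> confs R"
  by (simp add: confs_def)

lemma confs_eqI: "x \<in> confs R \<Longrightarrow> y \<in> confs R \<Longrightarrow> (\<And>s. s \<in> R \<Longrightarrow> x s = y s) \<Longrightarrow> x = y"
  unfolding confs_def by (rule PiE_ext)

lemma confs_outside: "x \<in> confs R \<Longrightarrow> s \<notin> R \<Longrightarrow> x s = undefined"
  by (auto simp: confs_def PiE_def extensional_def)

lemma mem_confsI: "(\<And>s. s \<notin> R \<Longrightarrow> x s = undefined) \<Longrightarrow> x \<in> confs R"
  by (auto simp: confs_def PiE_def extensional_def)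

lemma op_mult_pauli:
  fixes a b :: "'a :: {finite, field} vec"
  assumes R: "finite R" and x: "x \<in> confs R" and y: "y \<in> confs R"
  shows "op_mult R (pauli_X R a) (pauli_Z R b) x y =
    (if \<forall>s\<in>R. x s = y s + a $ idx s then \<Prod>s\<in>R. add_char (b $ idx s * y s) else 0)"
proof -
  let ?p = "\<Prod>s\<in>R. add_char (b $ idx s * y s)"
  have Z: "pauli_Z R b z y = (if z = y then ?p else 0)" if z: "z \<in> confs R" for z
  proof (cases "z = y")
    case True
    then show ?thesis using y by (simp add: pauli_Z_def Z1_def)
  next
    case False
    then obtain s where "s \<in> R" "z s \<noteq> y s" using confs_eqI[OF z y] by blast
    then have "(\<Prod>s\<in>R. Z1 (b $ idx s) (z s) (y s)) = 0"
      using R by (intro prod_zero) (auto simp: Z1_def)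
    then show ?thesis using False by (simp add: pauli_Z_def)
  qed
  have X: "pauli_X R a x y = (if \<forall>s\<in>R. x s = y s + a $ idx s then 1 else 0)"
  proof (cases "\<forall>s\<in>R. x s = y s + a $ idx s")
    case True
    then show ?thesis using x y by (simp add: pauli_X_def X1_def)
  next
    case False
    then have "(\<Prod>s\<in>R. X1 (a $ idx s) (x s) (y s)) = 0"
      using R by (intro prod_zero) (auto simp: X1_def)
    then show ?thesis unfolding pauli_X_def if_not_P[OF False] by simp
  qed
  have "op_mult R (pauli_X R a) (pauli_Z R b) x y =
      (\<Sum>z\<in>confs R. if z = y then pauli_X R a x y * ?p else 0)"
    unfolding op_mult_def by (intro sum.cong refl) (simp add: Z)
  then show ?thesis using R y by (simp add: X)
qed

definition conf_of :: "nat \<Rightarrow> nat \<Rightarrow> 'a :: zero vec \<Rightarrow> 'a vec \<Rightarrow> 'a conf" where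
  "conf_of n c a b = (\<lambda>s. case s of Tx j \<Rightarrow> if j < n then a $ j else 0 | Bob j \<Rightarrow> if j < c then b $ j else 0)"

lemma conf_of_simps [simp]:
  "conf_of n c a b (Tx j) = (if j < n then a $ j else 0)"
  "conf_of n c a b (Bob j) = (if j < c then b $ j else 0)"
  by (simp_all add: conf_of_def)

lemma site_forall: "(\<forall>s. P s) \<longleftrightarrow> (\<forall>j. P (Tx j)) \<and> (\<forall>j. P (Bob j))"
  by (metis site.exhaust)

lemma conf_of_supported [simp]: "conf_of n c a b \<in> supported (Qreg {..<n} \<union> Breg c)"
  by (auto simp: supported_def site_forall)

lemma conf_of_add:
  assumes "a' \<in> carrier_vec n" "b' \<in> carrier_vec c"
  shows "conf_of n c (a + a') (b + b') = conf_of n c a b + conf_of n c a' (b' :: 'a :: field vec)"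
  using assms by (auto simp: fun_eq_iff site_forall)

lemma conf_of_smult:
  assumes "a \<in> carrier_vec n" "b \<in> carrier_vec c"
  shows "conf_of n c (t \<cdot>\<^sub>v a) (t \<cdot>\<^sub>v b) = (\<lambda>s. t * conf_of n c a (b :: 'a :: field vec) s)"
  using assms by (auto simp: fun_eq_iff site_forall)

lemma conf_of_zero [simp]: "conf_of n c (0\<^sub>v n) (0\<^sub>v c) = (0 :: 'a :: field conf)"
  by (auto simp: fun_eq_iff site_forall)

lemma dotp_conf_of_left:
  "dotp (Qreg {..<n} \<union> Breg c) (conf_of n c a b) z =
    (\<Sum>j<n. a $ j * z (Tx j)) + (\<Sum>j<c. b $ j * z (Bob j))"
  by (simp add: dotp_def sum.union_disjoint Qreg_Breg_disjoint sum_Qreg sum_Breg)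

lemma dotp_conf_of:
  assumes "a' \<in> carrier_vec n" "b' \<in> carrier_vec c"
  shows "dotp (Qreg {..<n} \<union> Breg c) (conf_of n c a b) (conf_of n c a' b') = a \<bullet> a' + b \<bullet> b'"
  using assms by (simp add: dotp_conf_of_left scalar_prod_def atLeast0LessThan)

text \<open>The translation from Pauli matrices on the two registers to one label on the joint
  register. It needs \<open>\<psi>\<close> in \<open>hilb\<close>, because \<open>op_apply\<close>
  yields 0 outside \<open>confs\<close> while \<open>weyl\<close> merely shifts
  \<open>\<psi>\<close>.\<close>

lemma op_apply_stabilizer_element:
  fixes \<psi> :: "'a :: {finite, field} state"
  assumes \<psi>: "\<psi> \<in> hilb (Qreg {..<n} \<union> Breg c)"
  shows "op_apply (Qreg {..<n} \<union> Breg c) (op_tensor (Qreg {..<n}) (Breg c)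
      (op_mult (Qreg {..<n}) (pauli_X (Qreg {..<n}) a) (pauli_Z (Qreg {..<n}) b))
      (op_mult (Breg c) (pauli_X (Breg c) a') (pauli_Z (Breg c) b'))) \<psi> =
    weyl (Qreg {..<n} \<union> Breg c) (conf_of n c a a', conf_of n c b b') \<psi>"
    (is "op_apply ?A ?M \<psi> = weyl ?A (?g, ?h) \<psi>")
proof
  fix x
  let ?Q = "Qreg {..<n}" and ?B = "Breg c"
  show "op_apply ?A ?M \<psi> x = weyl ?A (?g, ?h) \<psi> x"
  proof (cases "x \<in> confs ?A")
    case False
    have "weyl ?A (?g, ?h) \<psi> \<in> hilb ?A" using \<psi> by (intro weyl_in_hilb) auto
    then show ?thesis using False by (simp add: op_apply_def op_tensor_def hilb_def)
  next
    case True
    have M: "?M x y = (if y = x - ?g then add_char (dotp ?A ?h (x - ?g)) else 0)" if y: "y \<in> confs ?A" for y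
    proof -
      have eq: "y = x - ?g \<longleftrightarrow> (\<forall>s\<in>?Q. x s = y s + a $ idx s) \<and> (\<forall>s\<in>?B. x s = y s + a' $ idx s)"
        (is "_ \<longleftrightarrow> ?R")
      proof
        assume ?R
        show "y = x - ?g"
        proof (rule confs_eqI[OF y])
          show "x - ?g \<in> confs ?A" using True by (simp add: diff_mem_confs_iff)
          show "y s = (x - ?g) s" if "s \<in> ?A" for s
            using that \<open>?R\<close> by (cases s) auto
        qed
      qed (auto simp: Qreg_def Breg_def)
      have d: "(\<Prod>s\<in>?Q. add_char (b $ idx s * y s)) * (\<Prod>s\<in>?B. add_char (b' $ idx s * y s)) =
          add_char (dotp ?A ?h y)"
        unfolding dotp_conf_of_left add_char_add add_char_sum
        by (simp add: Qreg_def Breg_def prod.reindex inj_on_def)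
      have "?M x y = (if ?R then add_char (dotp ?A ?h y) else 0)"
        using True y by (auto simp: op_tensor_def op_mult_pauli simp flip: d)
      then show ?thesis using eq by auto
    qed
    have "x - ?g \<in> confs ?A" using True by (simp add: diff_mem_confs_iff)
    then have "op_apply ?A ?M \<psi> x = add_char (dotp ?A ?h (x - ?g)) * \<psi> (x - ?g)"
      by (simp add: op_apply_def M if_distrib[of "\<lambda>u. u * _"] cong: sum.cong if_cong)
    then show ?thesis by (simp add: weyl_def)
  qed
qed

section \<open>Completing an orthonormal family to a unitary\<close>

definition orthonormal_on :: "'b set \<Rightarrow> 'b set \<Rightarrow> ('b \<Rightarrow> 'b \<Rightarrow> complex) \<Rightarrow> bool" where
  "orthonormal_on X S V \<longleftrightarrow>
     (\<forall>s\<in>S. \<forall>t\<in>S. (\<Sum>x\<in>X. cnj (V s x) * V t x) = (if s = t then 1 else 0))"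

text \<open>The component of the basis vector at \<open>z\<close> orthogonal to all
  \<open>V s\<close>, that is, column \<open>z\<close> of the complementary projection when the
  family is orthonormal.\<close>

definition defect :: "'b set \<Rightarrow> ('b \<Rightarrow> 'b \<Rightarrow> complex) \<Rightarrow> 'b \<Rightarrow> 'b \<Rightarrow> complex" where
  "defect S V z x = (if x = z then 1 else 0) - (\<Sum>s\<in>S. V s x * cnj (V s z))"

lemma orthogonal_defect:
  assumes X: "finite X" and S: "S \<subseteq> X" and on: "orthonormal_on X S V" and s: "s \<in> S" and z: "z \<in> X"
  shows "(\<Sum>x\<in>X. cnj (V s x) * defect S V z x) = 0"
proof -
  have fin: "finite S" using X S finite_subset by blast
  have "(\<Sum>x\<in>X. cnj (V s x) * (\<Sum>t\<in>S. V t x * cnj (V t z))) =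
      (\<Sum>t\<in>S. (\<Sum>x\<in>X. cnj (V s x) * V t x) * cnj (V t z))"
    unfolding sum_distrib_left sum_distrib_right by (subst sum.swap) (simp add: mult_ac)
  also have "\<dots> = (\<Sum>t\<in>S. if s = t then cnj (V t z) else 0)"
    using on s unfolding orthonormal_on_def by (intro sum.cong refl) auto
  also have "\<dots> = cnj (V s z)" using fin s by simp
  finally have "(\<Sum>x\<in>X. cnj (V s x) * (\<Sum>t\<in>S. V t x * cnj (V t z))) = cnj (V s z)" .
  moreover have "(\<Sum>x\<in>X. cnj (V s x) * (if x = z then 1 else 0)) = cnj (V s z)"
    using X z by (simp add: if_distrib[of "\<lambda>u. _ * u"] cong: if_cong)
  ultimately show ?thesis by (simp add: defect_def right_diff_distrib sum_subtractf)
qed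

text \<open>The trace of the complementary projection.\<close>

lemma sum_defect:
  assumes X: "finite X" and S: "S \<subseteq> X" and on: "orthonormal_on X S V"
  shows "(\<Sum>z\<in>X. \<Sum>x\<in>X. (cmod (defect S V z x))\<^sup>2) = real (card X) - real (card S)"
proof -
  have "(\<Sum>x\<in>X. cnj (defect S V z x) * defect S V z x) = defect S V z z" if z: "z \<in> X" for z
  proof -
    have "(\<Sum>x\<in>X. cnj (defect S V z x) * defect S V z x) =
        (\<Sum>x\<in>X. (if x = z then defect S V z x else 0)) -
        (\<Sum>x\<in>X. (\<Sum>s\<in>S. cnj (V s x) * V s z) * defect S V z x)"
      unfolding sum_subtractf[symmetric]
      by (intro sum.cong refl) (simp add: defect_def[of S V z] left_diff_distrib)
    also have "(\<Sum>x\<in>X. (\<Sum>s\<in>S. cnj (V s x) * V s z) * defect S V z x) =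
        (\<Sum>s\<in>S. V s z * (\<Sum>x\<in>X. cnj (V s x) * defect S V z x))"
      unfolding sum_distrib_left sum_distrib_right by (subst sum.swap) (simp add: mult_ac)
    also have "\<dots> = 0" using orthogonal_defect[OF X S on _ z] by simp
    finally show ?thesis using X z by simp
  qed
  then have "(\<Sum>z\<in>X. \<Sum>x\<in>X. cnj (defect S V z x) * defect S V z x) = (\<Sum>z\<in>X. defect S V z z)" by simp
  also have "\<dots> = of_nat (card X) - (\<Sum>s\<in>S. \<Sum>z\<in>X. cnj (V s z) * V s z)"
    by (subst sum.swap) (simp add: defect_def sum_subtractf mult.commute)
  also have "\<dots> = of_nat (card X) - of_nat (card S)"
    using on by (simp add: orthonormal_on_def)
  finally have eq: "(\<Sum>z\<in>X. \<Sum>x\<in>X. cnj (defect S V z x) * defect S V z x) =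
      of_nat (card X) - of_nat (card S)" .
  have "complex_of_real (\<Sum>z\<in>X. \<Sum>x\<in>X. (cmod (defect S V z x))\<^sup>2) =
      (\<Sum>z\<in>X. \<Sum>x\<in>X. cnj (defect S V z x) * defect S V z x)"
    unfolding of_real_sum complex_norm_square by (intro sum.cong refl mult.commute)
  then have "complex_of_real (\<Sum>z\<in>X. \<Sum>x\<in>X. (cmod (defect S V z x))\<^sup>2) =
      complex_of_real (real (card X) - real (card S))"
    unfolding eq by simp
  then show ?thesis unfolding of_real_eq_iff .
qed

text \<open>While vectors are missing, the complementary projection has positive trace, so one of
  its columns is nonzero and can be normalised. Any free index \<open>w\<close> may receive
  it.\<close>

lemma orthonormal_on_extend_step:
  assumes X: "finite X" and S: "S \<subset> X" and on: "orthonormal_on X S V" and w: "w \<in> X - S"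
  shows "\<exists>v. orthonormal_on X (insert w S) (V(w := v))"
proof -
  have SX: "S \<subseteq> X" using S by auto
  have "card S < card X" using X S psubset_card_mono by blast
  then have "(\<Sum>z\<in>X. \<Sum>x\<in>X. (cmod (defect S V z x))\<^sup>2) \<noteq> 0"
    unfolding sum_defect[OF X SX on] by simp
  then obtain z where z: "z \<in> X" "(\<Sum>x\<in>X. (cmod (defect S V z x))\<^sup>2) \<noteq> 0"
    by (meson sum.neutral)
  let ?N = "\<Sum>x\<in>X. (cmod (defect S V z x))\<^sup>2"
  let ?r = "complex_of_real (sqrt ?N)"
  have N: "0 < ?N" using z(2) by (simp add: sum_nonneg less_le)
  then have r: "cnj ?r * ?r = complex_of_real ?N" "?r \<noteq> 0"
    by (simp_all flip: of_real_mult)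
  let ?v = "\<lambda>x. defect S V z x / ?r"
  have vv: "(\<Sum>x\<in>X. cnj (?v x) * ?v x) = 1"
  proof -
    have "(\<Sum>x\<in>X. cnj (?v x) * ?v x) = (\<Sum>x\<in>X. complex_of_real ((cmod (defect S V z x))\<^sup>2)) / (cnj ?r * ?r)"
      unfolding sum_divide_distrib complex_norm_square by (intro sum.cong refl) (simp add: mult_ac)
    also have "\<dots> = 1" unfolding r of_real_sum[symmetric]
      using z(2) by (intro divide_self) (simp only: of_real_eq_0_iff not_False_eq_True)
    finally show ?thesis .
  qed
  have sv: "(\<Sum>x\<in>X. cnj (V s x) * ?v x) = 0" if "s \<in> S" for s
    using orthogonal_defect[OF X SX on that z(1)] by (simp flip: sum_divide_distrib)
  have vs: "(\<Sum>x\<in>X. cnj (?v x) * V s x) = 0" if "s \<in> S" for s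
  proof -
    have "(\<Sum>x\<in>X. cnj (?v x) * V s x) = cnj (\<Sum>x\<in>X. cnj (V s x) * ?v x)"
      by (simp add: mult.commute)
    then show ?thesis unfolding sv[OF that] by simp
  qed
  have "orthonormal_on X (insert w S) (V(w := ?v))"
    unfolding orthonormal_on_def
  proof (intro ballI)
    fix s t assume st: "s \<in> insert w S" "t \<in> insert w S"
    have on': "(\<Sum>x\<in>X. cnj (V s x) * V t x) = (if s = t then 1 else 0)" if "s \<in> S" "t \<in> S"
      using on that unfolding orthonormal_on_def by blast
    consider "s = w" "t = w" | "s = w" "t \<in> S" "t \<noteq> w" | "s \<in> S" "s \<noteq> w" "t = w"
      | "s \<in> S" "t \<in> S" "s \<noteq> w" "t \<noteq> w" using st w by blast
    then show "(\<Sum>x\<in>X. cnj ((V(w := ?v)) s x) * (V(w := ?v)) t x) = (if s = t then 1 else 0)"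
    proof cases
      case 1
      then show ?thesis using vv by simp
    next
      case 2
      then show ?thesis using vs by simp
    next
      case 3
      then show ?thesis using sv by simp
    next
      case 4
      then show ?thesis using on' by simp
    qed
  qed
  then show ?thesis by blast
qed

lemma orthonormal_on_extend:
  assumes X: "finite X" and S: "S \<subseteq> X" and on: "orthonormal_on X S V"
  shows "\<exists>V'. orthonormal_on X X V' \<and> (\<forall>s\<in>S. V' s = V s)"
  using S on
proof (induction "card (X - S)" arbitrary: S V)
  case 0
  then have "S = X" using X by auto
  then show ?case using 0 by blast
next
  case (Suc m)
  then have "X - S \<noteq> {}" by auto
  then obtain w where w: "w \<in> X - S" by auto
  then obtain v where v: "orthonormal_on X (insert w S) (V(w := v))"
    using orthonormal_on_extend_step[OF X _ Suc.prems(2) w] Suc.prems(1) by blast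
  have "card (X - insert w S) = card (X - S) - 1"
    using w by (intro card_Diff_insert) auto
  then have "m = card (X - insert w S)" using Suc.hyps(2) by linarith
  then obtain V' where V': "orthonormal_on X X V'" "\<forall>s\<in>insert w S. V' s = (V(w := v)) s"
    using Suc.hyps(1)[OF _ _ v] Suc.prems(1) w by blast
  have "V' s = V s" if "s \<in> S" for s using V'(2) w that by auto
  then show ?case using V'(1) by blast
qed

text \<open>For a full family the complementary projection has trace 0, hence only zero entries.
  This turns orthonormal columns into orthonormal rows, the second half of unitarity.\<close>

lemma orthonormal_on_complete:
  assumes X: "finite X" and on: "orthonormal_on X X V" and "x \<in> X" "z \<in> X"
  shows "(\<Sum>s\<in>X. V s x * cnj (V s z)) = (if x = z then 1 else 0)"
proof -
  have "(\<Sum>z\<in>X. \<Sum>x\<in>X. (cmod (defect X V z x))\<^sup>2) = 0"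
    using sum_defect[OF X _ on] by simp
  then have "(cmod (defect X V z x))\<^sup>2 = 0"
    using assms by (simp add: sum_nonneg_eq_0_iff sum_nonneg)
  then show ?thesis by (simp add: defect_def split: if_splits)
qed

lemma exists_unitary_extension:
  fixes V :: "'a :: finite conf \<Rightarrow> 'a state"
  assumes R: "finite R" and S: "S \<subseteq> confs R" and on: "orthonormal_on (confs R) S V"
  obtains U where "unitary_on R U" "\<And>x w. x \<in> confs R \<Longrightarrow> w \<in> S \<Longrightarrow> U x w = V w x"
proof -
  let ?X = "confs R :: 'a conf set"
  have fin: "finite ?X" using R by simp
  obtain V' where on': "orthonormal_on ?X ?X V'" and V': "\<forall>s\<in>S. V' s = V s"
    using orthonormal_on_extend[OF fin S on] by blast
  let ?U = "\<lambda>x w. if x \<in> ?X \<and> w \<in> ?X then V' w x else 0"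
  have "unitary_on R ?U"
    unfolding unitary_on_def
  proof (intro conjI)
    show "?U \<in> opers R" by (auto simp: opers_def)
    show "op_mult R (op_adj ?U) ?U = op_one R"
    proof (intro ext)
      fix x y
      have "(\<Sum>z\<in>?X. cnj (V' x z) * V' y z) = (if x = y then 1 else 0)" if "x \<in> ?X" "y \<in> ?X"
        using on' that unfolding orthonormal_on_def by blast
      then show "op_mult R (op_adj ?U) ?U x y = op_one R x y"
        unfolding op_mult_def op_adj_def op_one_def
        by (cases "x \<in> ?X"; cases "y \<in> ?X"; cases "x = y") simp_all
    qed
    show "op_mult R ?U (op_adj ?U) = op_one R"
    proof (intro ext)
      fix x y
      show "op_mult R ?U (op_adj ?U) x y = op_one R x y"
        unfolding op_mult_def op_adj_def op_one_def
        using orthonormal_on_complete[OF fin on', of x y]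
        by (cases "x \<in> ?X"; cases "y \<in> ?X"; cases "x = y") simp_all
    qed
  qed
  moreover have "?U x w = V w x" if "x \<in> ?X" "w \<in> S" for x w using that S V' by auto
  ultimately show thesis by (rule that)
qed

section \<open>The EA-CSS code as a space of functions on cosets\<close>

context ea_css_matrices
begin

abbreviation reg :: "site set" where "reg \<equiv> Qreg {..<n} \<union> Breg c"

definition rowX :: "'a vec \<Rightarrow> 'a conf" where "rowX u = conf_of n c (HX\<^sup>T *\<^sub>v u) (FX\<^sup>T *\<^sub>v u)"
definition rowZ :: "'a vec \<Rightarrow> 'a conf" where "rowZ v = conf_of n c (HZ\<^sup>T *\<^sub>v v) (FZ\<^sup>T *\<^sub>v v)"

lemmas carriers [simp] = HX FX HZ FZ

lemma rows_carrier [simp]: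
  "u \<in> carrier_vec mX \<Longrightarrow> HX\<^sup>T *\<^sub>v u \<in> carrier_vec n" "u \<in> carrier_vec mX \<Longrightarrow> FX\<^sup>T *\<^sub>v u \<in> carrier_vec c"
  "v \<in> carrier_vec mZ \<Longrightarrow> HZ\<^sup>T *\<^sub>v v \<in> carrier_vec n" "v \<in> carrier_vec mZ \<Longrightarrow> FZ\<^sup>T *\<^sub>v v \<in> carrier_vec c"
  using HX FX HZ FZ by (simp_all add: mult_mat_vec_carrier[of "HX\<^sup>T" n mX] mult_mat_vec_carrier[of "FX\<^sup>T" c mX]
    mult_mat_vec_carrier[of "HZ\<^sup>T" n mZ] mult_mat_vec_carrier[of "FZ\<^sup>T" c mZ])

lemma rowX_supported [simp]: "rowX u \<in> supported reg" and rowZ_supported [simp]: "rowZ v \<in> supported reg"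
  by (simp_all add: rowX_def rowZ_def)

lemma rowX_add: "u \<in> carrier_vec mX \<Longrightarrow> u' \<in> carrier_vec mX \<Longrightarrow> rowX (u + u') = rowX u + rowX u'"
  using mult_add_distrib_mat_vec[of "HX\<^sup>T" n mX] mult_add_distrib_mat_vec[of "FX\<^sup>T" c mX]
  by (simp add: rowX_def conf_of_add)

lemma rowX_smult: "u \<in> carrier_vec mX \<Longrightarrow> rowX (t \<cdot>\<^sub>v u) = (\<lambda>s. t * rowX u s)"
  using mult_mat_vec[of "HX\<^sup>T" n mX] mult_mat_vec[of "FX\<^sup>T" c mX]
  by (simp add: rowX_def conf_of_smult)

lemma rowX_zero [simp]: "rowX (0\<^sub>v mX) = 0"
proof -
  have "HX\<^sup>T *\<^sub>v 0\<^sub>v mX = 0\<^sub>v n" "FX\<^sup>T *\<^sub>v 0\<^sub>v mX = 0\<^sub>v c"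
    using carrier_matD[OF HX] carrier_matD[OF FX] by (auto intro!: eq_vecI simp: scalar_prod_def)
  then show ?thesis by (simp add: rowX_def)
qed

lemma rowX_uminus: "u \<in> carrier_vec mX \<Longrightarrow> rowX (- u) = - rowX u"
proof -
  assume u: "u \<in> carrier_vec mX"
  have "- u = (- 1) \<cdot>\<^sub>v u" by auto
  then show ?thesis using rowX_smult[OF u, of "- 1"] by (auto simp: fun_eq_iff)
qed

lemma rowZ_eq_rowX_swap: "rowZ = ea_css_matrices.rowX n c HZ FZ"
  by (simp add: fun_eq_iff rowZ_def ea_css_matrices.rowX_def[OF ea_css_matrices_swap])

lemmas rowZ_add = ea_css_matrices.rowX_add[OF ea_css_matrices_swap, folded rowZ_eq_rowX_swap]
  and rowZ_smult = ea_css_matrices.rowX_smult[OF ea_css_matrices_swap, folded rowZ_eq_rowX_swap]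
  and rowZ_zero = ea_css_matrices.rowX_zero[OF ea_css_matrices_swap, folded rowZ_eq_rowX_swap]
  and rowZ_uminus = ea_css_matrices.rowX_uminus[OF ea_css_matrices_swap, folded rowZ_eq_rowX_swap]

lemma inj_on_rowX: "inj_on rowX (carrier_vec mX)"
proof (rule inj_onI)
  fix u u' assume u: "u \<in> carrier_vec mX" "u' \<in> carrier_vec mX" and eq: "rowX u = rowX u'"
  have "(HX\<^sup>T *\<^sub>v u) $ j = (HX\<^sup>T *\<^sub>v u') $ j" if "j < n" for j
    using fun_cong[OF eq, of "Tx j"] that by (simp add: rowX_def)
  then have "HX\<^sup>T *\<^sub>v u = HX\<^sup>T *\<^sub>v u'" using carrier_matD[OF HX] by (intro eq_vecI) auto
  then show "u = u'" using inj_HX u by (meson inj_onD)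
qed

lemmas inj_on_rowZ = ea_css_matrices.inj_on_rowX[OF ea_css_matrices_swap, folded rowZ_eq_rowX_swap]

lemma dotp_rowZ_rowX:
  assumes "u \<in> carrier_vec mX" "v \<in> carrier_vec mZ"
  shows "dotp reg (rowZ v) (rowX u) = 0"
  using ea_css_matrices.orth[OF ea_css_matrices_swap assms(2,1)] assms
  by (simp add: rowZ_def rowX_def dotp_conf_of)

definition stab_labels :: "'a weyl_label set" where
  "stab_labels = rowX ` carrier_vec mX \<times> rowZ ` carrier_vec mZ"

text \<open>Orthogonality of the rows passes to every subgroup; this covers both the whole
  stabilizer and the small groups used for locality.\<close>

lemma isotropic_group_subset:
  assumes "S \<subseteq> stab_labels" "0 \<in> S" "\<And>s. s \<in> S \<Longrightarrow> - s \<in> S" "\<And>s t. s \<in> S \<Longrightarrow> t \<in> S \<Longrightarrow> s + t \<in> S"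
  shows "isotropic_group reg S"
proof -
  have "finite stab_labels" by (simp add: stab_labels_def)
  then have fin: "finite S" using assms(1) finite_subset by blast
  have dot: "dotp reg (snd s) (fst t) = 0" if "s \<in> S" "t \<in> S" for s t
  proof -
    have "s \<in> stab_labels" "t \<in> stab_labels" using assms(1) that by auto
    then show ?thesis by (auto simp: stab_labels_def dotp_rowZ_rowX)
  qed
  show ?thesis unfolding isotropic_group_def
    by (intro conjI ballI) (rule fin assms dot; assumption?)+
qed

lemma isotropic_group_stab_labels: "isotropic_group reg stab_labels"
proof (rule isotropic_group_subset)
  have mem: "(rowX u, rowZ v) \<in> stab_labels" if "u \<in> carrier_vec mX" "v \<in> carrier_vec mZ" for u v
    using that unfolding stab_labels_def by (intro SigmaI imageI)
  show "0 \<in> stab_labels"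
    using mem[of "0\<^sub>v mX" "0\<^sub>v mZ"] by (simp add: rowZ_zero zero_prod_def)
  show "- s \<in> stab_labels" if s: "s \<in> stab_labels" for s
  proof -
    obtain u v where uv: "u \<in> carrier_vec mX" "v \<in> carrier_vec mZ" "s = (rowX u, rowZ v)"
      using s unfolding stab_labels_def by blast
    then have "- s = (rowX (- u), rowZ (- v))" by (simp add: rowX_uminus rowZ_uminus)
    then show ?thesis using uv mem[of "- u" "- v"] by simp
  qed
  show "s + t \<in> stab_labels" if st: "s \<in> stab_labels" "t \<in> stab_labels" for s t
  proof -
    obtain u v u' v' where uv: "u \<in> carrier_vec mX" "v \<in> carrier_vec mZ" "s = (rowX u, rowZ v)"
      "u' \<in> carrier_vec mX" "v' \<in> carrier_vec mZ" "t = (rowX u', rowZ v')"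
      using st unfolding stab_labels_def by blast
    then have "s + t = (rowX (u + u'), rowZ (v + v'))" by (simp add: rowX_add rowZ_add)
    then show ?thesis using uv mem[of "u + u'" "v + v'"] by simp
  qed
qed simp

abbreviation code :: "'a state set" where "code \<equiv> ea_css n c HX HZ FX FZ"

lemma code_eq_fixed: "code = {\<psi> \<in> hilb reg. \<forall>s\<in>stab_labels. weyl reg s \<psi> = \<psi>}"
proof -
  have "(\<forall>S\<in>ea_css_stabilizer n c HX HZ FX FZ. op_apply reg S \<psi> = \<psi>) \<longleftrightarrow>
      (\<forall>s\<in>stab_labels. weyl reg s \<psi> = \<psi>)" if "\<psi> \<in> hilb reg" for \<psi>
  proof -
    have "(\<forall>S\<in>ea_css_stabilizer n c HX HZ FX FZ. op_apply reg S \<psi> = \<psi>) \<longleftrightarrow>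
        (\<forall>u\<in>carrier_vec mX. \<forall>v\<in>carrier_vec mZ. op_apply reg (op_tensor (Qreg {..<n}) (Breg c)
          (op_mult (Qreg {..<n}) (pauli_X (Qreg {..<n}) (HX\<^sup>T *\<^sub>v u)) (pauli_Z (Qreg {..<n}) (HZ\<^sup>T *\<^sub>v v)))
          (op_mult (Breg c) (pauli_X (Breg c) (FX\<^sup>T *\<^sub>v u)) (pauli_Z (Breg c) (FZ\<^sup>T *\<^sub>v v)))) \<psi> = \<psi>)"
      unfolding ea_css_stabilizer_def carrier_matD(1)[OF HX] carrier_matD(1)[OF HZ] by blast
    also have "\<dots> \<longleftrightarrow> (\<forall>u\<in>carrier_vec mX. \<forall>v\<in>carrier_vec mZ. weyl reg (rowX u, rowZ v) \<psi> = \<psi>)"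
      unfolding op_apply_stabilizer_element[OF that] rowX_def rowZ_def ..
    finally have "(\<forall>S\<in>ea_css_stabilizer n c HX HZ FX FZ. op_apply reg S \<psi> = \<psi>) \<longleftrightarrow>
        (\<forall>u\<in>carrier_vec mX. \<forall>v\<in>carrier_vec mZ. weyl reg (rowX u, rowZ v) \<psi> = \<psi>)" .
    then show ?thesis by (auto simp: stab_labels_def)
  qed
  then show ?thesis unfolding ea_css_def by blast
qed

section \<open>Support and cosets\<close>

definition code_support :: "'a conf set" where
  "code_support = {x \<in> confs reg. \<forall>v\<in>carrier_vec mZ. dotp reg (rowZ v) x = 0}"

lemma code_support_confs: "x \<in> code_support \<Longrightarrow> x \<in> confs reg"
  by (simp add: code_support_def)

lemma finite_code_support [simp]: "finite code_support"
  by (rule finite_subset[of _ "confs reg"]) (auto simp: code_support_def)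

lemma code_support_diff_rowX_iff: "u \<in> carrier_vec mX \<Longrightarrow> x - rowX u \<in> code_support \<longleftrightarrow> x \<in> code_support"
  by (auto simp: code_support_def diff_mem_confs_iff dotp_diff_right dotp_rowZ_rowX)

lemma code_support_add_rowX: "u \<in> carrier_vec mX \<Longrightarrow> x \<in> code_support \<Longrightarrow> x + rowX u \<in> code_support"
  using code_support_diff_rowX_iff[of u "x + rowX u"] by simp

text \<open>The Z rows confine the support and the X rows give the invariance. A nonzero value
  \<open>\<psi> x\<close> forces every phase of a Z row at \<open>x\<close> to be 1, and running
  through the multiples of \<open>v\<close> upgrades this to orthogonality.\<close>

lemma mem_code_iff:
  "\<psi> \<in> code \<longleftrightarrow> (\<forall>x. x \<notin> code_support \<longrightarrow> \<psi> x = 0) \<and> (\<forall>u\<in>carrier_vec mX. \<forall>x\<in>code_support. \<psi> (x - rowX u) = \<psi> x)"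
proof
  assume "\<psi> \<in> code"
  then have h: "\<psi> \<in> hilb reg" and
    fixed: "\<And>u v. u \<in> carrier_vec mX \<Longrightarrow> v \<in> carrier_vec mZ \<Longrightarrow> weyl reg (rowX u, rowZ v) \<psi> = \<psi>"
    by (auto simp: code_eq_fixed stab_labels_def)
  have "x \<in> code_support" if nz: "\<psi> x \<noteq> 0" for x
  proof -
    have "dotp reg (rowZ v) x = 0" if v: "v \<in> carrier_vec mZ" for v
    proof (rule add_char_mult_eq_1_imp)
      fix t
      have "weyl reg (rowX (0\<^sub>v mX), rowZ (t \<cdot>\<^sub>v v)) \<psi> x = \<psi> x"
        using fixed[of "0\<^sub>v mX" "t \<cdot>\<^sub>v v"] v by simp
      then show "add_char (t * dotp reg (rowZ v) x) = 1"
        using nz by (simp add: weyl_def rowZ_smult[OF v] dotp_def sum_distrib_left mult_ac)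
    qed
    then show ?thesis using nz h by (auto simp: code_support_def hilb_def)
  qed
  moreover have "\<psi> (x - rowX u) = \<psi> x" if u: "u \<in> carrier_vec mX" for u x
  proof -
    have "weyl reg (rowX u, rowZ (0\<^sub>v mZ)) \<psi> x = \<psi> x" using fixed u by simp
    then show ?thesis by (simp add: weyl_def rowZ_zero)
  qed
  ultimately show "(\<forall>x. x \<notin> code_support \<longrightarrow> \<psi> x = 0) \<and> (\<forall>u\<in>carrier_vec mX. \<forall>x\<in>code_support. \<psi> (x - rowX u) = \<psi> x)"
    by blast
next
  assume r: "(\<forall>x. x \<notin> code_support \<longrightarrow> \<psi> x = 0) \<and> (\<forall>u\<in>carrier_vec mX. \<forall>x\<in>code_support. \<psi> (x - rowX u) = \<psi> x)"
  have "\<psi> \<in> hilb reg" using r by (auto simp: hilb_def code_support_def)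
  moreover have "weyl reg (rowX u, rowZ v) \<psi> x = \<psi> x" if uv: "u \<in> carrier_vec mX" "v \<in> carrier_vec mZ" for u v x
  proof (cases "x \<in> code_support")
    case True
    then have "x - rowX u \<in> code_support" using uv by (simp add: code_support_diff_rowX_iff)
    then have "dotp reg (rowZ v) (x - rowX u) = 0" using uv by (simp add: code_support_def)
    then show ?thesis using r True uv by (simp add: weyl_def)
  next
    case False
    then have "x - rowX u \<notin> code_support" using uv by (simp add: code_support_diff_rowX_iff)
    then show ?thesis using r False by (simp add: weyl_def)
  qed
  ultimately show "\<psi> \<in> code" by (auto simp: code_eq_fixed stab_labels_def)
qed

lemma sum_add_char_confs:
  assumes v: "v \<in> carrier_vec mZ"
  shows "(\<Sum>x\<in>confs reg. add_char (dotp reg (rowZ v) x)) =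
    (if v = 0\<^sub>v mZ then of_nat (CARD('a) ^ (n + c)) else 0)"
proof (cases "v = 0\<^sub>v mZ")
  case True
  have "card reg = n + c"
    by (simp add: card_Un_disjoint Qreg_Breg_disjoint card_Qreg card_Breg)
  then show ?thesis using True by (simp add: rowZ_zero card_confs)
next
  case False
  then have "rowZ v \<noteq> rowZ (0\<^sub>v mZ)" using inj_onD[OF inj_on_rowZ, of v "0\<^sub>v mZ"] v by auto
  then obtain s where s: "rowZ v s \<noteq> 0" by (auto simp: rowZ_zero fun_eq_iff)
  then have sr: "s \<in> reg" using rowZ_supported[of v] unfolding supported_def by blast
  obtain t where t: "add_char (t * rowZ v s) \<noteq> 1" using add_char_mult_eq_1_imp s by blast
  \<comment> \<open>Negated because configurations are shifted by subtraction.\<close>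
  let ?d = "(\<lambda>s'. if s' = s then - t else 0) :: 'a conf"
  have d: "?d \<in> supported reg" using sr by (auto simp: supported_def)
  have "dotp reg (rowZ v) ?d = - (rowZ v s * t)"
    using sr unfolding dotp_def by (subst sum.remove[of _ s]) (auto intro!: sum.neutral)
  then have dz: "add_char (dotp reg (rowZ v) (x - ?d)) = add_char (t * rowZ v s) * add_char (dotp reg (rowZ v) x)" for x
    by (simp add: dotp_diff_right mult.commute add_char_add)
  show ?thesis
    using False sum_eq_0_if_shift[OF bij_betw_shift_confs[OF d], of "\<lambda>x. add_char (dotp reg (rowZ v) x)", OF dz t]
    by simp
qed

text \<open>Double counting of the sum of the phases of all Z rows at all configurations: for fixed
  \<open>v\<close> the sum vanishes unless \<open>v\<close> is zero, for fixed \<open>x\<close>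
  unless \<open>x\<close> lies in the support.\<close>

lemma card_code_support: "CARD('a) ^ mZ * card code_support = CARD('a) ^ (n + c)"
proof -
  have lin: "(\<Sum>v\<in>carrier_vec mZ. add_char (dotp reg (rowZ v) x)) = (if x \<in> code_support then of_nat (CARD('a) ^ mZ) else 0)"
    if x: "x \<in> confs reg" for x
  proof (cases "x \<in> code_support")
    case True
    then show ?thesis by (simp add: code_support_def card_carrier_vec)
  next
    case False
    then obtain w where w: "w \<in> carrier_vec mZ" "dotp reg (rowZ w) x \<noteq> 0" using x by (auto simp: code_support_def)
    then obtain t where t: "add_char (t * dotp reg (rowZ w) x) \<noteq> 1" using add_char_mult_eq_1_imp by blast
    have bij: "bij_betw (\<lambda>u. u + t \<cdot>\<^sub>v w) (carrier_vec mZ) (carrier_vec mZ)"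
      by (rule bij_betw_byWitness[of _ "\<lambda>u. u - t \<cdot>\<^sub>v w"]) (use w in auto)
    have tw: "dotp reg (rowZ (t \<cdot>\<^sub>v w)) x = t * dotp reg (rowZ w) x"
      by (simp add: rowZ_smult[OF w(1)] dotp_def sum_distrib_left mult_ac)
    have "(\<Sum>v\<in>carrier_vec mZ. add_char (dotp reg (rowZ v) x)) = 0"
      by (rule sum_eq_0_if_shift[OF bij _ t])
        (use w in \<open>simp add: rowZ_add dotp_add_left add_char_add tw\<close>)
    with False show ?thesis by simp
  qed
  have "(\<Sum>v\<in>carrier_vec mZ. \<Sum>x\<in>confs reg. add_char (dotp reg (rowZ v) x)) =
      of_nat (CARD('a) ^ (n + c))"
    by (simp add: sum_add_char_confs cong: sum.cong)
  moreover have "(\<Sum>v\<in>carrier_vec mZ. \<Sum>x\<in>confs reg. add_char (dotp reg (rowZ v) x)) =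
      (\<Sum>x\<in>confs reg. if x \<in> code_support then of_nat (CARD('a) ^ mZ) else 0)"
    by (subst sum.swap) (simp add: lin cong: sum.cong)
  moreover have "\<dots> = (\<Sum>x\<in>confs reg \<inter> code_support. of_nat (CARD('a) ^ mZ))"
    by (rule sum.inter_restrict[symmetric]) simp
  moreover have "confs reg \<inter> code_support = code_support" by (auto simp: code_support_def)
  ultimately have "(of_nat (CARD('a) ^ mZ * card code_support) :: complex) = of_nat (CARD('a) ^ (n + c))"
    by (simp add: mult.commute)
  then show ?thesis unfolding of_nat_eq_iff .
qed

definition coset :: "'a conf \<Rightarrow> 'a conf set" where
  "coset x = (\<lambda>u. x + rowX u) ` carrier_vec mX"

lemma self_mem_coset: "x \<in> coset x"
  unfolding coset_def by (rule image_eqI[of _ _ "0\<^sub>v mX"]) auto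

lemma card_coset: "card (coset x) = CARD('a) ^ mX"
proof -
  have "inj_on (\<lambda>u. x + rowX u) (carrier_vec mX)" using inj_on_rowX by (auto simp: inj_on_def)
  then show ?thesis by (simp add: coset_def card_image card_carrier_vec)
qed

lemma coset_eq_if_mem: "y \<in> coset x \<Longrightarrow> coset y = coset x"
proof -
  have sub: "coset (x + rowX u) \<subseteq> coset x" if u: "u \<in> carrier_vec mX" for x u
  proof
    fix z assume "z \<in> coset (x + rowX u)"
    then obtain w where w: "w \<in> carrier_vec mX" "z = x + rowX u + rowX w" by (auto simp: coset_def)
    then have "z = x + rowX (u + w)" using u by (simp add: rowX_add add.assoc)
    then show "z \<in> coset x" unfolding coset_def using u w by (intro image_eqI[of _ _ "u + w"]) auto
  qed
  assume "y \<in> coset x"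
  then obtain u where u: "u \<in> carrier_vec mX" "y = x + rowX u" by (auto simp: coset_def)
  have "y + rowX (- u) = x" using u by (simp add: rowX_uminus)
  then have "coset x \<subseteq> coset y" using sub[of "- u" y] u(1) by (simp only: uminus_carrier_vec)
  then show ?thesis using sub[OF u(1), of x] u by blast
qed

lemma coset_subset_code_support: "x \<in> code_support \<Longrightarrow> coset x \<subseteq> code_support"
  by (auto simp: coset_def code_support_add_rowX)

lemma card_cosets: "CARD('a) ^ (mX + mZ) * card (coset ` code_support) = CARD('a) ^ (n + c)"
proof -
  have "CARD('a) ^ mX * card (coset ` code_support) = card (\<Union>(coset ` code_support))"
  proof (rule card_partition)
    show "finite (\<Union>(coset ` code_support))" using coset_subset_code_support by (intro finite_subset[OF _ finite_code_support]) auto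
    show "A \<inter> B = {}" if "A \<in> coset ` code_support" "B \<in> coset ` code_support" "A \<noteq> B" for A B
      using that coset_eq_if_mem by blast
  qed (auto simp: card_coset)
  also have "\<Union>(coset ` code_support) = code_support" using coset_subset_code_support self_mem_coset by blast
  finally have "CARD('a) ^ mX * card (coset ` code_support) = card code_support" .
  then have "CARD('a) ^ mZ * (CARD('a) ^ mX * card (coset ` code_support)) = CARD('a) ^ (n + c)"
    using card_code_support by presburger
  then show ?thesis by (simp only: power_add mult_ac)
qed

text \<open>By \<open>card_cosets\<close> there are q^\<kappa> cosets, as many as logical basis
  configurations. An arbitrary bijection serves, because the encoding unitary may be chosen
  freely.\<close>

lemma exists_logical_labelling:
  assumes "\<kappa> + mX + mZ = n + c"
  obtains lbl :: "'a conf \<Rightarrow> 'a conf" where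
    "\<And>x. x \<in> code_support \<Longrightarrow> lbl x \<in> confs (Qreg {..<\<kappa>})"
    "\<And>k. k \<in> confs (Qreg {..<\<kappa>}) \<Longrightarrow> \<exists>x\<in>code_support. lbl x = k"
    "\<And>x y. x \<in> code_support \<Longrightarrow> y \<in> code_support \<Longrightarrow> lbl x = lbl y \<longleftrightarrow> y \<in> coset x"
proof -
  have "CARD('a) ^ (mX + mZ) * card (coset ` code_support) = CARD('a) ^ (mX + mZ) * CARD('a) ^ \<kappa>"
    using card_cosets assms by (simp flip: power_add add: add_ac)
  then have "card (coset ` code_support) = card (confs (Qreg {..<\<kappa>}) :: 'a conf set)"
    by (simp add: card_confs card_Qreg)
  then obtain b where b: "bij_betw b (coset ` code_support) (confs (Qreg {..<\<kappa>}) :: 'a conf set)"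
    using finite_same_card_bij[of "coset ` code_support" "confs (Qreg {..<\<kappa>}) :: 'a conf set"] by auto
  show thesis
  proof (rule that[of "\<lambda>x. b (coset x)"])
    show "b (coset x) \<in> confs (Qreg {..<\<kappa>})" if "x \<in> code_support" for x
      using b that by (auto simp: bij_betw_def)
    have img: "(\<lambda>x. b (coset x)) ` code_support = confs (Qreg {..<\<kappa>})"
      using b by (simp add: bij_betw_def image_image)
    show "\<exists>x\<in>code_support. b (coset x) = k" if k: "k \<in> confs (Qreg {..<\<kappa>})" for k
    proof -
      have "k \<in> (\<lambda>x. b (coset x)) ` code_support" using k unfolding img .
      then show ?thesis by auto
    qed
    show "b (coset x) = b (coset y) \<longleftrightarrow> y \<in> coset x" if "x \<in> code_support" "y \<in> code_support" for x y
    proof -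
      have "b (coset x) = b (coset y) \<longleftrightarrow> coset x = coset y"
        using that by (intro inj_on_eq_iff[OF bij_betw_imp_inj_on[OF b]]) auto
      then show ?thesis using coset_eq_if_mem self_mem_coset by blast
    qed
  qed
qed

end

section \<open>The encoder\<close>

locale ea_css_encoding = ea_css_matrices n c mX mZ HX HZ FX FZ
  for n c mX mZ and HX HZ FX FZ :: "'a :: {finite, field} mat" +
  fixes \<kappa> :: nat and lbl :: "'a conf \<Rightarrow> 'a conf"
  assumes dims: "\<kappa> + mX + mZ = n + c"
    and lbl_confs: "\<And>x. x \<in> code_support \<Longrightarrow> lbl x \<in> confs (Qreg {..<\<kappa>})"
    and lbl_surj: "\<And>k. k \<in> confs (Qreg {..<\<kappa>}) \<Longrightarrow> \<exists>x\<in>code_support. lbl x = k"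
    and lbl_eq_iff: "\<And>x y. x \<in> code_support \<Longrightarrow> y \<in> code_support \<Longrightarrow> lbl x = lbl y \<longleftrightarrow> y \<in> coset x"
begin

text \<open>With a and b the two dimensions from \<open>code_dim_rows_inter_kernel\<close>, so that
  \<open>mX\<close> = a + c and \<open>mZ\<close> = b + c, the equation \<open>dims\<close> becomes
  \<kappa> + c = n - a - b.\<close>

lemma logical_plus_ebits_le: "\<kappa> + c \<le> n"
  using dims code_dim_rows_inter_kernel ea_css_matrices.code_dim_rows_inter_kernel[OF ea_css_matrices_swap]
  by linarith

text \<open>The configuration of the full register in which Bob holds the last \<open>c\<close> symbols of \<open>w\<close>.\<close>

definition merge :: "'a conf \<Rightarrow> 'a conf \<Rightarrow> 'a conf" where
  "merge y w = (\<lambda>s. case s of Tx j \<Rightarrow> y (Tx j) | Bob j \<Rightarrow> if j < c then w (Tx (n - c + j)) else undefined)"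

text \<open>The basis configurations that occur in encoder inputs: logical symbols, then zeros, then
  the \<open>c\<close> symbols shared with Bob.\<close>

definition padded :: "'a conf set" where
  "padded = {w \<in> confs (Qreg {..<n}). \<forall>j. \<kappa> \<le> j \<and> j < n - c \<longrightarrow> w (Tx j) = 0}"

text \<open>The number of points of a coset with prescribed Bob symbols, by
  \<open>card_merge_fibre\<close>.\<close>

definition kernel_size :: nat where "kernel_size = card (mat_kernel FX\<^sup>T)"

text \<open>Column \<open>w\<close> of the encoder, for padded \<open>w\<close>: a normalised slice
  of a coset at fixed Bob symbols. The logical symbols of \<open>w\<close> name the coset, its last
  \<open>c\<close> symbols are Bob's.\<close>

definition partial_unitary :: "'a conf \<Rightarrow> 'a state" where
  "partial_unitary w y = (if merge y w \<in> code_support \<and> lbl (merge y w) = restrict w (Qreg {..<\<kappa>})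
     then complex_of_real (1 / sqrt (real kernel_size)) else 0)"

lemma merge_confs [simp]: "y \<in> confs (Qreg {..<n}) \<Longrightarrow> merge y w \<in> confs reg"
proof (rule mem_confsI)
  fix s assume "y \<in> confs (Qreg {..<n})" "s \<notin> reg"
  then show "merge y w s = undefined" by (cases s) (auto simp: merge_def confs_outside)
qed

lemma kernel_size_power: "CARD('a) ^ c * kernel_size = CARD('a) ^ mX"
  by (simp add: kernel_size_def card_kernel_FX)

lemma kernel_size_pos: "0 < kernel_size"
  using kernel_size_power by (metis mult_0_right neq0_conv power_not_zero zero_less_card_finite)

text \<open>Bob's symbols are determined by the transmitted ones, as \<open>F\<^sub>Z\<close> is injective.\<close>

lemma merge_code_support_determines:
  assumes "merge y w \<in> code_support" "merge y w' \<in> code_support" "j < c"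
  shows "w (Tx (n - c + j)) = w' (Tx (n - c + j))"
proof -
  let ?d = "vec c (\<lambda>j. w (Tx (n - c + j)) - w' (Tx (n - c + j)))"
  have "(FZ\<^sup>T *\<^sub>v v) \<bullet> ?d = 0" if v: "v \<in> carrier_vec mZ" for v
  proof -
    have "(FZ\<^sup>T *\<^sub>v v) \<bullet> ?d = dotp reg (rowZ v) (merge y w) - dotp reg (rowZ v) (merge y w')"
      by (simp add: rowZ_def dotp_conf_of_left merge_def scalar_prod_def atLeast0LessThan
          right_diff_distrib sum_subtractf)
    then show ?thesis using assms v by (simp add: code_support_def)
  qed
  then have "u \<bullet> ?d = 0" if "u \<in> carrier_vec c" for u
    using that unfolding surj_FZ[symmetric] by auto
  then have "?d = 0\<^sub>v c" by (intro eq_zero_if_orthogonal_all) auto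
  then have "?d $ j = 0\<^sub>v c $ j" by simp
  then show ?thesis using assms(3) by simp
qed

lemma padded_eqI:
  assumes w: "w \<in> padded" "w' \<in> padded"
    and log: "\<And>j. j < \<kappa> \<Longrightarrow> w (Tx j) = w' (Tx j)"
    and ebits: "\<And>j. j < c \<Longrightarrow> w (Tx (n - c + j)) = w' (Tx (n - c + j))"
  shows "w = w'"
proof (rule confs_eqI)
  show "w \<in> confs (Qreg {..<n})" "w' \<in> confs (Qreg {..<n})" using w by (auto simp: padded_def)
  fix s assume "s \<in> Qreg {..<n}"
  then obtain j where s: "s = Tx j" "j < n" by (auto simp: Qreg_def)
  consider "j < \<kappa>" | "\<kappa> \<le> j" "j < n - c" | "n - c \<le> j" by linarith
  then show "w s = w' s"
  proof cases
    case 2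
    then show ?thesis using w s by (simp add: padded_def)
  next
    case 3
    then show ?thesis using ebits[of "j - (n - c)"] s by simp
  qed (simp add: log s)
qed

text \<open>Within the coset of \<open>z\<close>, prescribing Bob's symbols means u FX = t, a
  nonempty fibre because u \<mapsto> u FX is onto. Different \<open>u\<close> give different
  transmitted parts, as the rows of \<open>HX\<close> are independent.\<close>

lemma card_merge_fibre:
  assumes k: "k \<in> confs (Qreg {..<\<kappa>})"
  shows "card {y \<in> confs (Qreg {..<n}). merge y w \<in> code_support \<and> lbl (merge y w) = k} = kernel_size"
proof -
  let ?Q = "Qreg {..<n}"
  obtain z where z: "z \<in> code_support" "lbl z = k" using lbl_surj[OF k] by blast
  have zc: "z \<in> confs reg" using z by (simp add: code_support_def)
  define t where "t = vec c (\<lambda>j. w (Tx (n - c + j)) - z (Bob j))"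
  let ?Y = "{y \<in> confs ?Q. merge y w \<in> code_support \<and> lbl (merge y w) = k}"
  let ?U = "{u \<in> carrier_vec mX. FX\<^sup>T *\<^sub>v u = t}"
  let ?f = "\<lambda>u. restrict (z + rowX u) ?Q"
  have "?Y = ?f ` ?U"
  proof (intro equalityI subsetI)
    fix y assume "y \<in> ?Y"
    then have y: "y \<in> confs ?Q" "merge y w \<in> code_support" "lbl (merge y w) = k" by auto
    then have "merge y w \<in> coset z" using lbl_eq_iff[OF z(1) y(2)] z by simp
    then obtain u where u: "u \<in> carrier_vec mX" and eq: "merge y w = z + rowX u" by (auto simp: coset_def)
    have "FX\<^sup>T *\<^sub>v u = t"
    proof
      fix j assume "j < dim_vec t"
      then have j: "j < c" by (simp add: t_def)
      then show "(FX\<^sup>T *\<^sub>v u) $ j = t $ j"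
        using fun_cong[OF eq, of "Bob j"] by (simp add: merge_def t_def rowX_def algebra_simps del: index_mult_mat_vec)
    qed (use carrier_matD[OF FX] in \<open>simp add: t_def\<close>)
    moreover have "y = ?f u"
    proof (rule confs_eqI[OF y(1)])
      fix s assume "s \<in> ?Q"
      then show "y s = ?f u s" using fun_cong[OF eq, of s] by (cases s) (auto simp: merge_def)
    qed simp
    ultimately show "y \<in> ?f ` ?U" using u by blast
  next
    fix y assume "y \<in> ?f ` ?U"
    then obtain u where u: "u \<in> carrier_vec mX" "FX\<^sup>T *\<^sub>v u = t" "y = ?f u" by auto
    have yc: "y \<in> confs ?Q" using u by simp
    have zu: "z + rowX u \<in> code_support" using z u by (simp add: code_support_add_rowX)
    have "merge y w = z + rowX u"
    proof (rule confs_eqI)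
      show "merge y w \<in> confs reg" "z + rowX u \<in> confs reg" using yc zu by (simp_all add: code_support_confs)
      fix s assume "s \<in> reg"
      then show "merge y w s = (z + rowX u) s"
        by (cases s) (auto simp: merge_def u(3) rowX_def[of u] u(2) t_def simp del: index_mult_mat_vec)
    qed
    moreover have "z + rowX u \<in> coset z" using u by (auto simp: coset_def)
    then have "lbl (z + rowX u) = k" using lbl_eq_iff[OF z(1) zu] z by simp
    ultimately show "y \<in> ?Y" using yc zu by simp
  qed
  moreover have "inj_on ?f ?U"
  proof (rule inj_onI)
    fix u u' assume u: "u \<in> ?U" "u' \<in> ?U" and eq: "?f u = ?f u'"
    have "(HX\<^sup>T *\<^sub>v u) $ j = (HX\<^sup>T *\<^sub>v u') $ j" if "j < n" for j
      using fun_cong[OF eq, of "Tx j"] that by (simp add: rowX_def del: index_mult_mat_vec)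
    then have "HX\<^sup>T *\<^sub>v u = HX\<^sup>T *\<^sub>v u'"
      using carrier_matD[OF HX] by (intro eq_vecI) (simp_all del: index_mult_mat_vec)
    then show "u = u'" using inj_HX u by (auto dest: inj_onD)
  qed
  moreover have "card ?U = kernel_size"
    unfolding kernel_size_def
  proof (rule card_mat_fibre)
    show "FX\<^sup>T \<in> carrier_mat c mX" using FX by simp
    show "t \<in> (*\<^sub>v) FX\<^sup>T ` carrier_vec mX" unfolding surj_FX by (simp add: t_def)
  qed
  ultimately show ?thesis by (simp add: card_image)
qed

text \<open>Two columns that are nonzero at a common \<open>y\<close> agree in Bob's symbols, hence
  in the merged configuration and in its label, so they are the same column. Distinct columns thus
  have disjoint supports.\<close>

lemma orthonormal_partial_unitary: "orthonormal_on (confs (Qreg {..<n})) padded partial_unitary"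
  unfolding orthonormal_on_def
proof (intro ballI)
  fix w w' assume w: "w \<in> padded" "w' \<in> padded"
  let ?Q = "confs (Qreg {..<n}) :: 'a conf set" and ?P = "\<lambda>w y. merge y w \<in> code_support \<and> lbl (merge y w) = restrict w (Qreg {..<\<kappa>})"
  let ?K = "complex_of_real (1 / sqrt (real kernel_size))"
  show "(\<Sum>y\<in>?Q. cnj (partial_unitary w y) * partial_unitary w' y) = (if w = w' then 1 else 0)"
  proof (cases "w = w'")
    case True
    have "(\<Sum>y\<in>?Q. cnj (partial_unitary w y) * partial_unitary w' y) = (\<Sum>y\<in>?Q. if ?P w y then ?K * ?K else 0)"
      unfolding True by (intro sum.cong refl) (simp add: partial_unitary_def)
    also have "\<dots> = (\<Sum>y\<in>{y \<in> ?Q. ?P w y}. ?K * ?K)"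
      by (rule sum.inter_filter[symmetric]) simp
    also have "\<dots> = of_nat kernel_size * (?K * ?K)" by (simp add: card_merge_fibre)
    also have "?K * ?K = 1 / of_nat kernel_size"
      by (simp flip: of_real_mult add: real_sqrt_mult_self)
    finally show ?thesis using True kernel_size_pos by simp
  next
    case False
    have "cnj (partial_unitary w y) * partial_unitary w' y = 0" for y
    proof (rule ccontr)
      assume "\<not> ?thesis"
      then have P: "?P w y" "?P w' y" by (auto simp: partial_unitary_def split: if_splits)
      then have ebits: "w (Tx (n - c + j)) = w' (Tx (n - c + j))" if "j < c" for j
        using merge_code_support_determines that by blast
      then have "merge y w = merge y w'" by (auto simp: merge_def fun_eq_iff split: site.split)
      then have eq: "restrict w (Qreg {..<\<kappa>}) = restrict w' (Qreg {..<\<kappa>})" using P by simp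
      have "w (Tx j) = w' (Tx j)" if "j < \<kappa>" for j
        using fun_cong[OF eq, of "Tx j"] that by simp
      then have "w = w'" using padded_eqI[OF w] ebits by blast
      with False show False by simp
    qed
    then show ?thesis using False by simp
  qed
qed

text \<open>The amplitude of a normalised coset state, 1 / sqrt (q^mX) by
  \<open>scale_square\<close>, split into the prefactor of \<open>encode\<close> and the entry of
  \<open>partial_unitary\<close>.\<close>

definition scale :: real where
  "scale = real CARD('a) powr (- real c / 2) * (1 / sqrt (real kernel_size))"

lemma scale_pos: "0 < scale"
  using kernel_size_pos by (simp add: scale_def)

lemma scale_square: "real (CARD('a) ^ mX) * scale\<^sup>2 = 1"
proof -
  have "(real CARD('a) powr (- real c / 2))\<^sup>2 = real CARD('a) powr (- real c)"
    by (simp add: power2_eq_square flip: powr_add)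
  also have "\<dots> = 1 / real CARD('a) ^ c" by (simp add: powr_minus_divide powr_realpow)
  finally have "scale\<^sup>2 = 1 / (real CARD('a) ^ c * real kernel_size)"
    by (simp add: scale_def power_mult_distrib power_divide)
  moreover have "real (CARD('a) ^ mX) = real CARD('a) ^ c * real kernel_size"
    unfolding kernel_size_power[symmetric] by simp
  ultimately show ?thesis using kernel_size_pos by simp
qed

lemma enc_input_eq:
  assumes w: "w \<in> confs (Qreg {..<n})"
  shows "enc_input n \<kappa> c \<phi> x w =
    (if w \<in> padded \<and> (\<forall>j<c. w (Tx (n - c + j)) = x $ j) then \<phi> (restrict w (Qreg {..<\<kappa>})) else 0)"
proof -
  \<comment> \<open>Ensures that the truncated difference \<open>n - c\<close> cuts the register
    into three consecutive blocks.\<close>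
  have le: "\<kappa> + c \<le> n" by (rule logical_plus_ebits_le)
  let ?K = "Qreg {..<\<kappa>}" and ?M = "Qreg {\<kappa>..<n - c}" and ?E = "Qreg {n - c..<n}" and ?R = "Qreg {\<kappa>..<n}"
  have un: "?K \<union> ?R = Qreg {..<n}" "?M \<union> ?E = ?R" using le by (auto simp: set_eq_iff site_forall)
  have rr: "restrict (restrict w ?R) ?M = restrict w ?M" "restrict (restrict w ?R) ?E = restrict w ?E"
    using le by (auto simp: restrict_def fun_eq_iff site_forall)
  have M: "restrict w ?M = restrict (\<lambda>s. 0) ?M \<longleftrightarrow> w \<in> padded"
    using w by (auto simp: padded_def restrict_def fun_eq_iff site_forall)
  have E: "restrict w ?E = restrict (\<lambda>s. x $ (idx s - (n - c))) ?E \<longleftrightarrow> (\<forall>j<c. w (Tx (n - c + j)) = x $ j)"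
  proof
    assume eq: "restrict w ?E = restrict (\<lambda>s. x $ (idx s - (n - c))) ?E"
    show "\<forall>j<c. w (Tx (n - c + j)) = x $ j"
    proof (intro allI impI)
      fix j assume j: "j < c"
      define i where "i = n - c + j"
      have "n - c \<le> i" "i < n" "i - (n - c) = j" using j le by (simp_all add: i_def)
      then show "w (Tx (n - c + j)) = x $ j"
        using fun_cong[OF eq, of "Tx i"] unfolding i_def[symmetric] by simp
    qed
  next
    assume r: "\<forall>j<c. w (Tx (n - c + j)) = x $ j"
    show "restrict w ?E = restrict (\<lambda>s. x $ (idx s - (n - c))) ?E"
    proof (rule restrict_ext)
      fix s assume "s \<in> ?E"
      then obtain j where j: "s = Tx j" "n - c \<le> j" "j < n" by (auto simp: Qreg_def)
      then show "w s = x $ (idx s - (n - c))" using r[rule_format, of "j - (n - c)"] by simp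
    qed
  qed
  show ?thesis
    using w by (auto simp add: enc_input_def st_tensor_def un rr ket_def M E simp del: restrict_restrict)
qed

text \<open>At a given \<open>z\<close> one term survives in each sum: Bob's symbols select the ebit
  value \<open>x0\<close>, the label of \<open>z\<close> selects the input \<open>w0\<close>.
  Logical basis states therefore become normalised indicators of cosets.\<close>

lemma encode_eq:
  assumes U: "\<And>y w. y \<in> confs (Qreg {..<n}) \<Longrightarrow> w \<in> padded \<Longrightarrow> U y w = partial_unitary w y"
  shows "encode n \<kappa> c U \<phi> z = (if z \<in> code_support then complex_of_real scale * \<phi> (lbl z) else 0)"
proof (cases "z \<in> confs reg")
  case False
  then show ?thesis by (auto simp: encode_def st_tensor_def code_support_def)
next
  case True
  let ?Q = "Qreg {..<n}" and ?B = "Breg c" and ?K = "Qreg {..<\<kappa>}"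
  have le: "\<kappa> + c \<le> n" by (rule logical_plus_ebits_le)
  define x0 where "x0 = vec c (\<lambda>j. z (Bob j))"
  let ?y = "restrict z ?Q"
  have yc: "?y \<in> confs ?Q" by simp
  have ketB: "ket ?B (\<lambda>s. x $ idx s) (restrict z ?B) = (if x = x0 then 1 else 0)"
    if x: "x \<in> carrier_vec c" for x
  proof -
    have "restrict z ?B = restrict (\<lambda>s. x $ idx s) ?B \<longleftrightarrow> x = x0"
    proof
      assume eq: "restrict z ?B = restrict (\<lambda>s. x $ idx s) ?B"
      show "x = x0"
      proof
        fix j assume "j < dim_vec x0"
        then have "j < c" by (simp add: x0_def)
        then show "x $ j = x0 $ j" using fun_cong[OF eq, of "Bob j"] by (simp add: x0_def)
      qed (use x in \<open>simp add: x0_def\<close>)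
    qed (auto simp: x0_def Breg_def intro!: restrict_ext)
    then show ?thesis by (simp add: ket_def)
  qed
  let ?p = "\<lambda>w. w \<in> padded \<and> (\<forall>j<c. w (Tx (n - c + j)) = z (Bob j))"
  have x0: "(\<forall>j<c. w (Tx (n - c + j)) = x0 $ j) \<longleftrightarrow> (\<forall>j<c. w (Tx (n - c + j)) = z (Bob j))" for w :: "'a conf"
    by (simp add: x0_def)
  \<comment> \<open>The only input that can reach \<open>z\<close>: its label, zeros on the
    ancillas, and a copy of Bob's symbols.\<close>
  define w0 where "w0 = (\<lambda>s. case s of Bob j \<Rightarrow> undefined | Tx j \<Rightarrow> if j < \<kappa> then lbl z (Tx j)
    else if j < n - c then 0 else if j < n then z (Bob (j - (n - c))) else undefined)"
  have w0c: "w0 \<in> confs ?Q"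
  proof (rule mem_confsI)
    fix s assume "s \<notin> ?Q"
    then show "w0 s = undefined" using le by (cases s) (auto simp: w0_def)
  qed
  have pw0: "?p w0" using w0c le by (auto simp: padded_def w0_def)
  have summand: "U ?y w * enc_input n \<kappa> c \<phi> x0 w =
      (if w = w0 then if z \<in> code_support then complex_of_real (1 / sqrt (real kernel_size)) * \<phi> (lbl z) else 0 else 0)"
    if w: "w \<in> confs ?Q" for w
  proof (cases "?p w")
    case False
    then have "w \<noteq> w0" using pw0 by blast
    moreover have "enc_input n \<kappa> c \<phi> x0 w = 0" unfolding enc_input_eq[OF w] x0 if_not_P[OF False] ..
    ultimately show ?thesis by simp
  next
    case p: True
    have m: "merge ?y w = z"
    proof (rule confs_eqI[OF _ True])
      fix s assume "s \<in> reg"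
      then show "merge ?y w s = z s" using p by (cases s) (auto simp: merge_def)
    qed simp
    have eq: "lbl z = restrict w ?K \<longleftrightarrow> w = w0" if z: "z \<in> code_support"
    proof
      assume l: "lbl z = restrict w ?K"
      show "w = w0"
      proof (rule padded_eqI)
        show "w (Tx j) = w0 (Tx j)" if "j < \<kappa>" for j using that l by (simp add: w0_def)
        show "w (Tx (n - c + j)) = w0 (Tx (n - c + j))" if "j < c" for j using that p pw0 by simp
      qed (use p pw0 in auto)
    next
      assume "w = w0"
      show "lbl z = restrict w ?K"
      proof (rule confs_eqI)
        show "lbl z s = restrict w ?K s" if "s \<in> ?K" for s
          using that \<open>w = w0\<close> by (cases s) (auto simp: w0_def)
      qed (simp_all add: lbl_confs[OF z])
    qed
    have "U ?y w = (if z \<in> code_support \<and> w = w0 then complex_of_real (1 / sqrt (real kernel_size)) else 0)"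
      using p eq by (auto simp: U[OF yc] partial_unitary_def m)
    moreover have "enc_input n \<kappa> c \<phi> x0 w = \<phi> (restrict w ?K)" unfolding enc_input_eq[OF w] x0 if_P[OF p] ..
    ultimately show ?thesis using eq by auto
  qed
  have "(\<Sum>x\<in>carrier_vec c. st_tensor ?Q ?B (op_apply ?Q U (enc_input n \<kappa> c \<phi> x)) (ket ?B (\<lambda>s. x $ idx s)) z) =
      (\<Sum>x\<in>carrier_vec c. if x = x0 then op_apply ?Q U (enc_input n \<kappa> c \<phi> x0) ?y else 0)"
    using True by (intro sum.cong refl) (simp add: st_tensor_def ketB)
  also have "\<dots> = op_apply ?Q U (enc_input n \<kappa> c \<phi> x0) ?y"
    by (simp add: x0_def)
  also have "\<dots> = (\<Sum>w\<in>confs ?Q. if w = w0 then if z \<in> code_support then complex_of_real (1 / sqrt (real kernel_size)) * \<phi> (lbl z) else 0 else 0)"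
    unfolding op_apply_def using summand by (intro sum.cong refl) simp
  also have "\<dots> = (if z \<in> code_support then complex_of_real (1 / sqrt (real kernel_size)) * \<phi> (lbl z) else 0)"
    using w0c by simp
  finally show ?thesis by (simp add: encode_def scale_def)
qed

section \<open>The encoder is an isometry onto the code\<close>

lemma card_lbl_fibre:
  assumes "k \<in> confs (Qreg {..<\<kappa>})"
  shows "card {z \<in> code_support. lbl z = k} = CARD('a) ^ mX"
proof -
  obtain z0 where z0: "z0 \<in> code_support" "lbl z0 = k" using lbl_surj[OF assms] by blast
  have "lbl z = k \<longleftrightarrow> z \<in> coset z0" if "z \<in> code_support" for z
    using lbl_eq_iff[OF z0(1) that] z0(2) by metis
  then have "{z \<in> code_support. lbl z = k} = coset z0"
    using coset_subset_code_support[OF z0(1)] by blast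
  then show ?thesis by (simp add: card_coset)
qed

lemma st_norm_encode:
  assumes U: "\<And>y w. y \<in> confs (Qreg {..<n}) \<Longrightarrow> w \<in> padded \<Longrightarrow> U y w = partial_unitary w y"
  shows "st_norm reg (encode n \<kappa> c U \<phi>) = st_norm (Qreg {..<\<kappa>}) \<phi>"
proof -
  let ?K = "confs (Qreg {..<\<kappa>}) :: 'a conf set"
  have "(\<Sum>z\<in>confs reg. (cmod (encode n \<kappa> c U \<phi> z))\<^sup>2) = (\<Sum>z\<in>code_support. (cmod (encode n \<kappa> c U \<phi> z))\<^sup>2)"
    by (rule sum.mono_neutral_right) (auto simp: code_support_confs encode_eq[OF U])
  also have "\<dots> = (\<Sum>z\<in>code_support. scale\<^sup>2 * (cmod (\<phi> (lbl z)))\<^sup>2)"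
    using scale_pos by (intro sum.cong refl) (simp add: encode_eq[OF U] norm_mult power_mult_distrib)
  also have "\<dots> = (\<Sum>k\<in>?K. \<Sum>z\<in>{z \<in> code_support. lbl z = k}. scale\<^sup>2 * (cmod (\<phi> (lbl z)))\<^sup>2)"
    by (rule sum.group[symmetric]) (auto simp: lbl_confs)
  also have "\<dots> = (\<Sum>k\<in>?K. (real (CARD('a) ^ mX) * scale\<^sup>2) * (cmod (\<phi> k))\<^sup>2)"
    by (intro sum.cong refl) (simp add: card_lbl_fibre)
  also have "\<dots> = (\<Sum>k\<in>?K. (cmod (\<phi> k))\<^sup>2)" unfolding scale_square by simp
  finally show ?thesis by (simp add: st_norm_def)
qed

lemma image_encode:
  assumes U: "\<And>y w. y \<in> confs (Qreg {..<n}) \<Longrightarrow> w \<in> padded \<Longrightarrow> U y w = partial_unitary w y"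
  shows "encode n \<kappa> c U ` hilb (Qreg {..<\<kappa>}) = code"
proof (intro equalityI subsetI)
  fix \<psi> assume "\<psi> \<in> encode n \<kappa> c U ` hilb (Qreg {..<\<kappa>})"
  then obtain \<phi> where \<psi>: "\<psi> = encode n \<kappa> c U \<phi>" by auto
  have "lbl (x - rowX u) = lbl x" if "u \<in> carrier_vec mX" "x \<in> code_support" for u x
  proof -
    have x: "x - rowX u \<in> code_support" using that by (simp add: code_support_diff_rowX_iff)
    have "x \<in> coset (x - rowX u)" unfolding coset_def using that by (intro image_eqI[of _ _ u]) auto
    then show ?thesis using lbl_eq_iff[OF x that(2)] by simp
  qed
  then show "\<psi> \<in> code" unfolding mem_code_iff \<psi> by (simp add: encode_eq[OF U] code_support_diff_rowX_iff)
next
  fix \<psi> assume \<psi>: "\<psi> \<in> code"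
  let ?rep = "\<lambda>k. SOME z. z \<in> code_support \<and> lbl z = k"
  have rep: "?rep k \<in> code_support \<and> lbl (?rep k) = k" if "k \<in> confs (Qreg {..<\<kappa>})" for k
    using someI_ex[of "\<lambda>z. z \<in> code_support \<and> lbl z = k"] lbl_surj[OF that] by blast
  \<comment> \<open>Code states are constant on cosets, so one representative per label determines
    the logical state; dividing by \<open>scale\<close> undoes the amplitude in
    \<open>encode_eq\<close>.\<close>
  define \<phi> where "\<phi> k = (if k \<in> confs (Qreg {..<\<kappa>}) then \<psi> (?rep k) / complex_of_real scale else 0)" for k
  have "\<phi> \<in> hilb (Qreg {..<\<kappa>})" by (simp add: hilb_def \<phi>_def)
  moreover have "encode n \<kappa> c U \<phi> = \<psi>"
  proof
    fix z
    show "encode n \<kappa> c U \<phi> z = \<psi> z"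
    proof (cases "z \<in> code_support")
      case False
      then show ?thesis using \<psi> by (simp add: encode_eq[OF U] mem_code_iff)
    next
      case True
      let ?z = "?rep (lbl z)"
      have r: "?z \<in> code_support" "lbl ?z = lbl z" using rep[OF lbl_confs[OF True]] by auto
      then have "?z \<in> coset z" using lbl_eq_iff[OF True r(1)] by simp
      then obtain u where u: "u \<in> carrier_vec mX" "?z = z + rowX u" by (auto simp: coset_def)
      have "\<psi> (?z - rowX u) = \<psi> ?z" using \<psi> u(1) r(1) unfolding mem_code_iff by blast
      then have "\<psi> z = \<psi> ?z" unfolding u(2) by simp
      then show ?thesis using True scale_pos by (simp add: encode_eq[OF U] \<phi>_def lbl_confs)
    qed
  qed
  ultimately show "\<psi> \<in> encode n \<kappa> c U ` hilb (Qreg {..<\<kappa>})" by blast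
qed

lemma exists_encoding_unitary:
  obtains U where "unitary_on (Qreg {..<n}) U"
    "\<And>\<phi>. st_norm reg (encode n \<kappa> c U \<phi>) = st_norm (Qreg {..<\<kappa>}) \<phi>"
    "code = encode n \<kappa> c U ` hilb (Qreg {..<\<kappa>})"
proof -
  have "padded \<subseteq> confs (Qreg {..<n})" by (auto simp: padded_def)
  then obtain U where "unitary_on (Qreg {..<n}) U"
    and U: "\<And>y w. y \<in> confs (Qreg {..<n}) \<Longrightarrow> w \<in> padded \<Longrightarrow> U y w = partial_unitary w y"
    using exists_unitary_extension[OF _ _ orthonormal_partial_unitary] by auto
  then show thesis using that st_norm_encode[OF U] image_encode[OF U] by auto
qed

end

section \<open>Distance and locality\<close>

lemma wt_le:
  assumes "finite S" "v \<in> S" "supp v \<noteq> {}"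
  shows "wt S \<le> card (supp v)"
proof -
  have "{card (supp v) | v. v \<in> S \<and> supp v \<noteq> {}} \<subseteq> (\<lambda>v. card (supp v)) ` S" by blast
  then have "finite {card (supp v) | v. v \<in> S \<and> supp v \<noteq> {}}"
    using assms(1) finite_subset by blast
  then show ?thesis unfolding wt_def using assms by (intro Min_le) auto
qed

lemma finite_supp [simp]: "finite (supp v)"
  by (simp add: supp_def)

lemma mem_dual_iff: "x \<in> dual n C \<longleftrightarrow> x \<in> carrier_vec n \<and> (\<forall>y\<in>C. x \<bullet> y = 0)"
  for x :: "'a :: field vec"
proof -
  interpret vec_space "TYPE('a)" n .
  show ?thesis by (simp add: orthogonal_complement_def)
qed

lemma dotp_commute: "dotp A b x = dotp A x b"
  by (simp add: dotp_def mult.commute)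

text \<open>With it, the case of empty \<open>E\<close> in \<open>erasure_recovery\<close> becomes
  plain correction by a channel on the whole register.\<close>

lemma chan_ext_empty:
  assumes "linear_on_opers A \<Phi>" and "\<rho> \<in> opers A"
  shows "chan_ext A {} \<Phi> \<rho> = \<Phi> \<rho>"
proof (intro ext)
  fix x y
  have out: "\<Phi> \<rho> \<in> opers A" using assms by (simp add: linear_on_opers_def)
  show "chan_ext A {} \<Phi> \<rho> x y = \<Phi> \<rho> x y"
  proof (cases "x \<in> confs A \<and> y \<in> confs A")
    case False
    then show ?thesis using out by (auto simp: chan_ext_def opers_def)
  next
    case True
    have ov: "override_on z a A = a" if "z \<in> confs A" "a \<in> confs A" for z a :: "'a conf"
      using that by (auto simp: override_on_def fun_eq_iff confs_outside)
    have "(\<lambda>a b. if a \<in> confs A \<and> b \<in> confs A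
        then \<rho> (override_on x a A) (override_on y b A) else 0) = \<rho>"
      using True assms(2) by (auto simp: ov opers_def fun_eq_iff)
    moreover have "restrict x A = x" "restrict y A = y"
      using True by (auto simp: confs_def PiE_restrict)
    ultimately show ?thesis using True by (simp add: chan_ext_def)
  qed
qed

lemma erase_in_opers: "T \<subseteq> A \<Longrightarrow> erase A T \<rho> \<in> opers A"
proof -
  assume "T \<subseteq> A"
  then have "T \<union> (A - T) = A" by auto
  then show ?thesis unfolding erase_def op_tensor_def opers_def by auto
qed

context ea_css_matrices
begin

text \<open>q^(mX + mZ) divides q^(n + c), the quotient being the number of cosets; so the number of
  logical qudits is not negative.\<close>

lemma checks_le: "mX + mZ \<le> n + c"
proof -
  have q: "1 < CARD('a)" using card_mono[of UNIV "{0, 1 :: 'a}"] by simp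
  have "CARD('a) ^ (mX + mZ) dvd CARD('a) ^ (n + c)" unfolding card_cosets[symmetric] by simp
  then show ?thesis using q by (simp add: power_dvd_imp_le)
qed

section \<open>Errors that the stabilizer does not detect\<close>

lemma supported_Qreg_eq_conf_of:
  assumes "T \<subseteq> {..<n}" "f \<in> supported (Qreg T)"
  shows "f = conf_of n c (vec n (\<lambda>j. f (Tx j))) (0\<^sub>v c)"
  using assms by (auto simp: fun_eq_iff site_forall supported_def)

text \<open>The commutation phase with the Z row of \<open>v\<close> is the character of the product
  of \<open>v\<close> with the syndrome of \<open>a\<close>; using all multiples of \<open>v\<close>
  makes the product itself zero.\<close>

lemma commuting_X_kernel:
  assumes a: "a \<in> carrier_vec n"
    and com: "\<And>v. v \<in> carrier_vec mZ \<Longrightarrow> add_char (dotp reg (rowZ v) (conf_of n c a (0\<^sub>v c))) = 1"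
  shows "a \<in> mat_kernel HZ"
proof (rule mat_kernelI[OF HZ a])
  show "HZ *\<^sub>v a = 0\<^sub>v mZ"
  proof (rule eq_zero_if_orthogonal_all)
    show "HZ *\<^sub>v a \<in> carrier_vec mZ" by (rule mult_mat_vec_carrier[OF HZ a])
    fix v :: "'a vec" assume v: "v \<in> carrier_vec mZ"
    have eq: "dotp reg (rowZ v) (conf_of n c a (0\<^sub>v c)) = v \<bullet> (HZ *\<^sub>v a)"
      using a v transpose_vec_mult_scalar[OF HZ a v] by (simp add: rowZ_def dotp_conf_of)
    show "v \<bullet> (HZ *\<^sub>v a) = 0"
    proof (rule add_char_mult_eq_1_imp)
      fix t
      have "dotp reg (rowZ (t \<cdot>\<^sub>v v)) (conf_of n c a (0\<^sub>v c)) = t * (v \<bullet> (HZ *\<^sub>v a))"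
        unfolding eq[symmetric] by (simp add: rowZ_smult[OF v] dotp_def sum_distrib_left mult.assoc)
      then show "add_char (t * (v \<bullet> (HZ *\<^sub>v a))) = 1" using com[of "t \<cdot>\<^sub>v v"] v by simp
    qed
  qed
qed

text \<open>A row with zero syndrome has zero Bob part, so the error, which lives on the transmitted
  qudits only, is itself an X stabilizer.\<close>

lemma kernel_row_is_label:
  assumes "a \<in> mat_kernel HZ" "a \<in> (*\<^sub>v) HX\<^sup>T ` carrier_vec mX"
  obtains u where "u \<in> carrier_vec mX" "conf_of n c a (0\<^sub>v c) = rowX u"
proof -
  obtain u where u: "u \<in> carrier_vec mX" "a = HX\<^sup>T *\<^sub>v u" using assms(2) by blast
  then have "FX\<^sup>T *\<^sub>v u = 0\<^sub>v c"
    using syndrome_row_eq_0_iff[OF u(1)] mat_kernelD(2)[OF HZ assms(1)] by simp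
  then show thesis using that[OF u(1)] u(2) by (simp add: rowX_def)
qed

lemmas commuting_Z_kernel =
    ea_css_matrices.commuting_X_kernel[OF ea_css_matrices_swap,
      unfolded ea_css_matrices.rowZ_eq_rowX_swap[OF ea_css_matrices_swap]]
  and kernel_row_is_label_Z =
    ea_css_matrices.kernel_row_is_label[OF ea_css_matrices_swap, folded rowZ_eq_rowX_swap]

text \<open>Commutation puts the X part into the kernel of \<open>HZ\<close> and the Z part into
  that of \<open>HX\<close>. \<open>rowsX\<close> and \<open>rowsZ\<close>, to be supplied by the
  weight bound, then make both parts rows, and rows in these kernels are stabilizer labels.\<close>

lemma undetected_error_trivial:
  assumes \<psi>: "\<psi> \<in> code" and T: "T \<subseteq> {..<n}"
    and e: "e \<in> supported (Qreg T) \<times> supported (Qreg T)"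
    and com: "\<And>s. s \<in> stab_labels \<Longrightarrow> add_char (symp_form reg s e) = 1"
    and rowsX: "\<And>a. a \<in> mat_kernel HZ \<Longrightarrow> supp a \<subseteq> T \<Longrightarrow> a \<in> (*\<^sub>v) HX\<^sup>T ` carrier_vec mX"
    and rowsZ: "\<And>b. b \<in> mat_kernel HX \<Longrightarrow> supp b \<subseteq> T \<Longrightarrow> b \<in> (*\<^sub>v) HZ\<^sup>T ` carrier_vec mZ"
  shows "weyl reg e \<psi> = \<psi>"
proof -
  define a b where "a = vec n (\<lambda>j. fst e (Tx j))" and "b = vec n (\<lambda>j. snd e (Tx j))"
  have ab: "a \<in> carrier_vec n" "b \<in> carrier_vec n" by (simp_all add: a_def b_def)
  have ea: "fst e = conf_of n c a (0\<^sub>v c)" and eb: "snd e = conf_of n c b (0\<^sub>v c)"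
    unfolding a_def b_def using e by (auto intro!: supported_Qreg_eq_conf_of[OF T])
  have supp: "supp a \<subseteq> T" "supp b \<subseteq> T"
    using e by (auto simp: supp_def a_def b_def supported_def site_forall)
  have ka: "a \<in> mat_kernel HZ"
  proof (rule commuting_X_kernel[OF ab(1)])
    fix v :: "'a vec" assume "v \<in> carrier_vec mZ"
    then have "(rowX (0\<^sub>v mX), rowZ v) \<in> stab_labels" unfolding stab_labels_def by (intro SigmaI imageI) auto
    then show "add_char (dotp reg (rowZ v) (conf_of n c a (0\<^sub>v c))) = 1"
      using com[of "(rowX (0\<^sub>v mX), rowZ v)"] by (simp add: symp_form_def ea)
  qed
  have kb: "b \<in> mat_kernel HX"
  proof (rule commuting_Z_kernel[OF ab(2)])
    fix u :: "'a vec" assume "u \<in> carrier_vec mX"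
    then have "(rowX u, rowZ (0\<^sub>v mZ)) \<in> stab_labels" unfolding stab_labels_def by (intro SigmaI imageI) auto
    then have "add_char (- dotp reg (snd e) (rowX u)) = 1"
      using com[of "(rowX u, rowZ (0\<^sub>v mZ))"] by (simp add: symp_form_def rowZ_zero)
    then show "add_char (dotp reg (rowX u) (conf_of n c b (0\<^sub>v c))) = 1"
      by (simp add: add_char_minus eb dotp_commute)
  qed
  obtain u where u: "u \<in> carrier_vec mX" "fst e = rowX u"
    using kernel_row_is_label[OF ka rowsX[OF ka supp(1)]] ea by metis
  obtain v where v: "v \<in> carrier_vec mZ" "snd e = rowZ v"
    using kernel_row_is_label_Z[OF kb rowsZ[OF kb supp(2)]] eb by metis
  have "e \<in> stab_labels" using u v by (metis SigmaI imageI prod.collapse stab_labels_def)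
  then show ?thesis using \<psi> by (simp add: code_eq_fixed)
qed

lemma corrects_erasure_code:
  assumes T: "T \<subseteq> {..<n}"
    and rowsX: "\<And>a. a \<in> mat_kernel HZ \<Longrightarrow> supp a \<subseteq> T \<Longrightarrow> a \<in> (*\<^sub>v) HX\<^sup>T ` carrier_vec mX"
    and rowsZ: "\<And>b. b \<in> mat_kernel HX \<Longrightarrow> supp b \<subseteq> T \<Longrightarrow> b \<in> (*\<^sub>v) HZ\<^sup>T ` carrier_vec mZ"
  shows "corrects_erasure n c code T"
proof -
  have TA: "Qreg T \<subseteq> reg" using T by (auto simp: Qreg_def)
  obtain \<Phi> where ch: "quantum_channel reg \<Phi>"
    and rec: "\<And>\<psi>. \<psi> \<in> code \<Longrightarrow> chan_ext reg {} \<Phi> (erase (reg \<union> {}) (Qreg T) (proj \<psi>)) = proj \<psi>"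
  proof (rule erasure_recovery[of reg "{}" "Qreg T" stab_labels code])
    show "isotropic_group (reg \<union> {}) stab_labels" using isotropic_group_stab_labels by simp
    show "fst s \<in> supported reg \<and> snd s \<in> supported reg" if "s \<in> stab_labels" for s
      using that by (auto simp: stab_labels_def)
    show "code \<subseteq> hilb (reg \<union> {})" by (auto simp: code_eq_fixed)
    show "weyl (reg \<union> {}) s \<psi> = \<psi>" if "\<psi> \<in> code" "s \<in> stab_labels" for \<psi> s
      using that by (simp add: code_eq_fixed)
    show "weyl (reg \<union> {}) e \<psi> = \<psi>" if "\<psi> \<in> code" "e \<in> supported (Qreg T) \<times> supported (Qreg T)"
      "\<And>s. s \<in> stab_labels \<Longrightarrow> add_char (symp_form (reg \<union> {}) s e) = 1" for \<psi> e
      using undetected_error_trivial[OF that(1) T that(2) _ rowsX rowsZ] that(3) by simp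
  qed (use TA in auto)
  have lin: "linear_on_opers reg \<Phi>" using ch by (simp add: quantum_channel_def)
  have "\<Phi> (erase reg (Qreg T) (proj \<psi>)) = proj \<psi>" if "\<psi> \<in> code" for \<psi>
    using rec[OF that] chan_ext_empty[OF lin erase_in_opers[OF TA]] by simp
  then show ?thesis unfolding corrects_erasure_def Let_def using ch by blast
qed

text \<open>Bob's qudits belong to the recovery register, so the extended rows of \<open>hX\<close>
  and \<open>hZ\<close> are supported on it whatever their Bob parts are. An error at
  \<open>i\<close> meets them only in the nonzero entries \<open>hX $ i\<close> and
  \<open>hZ $ i\<close>, which expose both of its parts.\<close>

lemma recovery_set_code:
  assumes hX: "hX \<in> (*\<^sub>v) HX\<^sup>T ` carrier_vec mX" and hZ: "hZ \<in> (*\<^sub>v) HZ\<^sup>T ` carrier_vec mZ"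
    and i: "i \<in> supp hX \<inter> supp hZ"
  shows "recovery_set n c code i ((supp hX \<union> supp hZ) - {i})"
proof -
  let ?R = "(supp hX \<union> supp hZ) - {i}"
  obtain u v where u: "u \<in> carrier_vec mX" "hX = HX\<^sup>T *\<^sub>v u" and v: "v \<in> carrier_vec mZ" "hZ = HZ\<^sup>T *\<^sub>v v"
    using hX hZ by blast
  have hc: "hX \<in> carrier_vec n" "hZ \<in> carrier_vec n" using u v by auto
  have ins: "insert i ?R = supp hX \<union> supp hZ" using i by auto
  have sub: "supp hX \<union> supp hZ \<subseteq> {..<n}" using hc by (auto simp: supp_def)
  have RI: "?R \<subseteq> {..<n} - {i}" and lt: "i < n" using sub i by auto
  let ?L = "Qreg (insert i ?R) \<union> Breg c" and ?E = "Qreg ({..<n} - insert i ?R)"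
  have LE: "?L \<union> ?E = reg" using sub unfolding ins by (auto simp: set_eq_iff site_forall)
  \<comment> \<open>All multiples are included: a single operator reveals only a trace, all of them
    together reveal the error symbol.\<close>
  define S where "S = range (\<lambda>(\<alpha>, \<beta>). ((\<lambda>s. \<alpha> * rowX u s), (\<lambda>s. \<beta> * rowZ v s)))"
  have memS: "((\<lambda>s. \<alpha> * rowX u s), (\<lambda>s. \<beta> * rowZ v s)) \<in> S" for \<alpha> \<beta>
    unfolding S_def by (rule range_eqI[of _ _ "(\<alpha>, \<beta>)"]) simp
  have Sstab: "S \<subseteq> stab_labels"
  proof
    fix s assume "s \<in> S"
    then obtain \<alpha> \<beta> where "s = (rowX (\<alpha> \<cdot>\<^sub>v u), rowZ (\<beta> \<cdot>\<^sub>v v))"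
      using u v by (auto simp: S_def rowX_smult rowZ_smult)
    then show "s \<in> stab_labels" using u v unfolding stab_labels_def by auto
  qed
  have iso: "isotropic_group reg S"
  proof (rule isotropic_group_subset[OF Sstab])
    show "0 \<in> S" using memS[of 0 0] by (simp add: zero_prod_def zero_fun_def)
    show "- s \<in> S" if "s \<in> S" for s
    proof -
      obtain \<alpha> \<beta> where s: "s = ((\<lambda>s. \<alpha> * rowX u s), (\<lambda>s. \<beta> * rowZ v s))"
        using \<open>s \<in> S\<close> by (auto simp: S_def)
      then have "- s = ((\<lambda>s. - \<alpha> * rowX u s), (\<lambda>s. - \<beta> * rowZ v s))" by (simp add: fun_eq_iff)
      then show ?thesis using memS[of "- \<alpha>" "- \<beta>"] by simp
    qed
    show "s + t \<in> S" if "s \<in> S" "t \<in> S" for s t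
    proof -
      obtain \<alpha> \<beta> \<alpha>' \<beta>' where s: "s = ((\<lambda>s. \<alpha> * rowX u s), (\<lambda>s. \<beta> * rowZ v s))"
        and t: "t = ((\<lambda>s. \<alpha>' * rowX u s), (\<lambda>s. \<beta>' * rowZ v s))"
        using \<open>s \<in> S\<close> \<open>t \<in> S\<close> by (auto simp: S_def)
      then have "s + t = ((\<lambda>s. (\<alpha> + \<alpha>') * rowX u s), (\<lambda>s. (\<beta> + \<beta>') * rowZ v s))"
        by (simp add: fun_eq_iff algebra_simps)
      then show ?thesis using memS[of "\<alpha> + \<alpha>'" "\<beta> + \<beta>'"] by simp
    qed
  qed
  have lL: "rowX u \<in> supported ?L" "rowZ v \<in> supported ?L"
    unfolding ins supported_def site_forall rowX_def rowZ_def u(2)[symmetric] v(2)[symmetric]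
    using hc by (auto simp: supp_def)
  have supS: "fst s \<in> supported ?L \<and> snd s \<in> supported ?L" if "s \<in> S" for s
    using that lL by (auto simp: S_def supported_def)
  have dot: "dotp reg (rowZ v) f = hZ $ i * f (Tx i)" "dotp reg (rowX u) f = hX $ i * f (Tx i)"
    if f: "f \<in> supported (Qreg {i})" for f
  proof -
    have 0: "f (Bob j) = 0" "j \<noteq> i \<Longrightarrow> f (Tx j) = 0" for j using f by (auto simp: supported_def)
    have "(\<Sum>j<n. h $ j * f (Tx j)) = h $ i * f (Tx i)" for h :: "'a vec"
      using lt by (subst sum.remove[of _ i]) (auto simp: 0 intro!: sum.neutral)
    then show "dotp reg (rowZ v) f = hZ $ i * f (Tx i)" "dotp reg (rowX u) f = hX $ i * f (Tx i)"
      unfolding rowX_def rowZ_def dotp_conf_of_left u(2)[symmetric] v(2)[symmetric] by (simp_all add: 0)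
  qed
  have triv: "e = 0" if e: "e \<in> supported (Qreg {i}) \<times> supported (Qreg {i})"
    and com: "\<And>s. s \<in> S \<Longrightarrow> add_char (symp_form reg s e) = 1" for e
  proof -
    have fe: "fst e \<in> supported (Qreg {i})" "snd e \<in> supported (Qreg {i})" using e by auto
    have nz: "hX $ i \<noteq> 0" "hZ $ i \<noteq> 0" using i by (auto simp: supp_def)
    have "dotp reg (rowZ v) (fst e) = 0"
    proof (rule add_char_mult_eq_1_imp)
      fix t
      have "symp_form reg ((\<lambda>s. 0 * rowX u s), (\<lambda>s. t * rowZ v s)) e = t * dotp reg (rowZ v) (fst e)"
        by (simp add: symp_form_def dotp_def sum_distrib_left mult.assoc)
      then show "add_char (t * dotp reg (rowZ v) (fst e)) = 1" using com[OF memS[of 0 t]] by simp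
    qed
    moreover have "dotp reg (rowX u) (snd e) = 0"
    proof (rule add_char_mult_eq_1_imp)
      fix t
      \<comment> \<open>The sign of \<open>t\<close> compensates the minus in
        \<open>symp_form\<close>.\<close>
      have "symp_form reg ((\<lambda>s. - t * rowX u s), (\<lambda>s. 0 * rowZ v s)) e = t * dotp reg (rowX u) (snd e)"
        by (simp add: symp_form_def dotp_def sum_distrib_left sum_negf mult_ac)
      then show "add_char (t * dotp reg (rowX u) (snd e)) = 1" using com[OF memS[of "- t" 0]] by simp
    qed
    ultimately have "fst e (Tx i) = 0" "snd e (Tx i) = 0" using dot fe nz by auto
    then have "f s = 0" if "f \<in> {fst e, snd e}" for f s
      using that fe unfolding supported_def by (cases "s = Tx i") (auto simp: Qreg_def)
    then have "fst e = 0" "snd e = 0" by (auto simp: fun_eq_iff)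
    then show ?thesis by (simp add: prod_eq_iff)
  qed
  obtain \<Phi> where "quantum_channel ?L \<Phi>"
    and "\<And>\<psi>. \<psi> \<in> code \<Longrightarrow> chan_ext ?L ?E \<Phi> (erase (?L \<union> ?E) (Qreg {i}) (proj \<psi>)) = proj \<psi>"
  proof (rule erasure_recovery[of ?L ?E "Qreg {i}" S code])
    show "isotropic_group (?L \<union> ?E) S" unfolding LE by (rule iso)
    show "fst s \<in> supported ?L \<and> snd s \<in> supported ?L" if "s \<in> S" for s by (rule supS[OF that])
    show "code \<subseteq> hilb (?L \<union> ?E)" unfolding LE by (auto simp: code_eq_fixed)
    show "weyl (?L \<union> ?E) s \<psi> = \<psi>" if "\<psi> \<in> code" "s \<in> S" for \<psi> s
      unfolding LE using that Sstab by (auto simp: code_eq_fixed)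
    show "weyl (?L \<union> ?E) e \<psi> = \<psi>" if "\<psi> \<in> code" "e \<in> supported (Qreg {i}) \<times> supported (Qreg {i})"
      "\<And>s. s \<in> S \<Longrightarrow> add_char (symp_form (?L \<union> ?E) s e) = 1" for \<psi> e
      using triv[OF that(2)] that(3) unfolding LE by simp
  qed (auto simp: Qreg_def)
  then show ?thesis unfolding recovery_set_def Let_def LE[symmetric] using RI by blast
qed

end

theorem theorem2:
  fixes CX CZ :: "'a :: {finite, field} vec set"
    and HX HZ FX FZ :: "'a mat"
    and n kX dX kZ dZ c \<delta> :: nat
    and r :: int
  assumes "linear_code n kX dX CX" and "linear_code n kZ dZ CZ"
    and "parity_check_matrix n kX CX HX" and "parity_check_matrix n kZ CZ HZ"
    and "c = vec_space.rank (n - kX) (HX * HZ\<^sup>T)"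
    and "FX \<in> carrier_mat (n - kX) c" and "FZ \<in> carrier_mat (n - kZ) c"
    and "- (HX * HZ\<^sup>T) = FX * FZ\<^sup>T"
    and "\<forall>i<n. \<exists>hX\<in>dual n CX. \<exists>hZ\<in>dual n CZ.
           i \<in> supp hX \<inter> supp hZ \<and> int (card (supp hX \<union> supp hZ)) \<le> r + 1"
    and "\<delta> = (if CX \<subseteq> dual n CZ then min dX dZ
              else min (wt (CX - (CX \<inter> dual n CZ))) (wt (CZ - (dual n CX \<inter> CZ))))"
  shows "int c = int n - int kX - int (code_dim n (dual n CX \<inter> CZ)) \<and>
         int c = int n - int kZ - int (code_dim n (CX \<inter> dual n CZ)) \<and>
         (\<exists>\<kappa>::nat. int \<kappa> = int kX + int kZ - int n + int c \<and>
            eaqlrc n \<kappa> \<delta> c r (ea_css n c HX HZ FX FZ))"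
proof -
  note X = parity_check_facts[OF assms(1,3)] and Z = parity_check_facts[OF assms(2,4)]
  interpret ea_css_matrices n c "n - kX" "n - kZ" HX HZ FX FZ
    by (rule ea_css_matricesI[OF X(2) Z(2) assms(6,7,5,8) X(6) Z(6)])
  have "n - kX = code_dim n (dual n CX \<inter> CZ) + c"
    using code_dim_rows_inter_kernel unfolding X(5) Z(3) .
  then have dim1: "int c = int n - int kX - int (code_dim n (dual n CX \<inter> CZ))" using X(1) by simp
  have "n - kZ = code_dim n (dual n CZ \<inter> CX) + c"
    using ea_css_matrices.code_dim_rows_inter_kernel[OF ea_css_matrices_swap] unfolding Z(5) X(3) .
  then have dim2: "int c = int n - int kZ - int (code_dim n (CX \<inter> dual n CZ))"
    using Z(1) by (simp add: Int_commute)
  \<comment> \<open>\<open>checks_le\<close> makes the truncated subtraction exact.\<close>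
  define \<kappa> where "\<kappa> = n + c - (n - kX) - (n - kZ)"
  have dims: "\<kappa> + (n - kX) + (n - kZ) = n + c" using checks_le by (simp add: \<kappa>_def)
  obtain lbl where lbl: "ea_css_encoding n c (n - kX) (n - kZ) HX HZ FX FZ \<kappa> lbl"
  proof (rule exists_logical_labelling[OF dims])
    fix lbl :: "'a conf \<Rightarrow> 'a conf"
    assume "\<And>x. x \<in> code_support \<Longrightarrow> lbl x \<in> confs (Qreg {..<\<kappa>})"
      "\<And>k. k \<in> confs (Qreg {..<\<kappa>}) \<Longrightarrow> \<exists>x\<in>code_support. lbl x = k"
      "\<And>x y. x \<in> code_support \<Longrightarrow> y \<in> code_support \<Longrightarrow> lbl x = lbl y \<longleftrightarrow> y \<in> coset x"
    then have "ea_css_encoding n c (n - kX) (n - kZ) HX HZ FX FZ \<kappa> lbl"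
      using dims by unfold_locales
    then show thesis by (rule that)
  qed
  have finC: "finite CX" "finite CZ" and subC: "CX \<subseteq> carrier_vec n" "CZ \<subseteq> carrier_vec n"
    using X(3) Z(3) mat_kernelD(1)[OF X(2)] mat_kernelD(1)[OF Z(2)]
    by (auto intro!: finite_subset[OF _ finite_carrier_vec[of n]])
  \<comment> \<open>By symmetry of the scalar product, \<open>CX \<subseteq> dual n CZ\<close> also
    puts \<open>CZ\<close> into the dual of \<open>CX\<close>, so in the first case of
    \<open>\<delta>\<close> both inclusions hold for all codewords.\<close>
  have orthogonal_if: "a \<in> dual n D"
    if "D \<subseteq> dual n C" "a \<in> C" "C \<subseteq> carrier_vec n" for C D :: "'a vec set" and a
    unfolding mem_dual_iff
  proof (intro conjI ballI)
    show a: "a \<in> carrier_vec n" using that by auto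
    fix y assume "y \<in> D"
    then have "y \<in> carrier_vec n" "y \<bullet> a = 0" using that by (auto simp: mem_dual_iff)
    then show "a \<bullet> y = 0" using comm_scalar_prod[OF a] by metis
  qed
  \<comment> \<open>If the claim failed, \<open>a\<close> itself would be a nonzero word of
    \<open>C - D\<close>, so \<open>wt\<close> is a true minimum in the comparison that refutes
    it.\<close>
  have light: "a \<in> D" if "a \<in> C" "C \<subseteq> carrier_vec n" "finite C" "0\<^sub>v n \<in> D"
    "card (supp a) < wt (C - D)" for C D :: "'a vec set" and a
  proof (rule ccontr)
    assume "a \<notin> D"
    then have "a \<noteq> 0\<^sub>v n" using that(4) by metis
    moreover have "a = 0\<^sub>v n" if "supp a = {}"
      using that \<open>a \<in> C\<close> \<open>C \<subseteq> carrier_vec n\<close> by (intro eq_vecI) (auto simp: supp_def)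
    ultimately have "supp a \<noteq> {}" by blast
    then have "wt (C - D) \<le> card (supp a)" using that \<open>a \<notin> D\<close> by (intro wt_le) auto
    with that(5) show False by simp
  qed
  have zero: "0\<^sub>v n \<in> dual n C" if "C \<subseteq> carrier_vec n" for C :: "'a vec set"
    using that by (auto simp: mem_dual_iff)
  have rows: "(a \<in> CZ \<longrightarrow> a \<in> dual n CX) \<and> (a \<in> CX \<longrightarrow> a \<in> dual n CZ)"
    if T: "T \<subseteq> {..<n}" "card T < \<delta>" "supp a \<subseteq> T" for T a
  proof (cases "CX \<subseteq> dual n CZ")
    case True
    then show ?thesis using orthogonal_if[OF True _ subC(2)] by blast
  next
    case False
    have "card (supp a) \<le> card T" using T finite_subset by (intro card_mono) auto
    then have "card (supp a) < wt (CX - dual n CZ)" "card (supp a) < wt (CZ - dual n CX)"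
      using T(2) False assms(10) by (auto simp: Diff_Int)
    then show ?thesis
      using light[OF _ subC(1) finC(1) zero[OF subC(2)]] light[OF _ subC(2) finC(2) zero[OF subC(1)]] by blast
  qed
  have "corrects_erasure n c (ea_css n c HX HZ FX FZ) T" if T: "T \<subseteq> {..<n}" "card T < \<delta>" for T
  proof (rule corrects_erasure_code[OF T(1)])
    show "a \<in> (*\<^sub>v) HX\<^sup>T ` carrier_vec (n - kX)" if "a \<in> mat_kernel HZ" "supp a \<subseteq> T" for a
      using rows[OF T that(2)] that(1) X(5) Z(3) by metis
    show "b \<in> (*\<^sub>v) HZ\<^sup>T ` carrier_vec (n - kZ)" if "b \<in> mat_kernel HX" "supp b \<subseteq> T" for b
      using rows[OF T that(2)] that(1) Z(5) X(3) by metis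
  qed
  moreover obtain U where "unitary_on (Qreg {..<n}) U"
    "\<And>\<phi>. st_norm reg (encode n \<kappa> c U \<phi>) = st_norm (Qreg {..<\<kappa>}) \<phi>"
    "ea_css n c HX HZ FX FZ = encode n \<kappa> c U ` hilb (Qreg {..<\<kappa>})"
    using ea_css_encoding.exists_encoding_unitary[OF lbl] by blast
  moreover have "\<kappa> + c \<le> n" by (rule ea_css_encoding.logical_plus_ebits_le[OF lbl])
  ultimately have "eaqecc n \<kappa> \<delta> c (ea_css n c HX HZ FX FZ)"
    unfolding eaqecc_def by auto
  moreover have "\<exists>R. recovery_set n c (ea_css n c HX HZ FX FZ) i R \<and> int (card R) \<le> r" if i: "i < n" for i
  proof -
    obtain hX hZ where h: "hX \<in> dual n CX" "hZ \<in> dual n CZ" "i \<in> supp hX \<inter> supp hZ"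
      and card: "int (card (supp hX \<union> supp hZ)) \<le> r + 1" using assms(9) i by blast
    have "recovery_set n c (ea_css n c HX HZ FX FZ) i ((supp hX \<union> supp hZ) - {i})"
      using h X(5) Z(5) by (intro recovery_set_code) auto
    \<comment> \<open>Removing \<open>i\<close>, which lies in both supports, accounts for the 1 in
      \<open>r + 1\<close>.\<close>
    moreover have "card (supp hX \<union> supp hZ) = Suc (card ((supp hX \<union> supp hZ) - {i}))"
      using h(3) by (intro card.remove) auto
    then have "int (card ((supp hX \<union> supp hZ) - {i})) \<le> r" using card by simp
    ultimately show ?thesis by blast
  qed
  moreover have "int \<kappa> = int kX + int kZ - int n + int c"
    using dims X(1) Z(1) by linarith
  ultimately show ?thesis using dim1 dim2 unfolding eaqlrc_def by blast
qed

end
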